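(* Let $X=\Gamma\backslash\mathbb{H}$ be a hyperbolic Riemann surface of finite volume, where $\Gamma\subset\mathrm{PSL}_2(\mathbb{R})$ is a cofinite Fuchsian subgroup, and for $k\geq 3$ let $\|\mathcal{B}^k_{\Omega_X}\|_{\mathrm{hyp}}(z,z)$ be the pointwise hyperbolic norm, on the diagonal, of the Bergman kernel of $\Omega_X^{\otimes k}$. (1) If $X$ is compact, then for $z\in X$ $$\|\mathcal{B}^k_{\Omega_X}\|_{\mathrm{hyp}}(z,z)=O_X(k).$$ (2) If $X$ is noncompact, then for any $z\in X$ $$\|\mathcal{B}^k_{\Omega_X}\|_{\mathrm{hyp}}(z,z)=O\big(k^{3/2}\big).$$
   Context: $\mathbb{H}=\{z=x+iy: y>0\}$ is the upper half-plane, on which $\Gamma$ acts by fractional linear transformations; points of $X=\Gamma\backslash\mathbb{H}$ are denoted by the same letters as points of $\mathbb{H}$ representing them. The notation $O_X$ means that the implied constant depends on $X$ (and not on $k$ or $z$); $O$ is written without a subscript. When $X$ is noncompact, it is normalized, without loss of generality, so that $i\infty$ is its only puncture. $\Omega_X$ is the cotangent bundle of holomorphic differential $1$-forms on $X$. The Bergman kernel of $\Omega_X^{\otimes k}$ is given by $$\mathcal{B}^k_{\Omega_X}(z,w)=\frac{(2k-1)(2i)^{2k}}{4\pi}\sum_{\gamma\in\Gamma}\frac{1}{(\gamma z-\overline{w})^{2k}}\cdot\frac{dz^{\otimes k}\wedge d\overline{w}^{\otimes k}}{j(\gamma,z)^{2k}},$$ where $j(\gamma,z)=cz+d$ for $\gamma=\begin{pmatrix}a&b\\c&d\end{pmatrix}$,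 and its pointwise hyperbolic norm at $z=x+iy$, $w=u+iv$ is $$\|\mathcal{B}^k_{\Omega_X}\|_{\mathrm{hyp}}(z,w)=\frac{(2k-1)(4yv)^k}{4\pi}\left|\sum_{\gamma\in\Gamma}\frac{1}{(\gamma z-\overline{w})^{2k}}\cdot\frac{1}{j(\gamma,z)^{2k}}\right|.$$
   Formalization: In (2), the O-constant is absolute only for k beyond a bound depending on X, and for all k≥3 it may depend on X; a bound uniform in both X and k≥3 fails (Hecke group (2,m,∞) at its order-m elliptic point with k=m gives size k²/(2π)). *)

theory Defs
  imports "HOL-Analysis.Analysis" "HOL-Algebra.Group_Action"
begin

section \<open>The group \<open>PSL\<^sub>2(\<real>)\<close>\<close>

definition SL2 :: "(real^2^2) monoid" where
  "SL2 = \<lparr>carrier = {A. det A = 1}, mult = (**), one = mat 1\<rparr>"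

text \<open>Elements of \<open>PSL2\<close> are the cosets \<open>{A, -A}\<close>; a subgroup of \<open>PSL2\<close> is a set of such cosets.\<close>

definition PSL2 :: "(real^2^2) set monoid" where
  "PSL2 = SL2 Mod {mat 1, - mat 1}"

lemma SL2_simps [simp]:
  "carrier SL2 = {A. det A = 1}" "mult SL2 = (**)" "one SL2 = mat 1"
  by (simp_all add: SL2_def)

lemma group_SL2: "group SL2"
proof (rule groupI)
  fix A assume A: "A \<in> carrier SL2"
  then obtain B where "A ** B = mat 1" "B ** A = mat 1"
    using invertible_det_nz[of A] by (auto simp: invertible_def)
  moreover from this have "det B = 1"
    using A det_mul[of A B] by simp
  ultimately show "\<exists>B\<in>carrier SL2. B \<otimes>\<^bsub>SL2\<^esub> A = \<one>\<^bsub>SL2\<^esub>" by auto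
qed (auto simp: det_mul matrix_mul_assoc)

lemma det_uminus_2: "det (- A :: real^2^2) = det A"
  by (simp add: det_2)

lemma matrix_mul_uminus:
  "(- A) ** B = - (A ** B :: real^2^2)" "A ** (- B) = - (A ** B :: real^2^2)"
  by (simp_all add: matrix_matrix_mult_def vec_eq_iff sum_negf)

lemma normal_center_SL2: "{mat 1, - mat 1} \<lhd> SL2"
proof -
  interpret group SL2 by (rule group_SL2)
  have inv1: "inv\<^bsub>SL2\<^esub> (- mat 1) = - mat 1"
    by (rule inv_equality) (auto simp: matrix_mul_uminus det_uminus_2)
  have "subgroup {mat 1, - mat 1} SL2"
    by unfold_locales (use inv1 inv_one in \<open>auto simp: matrix_mul_uminus det_uminus_2\<close>)
  then show ?thesis
    using r_inv by (auto simp: normal_inv_iff matrix_mul_uminus)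
qed

lemma group_PSL2: "group PSL2"
  unfolding PSL2_def by (rule normal.factorgroup_is_group[OF normal_center_SL2])

lemma carrier_PSL2: "carrier PSL2 = {{A, - A} | A. det A = 1}"
  by (auto simp: PSL2_def carrier_FactGroup r_coset_def matrix_mul_uminus)

lemma one_PSL2: "one PSL2 = {mat 1, - mat 1}"
  by (simp add: PSL2_def)

text \<open>
  A representative of a coset. All quantities below are unchanged when it is replaced by its negative.
\<close>

definition rep :: "(real^2^2) set \<Rightarrow> real^2^2" where
  "rep g = (SOME A. A \<in> g)"

lemma rep_cases:
  assumes "g \<in> carrier PSL2"
  obtains "det (rep g) = 1" "g = {rep g, - rep g}"
proof -
  from assms obtain A where A: "det A = 1" "g = {A, - A}"
    by (auto simp: carrier_PSL2)
  have "rep g \<in> g"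
    unfolding rep_def by (rule someI[of _ A]) (simp add: A)
  with A that show ?thesis by (auto simp: det_uminus_2 insert_commute)
qed


section \<open>The actions on the upper half-plane and on its boundary\<close>

definition upper_half_plane :: "complex set" where
  "upper_half_plane = {z. Im z > 0}"

definition automorphy :: "real^2^2 \<Rightarrow> complex \<Rightarrow> complex" where
  "automorphy A z = of_real (A$2$1) * z + of_real (A$2$2)"

definition moebius :: "real^2^2 \<Rightarrow> complex \<Rightarrow> complex" where
  "moebius A z = (of_real (A$1$1) * z + of_real (A$1$2)) / automorphy A z"

definition psl_act :: "(real^2^2) set \<Rightarrow> complex \<Rightarrow> complex" where
  "psl_act g = moebius (rep g)"

lemma automorphy_uminus: "automorphy (- A) z = - automorphy A z"
  by (simp add: automorphy_def)

lemma moebius_uminus: "moebius (- A) = moebius A"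
proof
  fix z
  have "moebius (- A) z = (- (of_real (A$1$1) * z + of_real (A$1$2))) / (- automorphy A z)"
    by (simp add: moebius_def automorphy_uminus)
  then show "moebius (- A) z = moebius A z"
    unfolding moebius_def by (metis minus_divide_divide)
qed

text \<open>
  The boundary \<open>\<real> \<union> {i\<infinity>}\<close> is modelled by the type \<open>real option\<close>, where \<open>None\<close> stands for \<open>i\<infinity>\<close>.
\<close>

fun moebius_boundary :: "real^2^2 \<Rightarrow> real option \<Rightarrow> real option" where
  "moebius_boundary A None =
     (if A$2$1 = 0 then None else Some (A$1$1 / A$2$1))"
| "moebius_boundary A (Some x) =
     (if A$2$1 * x + A$2$2 = 0 then None
      else Some ((A$1$1 * x + A$1$2) / (A$2$1 * x + A$2$2)))"

definition psl_boundary_act :: "(real^2^2) set \<Rightarrow> real option \<Rightarrow> real option" where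
  "psl_boundary_act g = moebius_boundary (rep g)"


section \<open>Cofinite Fuchsian groups and their quotients\<close>

text \<open>
  The topology of \<open>PSL2\<close> is the quotient topology of that of \<open>SL2\<close>, and the projection has finite
  fibres \<open>{A, -A}\<close>, so \<open>\<Gamma>\<close> is discrete iff its preimage \<open>\<Union>\<Gamma>\<close> is discrete in the space of matrices.
\<close>

definition fuchsian :: "(real^2^2) set set \<Rightarrow> bool" where
  "fuchsian \<Gamma> \<longleftrightarrow> subgroup \<Gamma> PSL2 \<and> discrete (\<Union>\<Gamma>)"

definition hyperbolic_area :: "complex measure" where
  "hyperbolic_area =
     density lborel (\<lambda>z. ennreal (1 / (Im z)\<^sup>2) * indicator upper_half_plane z)"

definition fundamental_domain :: "(real^2^2) set set \<Rightarrow> complex set \<Rightarrow> bool" where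
  "fundamental_domain \<Gamma> F \<longleftrightarrow>
     F \<in> sets borel \<and> F \<subseteq> upper_half_plane \<and>
     (\<Union>g\<in>\<Gamma>. psl_act g ` F) = upper_half_plane \<and>
     (\<forall>g\<in>\<Gamma>. g \<noteq> \<one>\<^bsub>PSL2\<^esub> \<longrightarrow> psl_act g ` F \<inter> F \<in> null_sets hyperbolic_area)"

definition cofinite_fuchsian :: "(real^2^2) set set \<Rightarrow> bool" where
  "cofinite_fuchsian \<Gamma> \<longleftrightarrow> fuchsian \<Gamma> \<and>
     (\<exists>F. fundamental_domain \<Gamma> F \<and> emeasure hyperbolic_area F < \<infinity>)"

definition orbit_map :: "(real^2^2) set set \<Rightarrow> complex \<Rightarrow> complex set" where
  "orbit_map \<Gamma> = orbit (PSL2\<lparr>carrier := \<Gamma>\<rparr>) psl_act"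

definition quotient_surface :: "(real^2^2) set set \<Rightarrow> complex set topology" where
  "quotient_surface \<Gamma> = topology (\<lambda>U. U \<subseteq> orbit_map \<Gamma> ` upper_half_plane \<and>
     openin (top_of_set upper_half_plane) {z \<in> upper_half_plane. orbit_map \<Gamma> z \<in> U})"

lemma openin_quotient_surface:
  "openin (quotient_surface \<Gamma>) U \<longleftrightarrow> U \<subseteq> orbit_map \<Gamma> ` upper_half_plane \<and>
     openin (top_of_set upper_half_plane) {z \<in> upper_half_plane. orbit_map \<Gamma> z \<in> U}"
    (is "_ \<longleftrightarrow> ?P U")
proof -
  have "istopology ?P"
    unfolding istopology_def
  proof (intro conjI allI impI)
    fix S T assume "?P S" "?P T"
    moreover have "{z \<in> upper_half_plane. orbit_map \<Gamma> z \<in> S \<inter> T} =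
        {z \<in> upper_half_plane. orbit_map \<Gamma> z \<in> S} \<inter> {z \<in> upper_half_plane. orbit_map \<Gamma> z \<in> T}"
      by auto
    ultimately show "S \<inter> T \<subseteq> orbit_map \<Gamma> ` upper_half_plane"
        "openin (top_of_set upper_half_plane) {z \<in> upper_half_plane. orbit_map \<Gamma> z \<in> S \<inter> T}"
      by auto
  next
    fix \<K> assume K: "\<forall>K\<in>\<K>. ?P K"
    then show "\<Union>\<K> \<subseteq> orbit_map \<Gamma> ` upper_half_plane" by auto
    have "{z \<in> upper_half_plane. orbit_map \<Gamma> z \<in> \<Union>\<K>} =
        (\<Union>K\<in>\<K>. {z \<in> upper_half_plane. orbit_map \<Gamma> z \<in> K})"
      by auto
    with K show "openin (top_of_set upper_half_plane) {z \<in> upper_half_plane. orbit_map \<Gamma> z \<in> \<Union>\<K>}"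
      by auto
  qed
  then show ?thesis
    by (simp add: quotient_surface_def topology_inverse')
qed

lemma topspace_quotient_surface:
  "topspace (quotient_surface \<Gamma>) = orbit_map \<Gamma> ` upper_half_plane"
proof -
  have "{z \<in> upper_half_plane. orbit_map \<Gamma> z \<in> orbit_map \<Gamma> ` upper_half_plane} = upper_half_plane"
    by auto
  then have "openin (quotient_surface \<Gamma>) (orbit_map \<Gamma> ` upper_half_plane)"
    using openin_topspace[of "top_of_set upper_half_plane"] by (simp add: openin_quotient_surface)
  then show ?thesis
    by (metis openin_quotient_surface openin_subset openin_topspace subset_antisym)
qed

lemma quotient_map_orbit_map:
  "quotient_map (top_of_set upper_half_plane) (quotient_surface \<Gamma>) (orbit_map \<Gamma>)"
  by (auto simp: quotient_map_def topspace_quotient_surface openin_quotient_surface)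

text \<open>The punctures of the quotient are the orbits of the parabolic fixed points.\<close>

definition parabolic :: "(real^2^2) set \<Rightarrow> bool" where
  "parabolic g \<longleftrightarrow> g \<noteq> \<one>\<^bsub>PSL2\<^esub> \<and> \<bar>trace (rep g)\<bar> = 2"

definition cusps :: "(real^2^2) set set \<Rightarrow> real option set" where
  "cusps \<Gamma> = {p. \<exists>g\<in>\<Gamma>. parabolic g \<and> psl_boundary_act g p = p}"

definition punctures :: "(real^2^2) set set \<Rightarrow> real option set set" where
  "punctures \<Gamma> = orbit (PSL2\<lparr>carrier := \<Gamma>\<rparr>) psl_boundary_act ` cusps \<Gamma>"

definition infinity_only_puncture :: "(real^2^2) set set \<Rightarrow> bool" where
  "infinity_only_puncture \<Gamma> \<longleftrightarrow>
     punctures \<Gamma> = {orbit (PSL2\<lparr>carrier := \<Gamma>\<rparr>) psl_boundary_act None}"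


section \<open>The Bergman kernel\<close>

definition bergman_series :: "(real^2^2) set set \<Rightarrow> nat \<Rightarrow> complex \<Rightarrow> complex \<Rightarrow> complex" where
  "bergman_series \<Gamma> k z w = (\<Sum>\<^sub>\<infinity>g\<in>\<Gamma>.
     1 / (psl_act g z - cnj w) ^ (2 * k) * (1 / automorphy (rep g) z ^ (2 * k)))"

text \<open>
  The coefficient of the kernel with respect to \<open>dz^k\<close> and the \<open>k\<close>-th power of the conjugate of \<open>dw\<close>;
  lemma \<open>bergman_norm_eq\<close> relates it to the pointwise hyperbolic norm.
\<close>

definition bergman_kernel :: "(real^2^2) set set \<Rightarrow> nat \<Rightarrow> complex \<Rightarrow> complex \<Rightarrow> complex" where
  "bergman_kernel \<Gamma> k z w =
     of_real (2 * real k - 1) * (2 * \<i>) ^ (2 * k) / of_real (4 * pi) * bergman_series \<Gamma> k z w"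

definition bergman_norm :: "(real^2^2) set set \<Rightarrow> nat \<Rightarrow> complex \<Rightarrow> complex \<Rightarrow> real" where
  "bergman_norm \<Gamma> k z w =
     (2 * real k - 1) * (4 * Im z * Im w) ^ k / (4 * pi) * cmod (bergman_series \<Gamma> k z w)"

lemma bergman_norm_eq:
  assumes "k \<ge> 1"
  shows "bergman_norm \<Gamma> k z w = cmod (bergman_kernel \<Gamma> k z w) * (Im z * Im w) ^ k"
proof -
  have "cmod (of_real (2 * real k - 1)) = 2 * real k - 1"
    unfolding norm_of_real using assms by simp
  moreover have "cmod ((2 * \<i>) ^ (2 * k)) = 4 ^ k"
    by (simp add: norm_power norm_mult power_mult)
  ultimately show ?thesis
    by (simp add: bergman_norm_def bergman_kernel_def norm_mult norm_divide power_mult_distrib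
        del: of_real_diff of_real_mult)
qed

end

theory Submission
  imports Defs
begin

text \<open>
  On the diagonal, the pointwise norm of a single term of the series is
  \<open>cosh (d(z, \<gamma> z) / 2) ^ (- 2 k)\<close>, where \<open>d\<close> is the hyperbolic distance. So up to the factor
  \<open>(2 k - 1) / (4 \<pi>)\<close> the norm of the Bergman kernel is at most the sum of these terms, which is a
  function on the quotient and decreases in \<open>k\<close>. The orbit of \<open>\<i>\<close> meets a hyperbolic box of fixed
  size in boundedly many points, so the sum converges, even when the power \<open>6\<close> of the hyperbolic
  cosine (for \<open>k = 3\<close>) is replaced by \<open>3\<close> (\<open>summable_ppi_orbit\<close>); moving the base point costs a
  factor that is controlled by the distance. On a compact quotient this gives a bound \<open>O(k)\<close>.

  If infinity is a cusp, its stabilizer consists of the translations by the multiples of a width \<open>h\<close>.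
  The absolute values of their terms have a sum of order \<open>1 + y / (h \<surd>k)\<close>, which is not bounded in
  \<open>y = Im z\<close>. The sum of the terms themselves, however, is at most \<open>2 \<pi> \<surd>k\<close> for all \<open>y\<close> and \<open>h\<close>: it
  is a Riemann sum of a function whose integral vanishes, and the error is at most the total variation
  (\<open>cmod_infsum_inverse_powers_le\<close>). This is the source of the exponent \<open>3/2\<close>, with a universal
  constant. The remaining terms contribute \<open>O(1)\<close> in every region \<open>Im z \<ge> Y\<close>, where the bound
  depends on the group (\<open>ex_bound_near_cusp\<close>); it is below \<open>\<surd>k\<close> for large \<open>k\<close>.

  It remains to see that every orbit meets such a region, for some \<open>Y\<close> (\<open>ex_height_bound\<close>). This is
  a case of Siegel's theorem that a group of finite covolume has a fundamental domain whose only ends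
  are cusps. A sequence of orbits of heights tending to zero yields a real number \<open>x\<close> such that
  no point of the vertical line over \<open>x\<close> can be moved up by more than a factor \<open>2\<close>. Finiteness of the
  area implies that low points of this line are moved only a little by some nontrivial element
  (\<open>ex_short_elements\<close>). The shortest such element at a point commutes with all other short ones, so
  the shortest elements along the line share their fixed points, and their common fixed point must
  be \<open>x\<close> (\<open>ex_parabolic_of_short_elements\<close>). So \<open>x\<close> is a cusp, hence equivalent to infinity, and the
  low points over \<open>x\<close> are equivalent to very high ones, a contradiction.
\<close>

section \<open>Matrices and Moebius transformations\<close>

definition mat2 :: "real \<Rightarrow> real \<Rightarrow> real \<Rightarrow> real \<Rightarrow> real^2^2" where
  "mat2 a b c d = vector [vector [a, b], vector [c, d]]"

lemma mat2_nth [simp]: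
  "mat2 a b c d $ 1 $ 1 = a" "mat2 a b c d $ 1 $ 2 = b"
  "mat2 a b c d $ 2 $ 1 = c" "mat2 a b c d $ 2 $ 2 = d"
  by (simp_all add: mat2_def)

lemma mat2_eqI:
  fixes A B :: "real^2^2"
  assumes "A$1$1 = B$1$1" "A$1$2 = B$1$2" "A$2$1 = B$2$1" "A$2$2 = B$2$2"
  shows "A = B"
  using assms by (simp add: vec_eq_iff forall_2)

lemma matmul_nth [simp]:
  fixes A B :: "real^2^2"
  shows "(A ** B) $ i $ j = A$i$1 * B$1$j + A$i$2 * B$2$j"
  by (simp add: matrix_matrix_mult_def sum_2)

lemma mat_1_nth [simp]:
  "(mat 1 :: real^2^2) $ 1 $ 1 = 1" "(mat 1 :: real^2^2) $ 1 $ 2 = 0"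
  "(mat 1 :: real^2^2) $ 2 $ 1 = 0" "(mat 1 :: real^2^2) $ 2 $ 2 = 1"
  by (simp_all add: mat_def)

definition adj2 :: "real^2^2 \<Rightarrow> real^2^2" where
  "adj2 A = mat2 (A$2$2) (- A$1$2) (- A$2$1) (A$1$1)"

lemma adj2_nth [simp]:
  "adj2 A $ 1 $ 1 = A$2$2" "adj2 A $ 1 $ 2 = - A$1$2"
  "adj2 A $ 2 $ 1 = - A$2$1" "adj2 A $ 2 $ 2 = A$1$1"
  by (simp_all add: adj2_def)

lemma adj2_mult:
  assumes "det A = 1"
  shows "A ** adj2 A = mat 1" "adj2 A ** A = mat 1"
  using assms by (auto intro!: mat2_eqI simp: det_2 algebra_simps)

lemma det_adj2 [simp]: "det (adj2 A) = det A"
  by (simp add: det_2 mult.commute)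

lemma adj2_adj2 [simp]: "adj2 (adj2 A) = A"
  by (rule mat2_eqI) auto

section \<open>The Frobenius norm\<close>

lemma norm_mat_sq:
  fixes A :: "real^2^2"
  shows "(norm A)\<^sup>2 = (A$1$1)\<^sup>2 + (A$1$2)\<^sup>2 + (A$2$1)\<^sup>2 + (A$2$2)\<^sup>2"
  by (simp add: norm_vec_def L2_set_def sum_2)

lemma norm_matmul_le:
  fixes A B :: "real^2^2"
  shows "norm (A ** B) \<le> norm A * norm B"
proof -
  have CS: "(x * z + y * w)\<^sup>2 \<le> (x\<^sup>2 + y\<^sup>2) * (z\<^sup>2 + w\<^sup>2)" for x y z w :: real
  proof -
    have "(x\<^sup>2 + y\<^sup>2) * (z\<^sup>2 + w\<^sup>2) - (x * z + y * w)\<^sup>2 = (x * w - y * z)\<^sup>2"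
      by (simp add: power2_eq_square algebra_simps)
    then show ?thesis by (smt (verit) zero_le_power2)
  qed
  have "(norm (A ** B))\<^sup>2 \<le> (norm A * norm B)\<^sup>2"
    unfolding power_mult_distrib norm_mat_sq matmul_nth
    using CS[of "A$1$1" "B$1$1" "A$1$2" "B$2$1"] CS[of "A$1$1" "B$1$2" "A$1$2" "B$2$2"]
      CS[of "A$2$1" "B$1$1" "A$2$2" "B$2$1"] CS[of "A$2$1" "B$1$2" "A$2$2" "B$2$2"]
    by (simp add: algebra_simps)
  then show ?thesis by (rule power2_le_imp_le) simp
qed

lemma norm_adj2 [simp]: "norm (adj2 A) = norm A"
proof -
  have "(norm (adj2 A))\<^sup>2 = (norm A)\<^sup>2" by (simp add: norm_mat_sq)
  then show ?thesis by simp
qed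

lemma norm_mat_1_le: "norm (mat 1 :: real^2^2) \<le> 3/2"
proof -
  have "(norm (mat 1 :: real^2^2))\<^sup>2 \<le> (3/2)\<^sup>2"
    unfolding norm_mat_sq by (simp add: power2_eq_square)
  then show ?thesis by (rule power2_le_imp_le) simp
qed

lemma entry_le_norm:
  fixes A :: "real^2^2"
  shows "\<bar>A$i$j\<bar> \<le> norm A"
  using component_le_norm_cart[of "A$i" j] Finite_Cartesian_Product.norm_nth_le[of A i] by linarith

lemma norm_mat_le_entries:
  fixes A :: "real^2^2"
  shows "norm A \<le> \<bar>A$1$1\<bar> + \<bar>A$1$2\<bar> + \<bar>A$2$1\<bar> + \<bar>A$2$2\<bar>"
proof -
  have "(norm A)\<^sup>2 \<le> (\<bar>A$1$1\<bar> + \<bar>A$1$2\<bar> + \<bar>A$2$1\<bar> + \<bar>A$2$2\<bar>)\<^sup>2"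
    unfolding norm_mat_sq by (simp add: power2_eq_square algebra_simps)
  then show ?thesis by (rule power2_le_imp_le) simp
qed

section \<open>The action on the upper half-plane\<close>

lemma uhp_iff [simp]: "z \<in> upper_half_plane \<longleftrightarrow> Im z > 0"
  by (simp add: upper_half_plane_def)

lemma automorphy_nz:
  assumes "det A = 1" "Im z > 0"
  shows "automorphy A z \<noteq> 0"
proof
  assume "automorphy A z = 0"
  then have "A$2$1 * Im z = 0" "A$2$1 * Re z + A$2$2 = 0"
    by (auto simp: automorphy_def complex_eq_iff)
  with assms show False by (auto simp: det_2)
qed

lemma cmod_automorphy_sq: "(cmod (automorphy A z))\<^sup>2 = (A$2$1 * Re z + A$2$2)\<^sup>2 + (A$2$1 * Im z)\<^sup>2"
  by (simp add: automorphy_def cmod_power2)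

lemma automorphy_mult:
  assumes "det B = 1" "Im z > 0"
  shows "automorphy (A ** B) z = automorphy A (moebius B z) * automorphy B z"
  using automorphy_nz[OF assms]
  by (simp add: moebius_def automorphy_def[of A] automorphy_def[of "A ** B"] field_simps)
     (simp add: automorphy_def algebra_simps)

lemma moebius_diff:
  assumes "det A = 1" "automorphy A z \<noteq> 0" "automorphy A w \<noteq> 0"
  shows "moebius A z - moebius A w = (z - w) / (automorphy A z * automorphy A w)"
proof -
  have d: "complex_of_real (A$1$1 * A$2$2 - A$1$2 * A$2$1) = 1"
    using assms(1) by (simp add: det_2)
  have "(of_real (A$1$1) * z + of_real (A$1$2)) * automorphy A w
      - (of_real (A$1$1) * w + of_real (A$1$2)) * automorphy A z
      = complex_of_real (A$1$1 * A$2$2 - A$1$2 * A$2$1) * (z - w)"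
    by (simp add: automorphy_def algebra_simps)
  with d assms show ?thesis
    unfolding moebius_def by (simp add: diff_frac_eq)
qed

lemma cnj_automorphy: "cnj (automorphy A z) = automorphy A (cnj z)"
  by (simp add: automorphy_def)

lemma cnj_moebius: "cnj (moebius A z) = moebius A (cnj z)"
  by (simp add: moebius_def automorphy_def)

lemma moebius_diff_cnj:
  assumes "det A = 1" "Im z > 0" "Im w > 0"
  shows "moebius A z - cnj (moebius A w) = (z - cnj w) / (automorphy A z * cnj (automorphy A w))"
  using assms moebius_diff[of A z "cnj w"] automorphy_nz[of A z] automorphy_nz[of A w]
  by (metis cnj_automorphy cnj_moebius complex_cnj_zero_iff)

lemma Im_moebius:
  assumes "det A = 1" "Im z > 0"
  shows "Im (moebius A z) = Im z / (cmod (automorphy A z))\<^sup>2"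
proof -
  have "moebius A z - cnj (moebius A z) = (z - cnj z) / of_real ((cmod (automorphy A z))\<^sup>2)"
    using moebius_diff_cnj[OF assms assms(2)] by (simp only: complex_norm_square)
  then have "2 * Im (moebius A z) = 2 * Im z / (cmod (automorphy A z))\<^sup>2"
    by (simp only: complex_diff_cnj) (simp add: complex_eq_iff field_simps)
  then show ?thesis by simp
qed

lemma Im_moebius_pos: "det A = 1 \<Longrightarrow> Im z > 0 \<Longrightarrow> Im (moebius A z) > 0"
  using automorphy_nz[of A z] by (simp add: Im_moebius)

lemma moebius_mult:
  assumes "det A = 1" "det B = 1" "Im z > 0"
  shows "moebius (A ** B) z = moebius A (moebius B z)"
proof -
  have nz: "automorphy B z \<noteq> 0" "automorphy A (moebius B z) \<noteq> 0"
    using assms automorphy_nz Im_moebius_pos by blast+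
  have "of_real ((A ** B)$1$1) * z + of_real ((A ** B)$1$2)
     = (of_real (A$1$1) * moebius B z + of_real (A$1$2)) * automorphy B z"
    using nz(1) by (simp add: moebius_def field_simps) (simp add: automorphy_def algebra_simps)
  with nz show ?thesis
    by (simp add: moebius_def[of "A ** B"] moebius_def[of A] automorphy_mult[OF assms(2,3)])
qed

lemma moebius_mat_1 [simp]: "moebius (mat 1) z = z"
  by (simp add: moebius_def automorphy_def)

lemma moebius_adj2:
  assumes "det A = 1" "Im z > 0"
  shows "moebius (adj2 A) (moebius A z) = z" "moebius A (moebius (adj2 A) z) = z"
  using assms moebius_mult[of "adj2 A" A z] moebius_mult[of A "adj2 A" z] adj2_mult[of A] by auto

section \<open>The point-pair invariant\<close>

text \<open>
  This is \<open>cosh\<^sup>2 (d(z,w)/2)\<close> for the hyperbolic distance \<open>d\<close>. It replaces \<open>d\<close> throughout: it is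
  rational in the coordinates, and the \<open>k\<close>-th powers of its inverse are the moduli of the terms of
  the Bergman kernel.
\<close>

definition ppi :: "complex \<Rightarrow> complex \<Rightarrow> real" where
  "ppi z w = (cmod (z - cnj w))\<^sup>2 / (4 * Im z * Im w)"

lemma ppi_commute: "ppi z w = ppi w z"
proof -
  have "cmod (z - cnj w) = cmod (w - cnj z)"
    by (metis complex_cnj_cnj complex_cnj_diff complex_mod_cnj norm_minus_commute)
  then show ?thesis by (simp add: ppi_def mult_ac)
qed

lemma cmod_diff_cnj_sq: "(cmod (z - cnj w))\<^sup>2 = (Re z - Re w)\<^sup>2 + (Im z + Im w)\<^sup>2"
  by (simp add: cmod_power2)

lemma ppi_alt: "ppi z w = ((Re z - Re w)\<^sup>2 + (Im z + Im w)\<^sup>2) / (4 * Im z * Im w)"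
  by (simp add: ppi_def cmod_diff_cnj_sq)

lemma ppi_ge_1:
  assumes "Im z > 0" "Im w > 0"
  shows "ppi z w \<ge> 1"
proof -
  have "4 * Im z * Im w \<le> (Re z - Re w)\<^sup>2 + (Im z + Im w)\<^sup>2"
    using zero_le_power2[of "Re z - Re w"] zero_le_power2[of "Im z - Im w"]
    by (simp add: power2_eq_square algebra_simps)
  then show ?thesis using assms by (simp add: ppi_alt)
qed

lemma ppi_moebius:
  assumes "det A = 1" "Im z > 0" "Im w > 0"
  shows "ppi (moebius A z) (moebius A w) = ppi z w"
proof -
  have "automorphy A z \<noteq> 0" "automorphy A w \<noteq> 0" using assms automorphy_nz by blast+
  then show ?thesis
    unfolding ppi_def moebius_diff_cnj[OF assms]
    by (simp add: Im_moebius assms norm_divide norm_mult power_divide power_mult_distrib field_simps)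
qed

text \<open>
  The substitute for the triangle inequality, from \<open>cosh (s + t) \<le> 2 cosh s cosh t\<close>; algebraically
  it is Ptolemy's inequality.
\<close>

lemma ppi_triangle:
  assumes "Im a > 0" "Im b > 0" "Im c > 0"
  shows "ppi a c \<le> 4 * ppi a b * ppi b c"
proof -
  have le: "cmod (u - v) \<le> cmod (u - cnj v)" if "Im u > 0" "Im v > 0" for u v
  proof -
    have "(Im u - Im v)\<^sup>2 \<le> (Im u + Im v)\<^sup>2" using that by (simp add: power2_eq_square algebra_simps)
    then have "(cmod (u - v))\<^sup>2 \<le> (cmod (u - cnj v))\<^sup>2" by (simp add: cmod_power2)
    then show ?thesis by (rule power2_le_imp_le) simp
  qed
  have eq: "(a - cnj c) * (b - cnj b) = (a - cnj b) * (b - cnj c) - (a - b) * cnj (b - c)"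
    by (simp add: algebra_simps)
  have "cmod (a - cnj c) * (2 * Im b) = cmod ((a - cnj c) * (b - cnj b))"
    using assms by (simp add: norm_mult complex_diff_cnj)
  also have "\<dots> \<le> cmod (a - cnj b) * cmod (b - cnj c) + cmod (a - b) * cmod (b - c)"
    unfolding eq by (rule order_trans[OF norm_triangle_ineq4])
      (simp add: norm_mult flip: complex_cnj_diff)
  also have "\<dots> \<le> 2 * (cmod (a - cnj b) * cmod (b - cnj c))"
    using mult_mono[OF le[of a b] le[of b c]] assms by simp
  finally have "cmod (a - cnj c) * Im b \<le> cmod (a - cnj b) * cmod (b - cnj c)" by simp
  then have "(cmod (a - cnj c) * Im b)\<^sup>2 \<le> (cmod (a - cnj b) * cmod (b - cnj c))\<^sup>2"
    using assms by (intro power_mono) auto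
  then show ?thesis
    using assms by (simp add: ppi_def power_mult_distrib field_simps power2_eq_square)
qed

lemma ppi_ge_Im_quotient:
  assumes "Im z > 0" "Im w > 0"
  shows "ppi z w \<ge> Im z / (4 * Im w)"
proof -
  have "(Im z)\<^sup>2 \<le> (Re z - Re w)\<^sup>2 + (Im z + Im w)\<^sup>2"
    using assms zero_le_power2[of "Re z - Re w"] power_mono[of "Im z" "Im z + Im w" 2] by linarith
  then show ?thesis using assms by (simp add: ppi_alt field_simps power2_eq_square)
qed

section \<open>The contribution of a cusp\<close>

text \<open>
  The mean value inequality twice: the increment of \<open>G\<close> bounds the variation of the derivative \<open>f\<close>
  over the step, and hence the distance of \<open>F\<close> from its linear approximation at \<open>a\<close>. Summed over all
  steps, the left hand sides compare a series with a telescoping one.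
\<close>

lemma norm_increment_minus_derivative_le:
  fixes F f f' :: "real \<Rightarrow> complex" and G g :: "real \<Rightarrow> real"
  assumes F: "\<And>x. (F has_vector_derivative f x) (at x)"
    and f: "\<And>x. (f has_vector_derivative f' x) (at x)"
    and G: "\<And>x. (G has_vector_derivative g x) (at x)"
    and bound: "\<And>x. cmod (f' x) \<le> g x"
  shows "cmod (F (a + 1) - F a - f a) \<le> G (a + 1) - G a"
proof -
  have contF: "continuous_on S F" and contf: "continuous_on S f" and contG: "continuous_on S G" for S
    using F f G by (meson continuous_at_imp_continuous_on has_vector_derivative_continuous)+
  have inc: "cmod (f y - f x) \<le> G y - G x" if "x < y" for x y
    using that contf contG f G bound by (intro differentiable_bound_general) auto
  have "cmod ((F (a + 1) - (a + 1) *\<^sub>R f a) - (F a - a *\<^sub>R f a))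
      \<le> (a + 1) * (G (a + 1) - G a) - a * (G (a + 1) - G a)"
  proof (rule differentiable_bound_general[where f' = "\<lambda>x. f x - f a" and \<phi>' = "\<lambda>x. G (a + 1) - G a"])
    show "((\<lambda>x. F x - x *\<^sub>R f a) has_vector_derivative f x - f a) (at x)" for x
      by (auto intro!: derivative_eq_intros F)
    show "((\<lambda>x. x * (G (a + 1) - G a)) has_vector_derivative G (a + 1) - G a) (at x)" for x
      by (auto intro!: derivative_eq_intros simp flip: has_real_derivative_iff_has_vector_derivative)
    show "cmod (f x - f a) \<le> G (a + 1) - G a" if "a < x" "x < a + 1" for x
      using inc[OF that(1)] inc[OF that(2)] norm_ge_zero[of "f (a + 1) - f x"] by linarith
  qed (auto intro!: continuous_intros contF)
  then show ?thesis by (simp add: algebra_simps)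
qed

lemma sum_telescope_int:
  fixes F :: "int \<Rightarrow> 'a::ab_group_add"
  shows "(\<Sum>n\<in>{- int N..<int N}. F (n + 1) - F n) = F (int N) - F (- int N)"
proof (induction N)
  case (Suc N)
  have "{- int (Suc N)..<int (Suc N)} = insert (- int (Suc N)) (insert (int N) {- int N..<int N})"
    by auto
  with Suc show ?case by (simp add: add.commute[of 1 "int N"])
qed simp

lemma filterlim_symmetric_interval_int:
  "filterlim (\<lambda>N. {- int N..<int N}) (finite_subsets_at_top UNIV) sequentially"
  unfolding filterlim_iff eventually_finite_subsets_at_top
proof safe
  fix P :: "int set \<Rightarrow> bool" and X :: "int set"
  assume X: "finite X" "\<forall>Y. finite Y \<and> X \<subseteq> Y \<and> Y \<subseteq> UNIV \<longrightarrow> P Y"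
  define M where "M = (\<Sum>x\<in>X. nat \<bar>x\<bar>) + 1"
  have "X \<subseteq> {- int N..<int N}" if "N \<ge> M" for N
  proof
    fix x assume "x \<in> X"
    then have "nat \<bar>x\<bar> \<le> (\<Sum>x\<in>X. nat \<bar>x\<bar>)" using X(1) by (intro member_le_sum) auto
    with that show "x \<in> {- int N..<int N}" by (auto simp: M_def)
  qed
  with X show "\<forall>\<^sub>F N in sequentially. P {- int N..<int N}"
    unfolding eventually_sequentially by auto
qed

text \<open>
  The bound does not depend on \<open>s\<close>, although for small \<open>s\<close> the sum of the absolute values is of
  order \<open>1 / (s \<surd>k)\<close>. The reason is that the integral of \<open>1 / (1 + i s x) ^ (2 * k)\<close> over the real
  line vanishes: the series is compared with the telescoping series of an antiderivative, and the
  difference is at most the total variation of the function, which is \<open>O (\<surd>k)\<close> by Bernoulli's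
  inequality \<open>(1 + s\<^sup>2 x\<^sup>2) ^ k \<ge> 1 + k s\<^sup>2 x\<^sup>2\<close>.
\<close>

lemma cmod_infsum_inverse_powers_le:
  fixes s :: real and k :: nat
  defines "f \<equiv> \<lambda>x::real. 1 / (1 + \<i> * of_real (s * x)) ^ (2 * k)"
  assumes k: "k \<ge> 1" and s: "s \<noteq> 0" and summ: "(\<lambda>n::int. f (of_int n)) summable_on UNIV"
  shows "cmod (\<Sum>\<^sub>\<infinity>n::int. f (of_int n)) \<le> 2 * pi * sqrt (real k)"
proof -
  define u where "u = (\<lambda>z::complex. 1 + \<i> * of_real s * z)"
  define F where "F = (\<lambda>x::real. - 1 / (of_nat (2 * k - 1) * \<i> * of_real s * u (of_real x) ^ (2 * k - 1)))"
  define f' where "f' = (\<lambda>x::real. - of_nat (2 * k) * \<i> * of_real s / u (of_real x) ^ (2 * k + 1))"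
  define G where "G = (\<lambda>x::real. 2 * sqrt (real k) * arctan (sqrt (real k) * \<bar>s\<bar> * x))"
  define g where "g = (\<lambda>x::real. 2 * real k * \<bar>s\<bar> / (1 + real k * (s * x)\<^sup>2))"
  have u_nz: "u (of_real x) \<noteq> 0" for x :: real
    by (simp add: u_def complex_eq_iff)
  have cmod_u_sq: "(cmod (u (of_real x)))\<^sup>2 = 1 + (s * x)\<^sup>2" for x :: real
    by (simp add: u_def cmod_power2)
  have u_ge_1: "cmod (u (of_real x)) \<ge> 1" for x :: real
    using cmod_u_sq[of x] by (intro power2_le_imp_le[of 1]) auto
  have f_u: "f x = 1 / u (of_real x) ^ (2 * k)" for x by (simp add: f_def u_def mult.assoc)
  have du: "((\<lambda>z. 1 / u z ^ n) has_field_derivative - of_nat n * \<i> * of_real s / u (of_real x) ^ (n + 1))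
      (at (of_real x))" if "n \<ge> 1" for n and x :: real
  proof -
    have "(u has_field_derivative \<i> * of_real s) (at (of_real x))"
      unfolding u_def by (auto intro!: derivative_eq_intros)
    note DERIV_power[OF this, of n]
    then have "((\<lambda>z. inverse (u z ^ n)) has_field_derivative
        - (inverse (u (of_real x) ^ n) * (of_nat n * (\<i> * of_real s * u (of_real x) ^ (n - Suc 0))) *
           inverse (u (of_real x) ^ n))) (at (of_real x))"
      by (rule DERIV_inverse') (simp add: u_nz)
    moreover have "u (of_real x) ^ n = u (of_real x) * u (of_real x) ^ (n - Suc 0)"
      using that by (metis Suc_pred' One_nat_def less_eq_Suc_le power_Suc)
    ultimately show ?thesis
      using u_nz[of x] by (simp add: field_simps)
  qed
  have f: "(f has_vector_derivative f' x) (at x)" for x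
    using has_vector_derivative_real_field[OF du[of "2 * k" x]] k unfolding f_u f'_def by (simp add: o_def)
  have F: "(F has_vector_derivative f x) (at x)" for x
  proof -
    have n: "2 * k - 1 + 1 = 2 * k" "2 * k - 1 \<ge> 1" using k by auto
    then have nz: "of_nat (2 * k - 1) * \<i> * of_real s \<noteq> (0::complex)" using s by (simp del: of_nat_diff)
    define c where "c = - 1 / (of_nat (2 * k - 1) * \<i> * complex_of_real s)"
    have "((\<lambda>x. c * (1 / u (of_real x) ^ (2 * k - 1))) has_vector_derivative
        c * (- of_nat (2 * k - 1) * \<i> * of_real s / u (of_real x) ^ (2 * k))) (at x)"
      using has_vector_derivative_mult_right[OF has_vector_derivative_real_field[OF du[OF n(2), of x]]]
      unfolding n(1) o_def .
    moreover have "c * (- of_nat (2 * k - 1) * \<i> * of_real s / u (of_real x) ^ (2 * k)) = f x"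
      using nz unfolding f_u c_def by (simp del: of_nat_diff)
    moreover have "F = (\<lambda>x. c * (1 / u (of_real x) ^ (2 * k - 1)))"
      by (simp add: F_def c_def fun_eq_iff del: of_nat_diff)
    ultimately show ?thesis by metis
  qed
  have G: "(G has_vector_derivative g x) (at x)" for x
    unfolding G_def g_def
    by (auto intro!: derivative_eq_intros simp: power_mult_distrib field_simps
        simp flip: has_real_derivative_iff_has_vector_derivative)
  have bound: "cmod (f' x) \<le> g x" for x
  proof -
    have "1 + real k * (s * x)\<^sup>2 \<le> (1 + (s * x)\<^sup>2) ^ k"
      by (rule Bernoulli_inequality) (smt (verit) zero_le_power2)
    also have "\<dots> = cmod (u (of_real x)) ^ (2 * k)" by (simp add: cmod_u_sq power_mult)
    also have "\<dots> \<le> cmod (u (of_real x)) ^ (2 * k + 1)"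
      using u_ge_1[of x] by (intro power_increasing) auto
    finally have le: "1 + real k * (s * x)\<^sup>2 \<le> cmod (u (of_real x)) ^ (2 * k + 1)" .
    have pos: "0 < 1 + real k * (s * x)\<^sup>2" by (smt (verit) of_nat_0_le_iff mult_nonneg_nonneg zero_le_power2)
    have "cmod (f' x) = 2 * real k * \<bar>s\<bar> / cmod (u (of_real x)) ^ (2 * k + 1)"
      by (simp add: f'_def norm_divide norm_mult norm_power)
    also have "\<dots> \<le> g x"
      unfolding g_def using le pos by (intro divide_left_mono mult_pos_pos) auto
    finally show ?thesis .
  qed
  define K where "K = 1 / (real (2 * k - 1) * \<bar>s\<bar>)"
  have cmodF: "cmod (F x) \<le> K / (\<bar>s\<bar> * \<bar>x\<bar>)" if "x \<noteq> 0" for x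
  proof -
    have "\<bar>s\<bar> * \<bar>x\<bar> \<le> cmod (u (of_real x))"
      using cmod_u_sq[of x] by (intro power2_le_imp_le[of "\<bar>s\<bar> * \<bar>x\<bar>"]) (auto simp: power_mult_distrib)
    also have "\<dots> \<le> cmod (u (of_real x)) ^ (2 * k - 1)"
    proof -
      have "1 \<le> 2 * k - 1" using k by linarith
      from power_increasing[OF this u_ge_1[of x]] show ?thesis by (simp only: power_one_right)
    qed
    finally have le: "\<bar>s\<bar> * \<bar>x\<bar> \<le> cmod (u (of_real x)) ^ (2 * k - 1)" .
    have "cmod (F x) = K / cmod (u (of_real x)) ^ (2 * k - 1)"
      by (simp only: F_def K_def norm_divide norm_mult norm_power norm_minus_cancel norm_one norm_ii
          norm_of_nat norm_of_real) simp
    also have "\<dots> \<le> K / (\<bar>s\<bar> * \<bar>x\<bar>)"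
    proof (rule divide_left_mono[OF le])
      show "0 \<le> K" by (simp add: K_def)
      have "0 < cmod (u (of_real x)) ^ (2 * k - 1)" using u_ge_1[of x] by (intro zero_less_power) linarith
      moreover have "0 < \<bar>s\<bar> * \<bar>x\<bar>" using s that by simp
      ultimately show "0 < cmod (u (of_real x)) ^ (2 * k - 1) * (\<bar>s\<bar> * \<bar>x\<bar>)" by (rule mult_pos_pos)
    qed
    finally show ?thesis .
  qed
  have partial: "cmod (\<Sum>n\<in>{- int N..<int N}. f (of_int n))
      \<le> 2 * K / (\<bar>s\<bar> * real N) + 2 * pi * sqrt (real k)" if N: "N > 0" for N
  proof -
    let ?I = "{- int N..<int N}"
    have eq: "(\<Sum>n\<in>?I. f (of_int n)) =
      (F (real N) - F (- real N)) - (\<Sum>n\<in>?I. F (of_int n + 1) - F (of_int n) - f (of_int n))"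
      using sum_telescope_int[of "\<lambda>n. F (of_int n)" N] by (simp add: sum_subtractf)
    have "cmod (\<Sum>n\<in>?I. F (of_int n + 1) - F (of_int n) - f (of_int n))
        \<le> (\<Sum>n\<in>?I. G (of_int n + 1) - G (of_int n))"
      by (intro sum_norm_le norm_increment_minus_derivative_le[OF F f G bound])
    also have "\<dots> = G (real N) - G (- real N)"
      using sum_telescope_int[of "\<lambda>n. G (of_int n)" N] by simp
    also have "\<dots> \<le> 2 * pi * sqrt (real k)"
    proof -
      have "G (real N) \<le> 2 * sqrt (real k) * (pi / 2)" "G (- real N) \<ge> 2 * sqrt (real k) * (- (pi / 2))"
        unfolding G_def using arctan_ubound arctan_lbound by (intro mult_left_mono; force simp: less_imp_le)+
      then show ?thesis by (simp add: algebra_simps)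
    qed
    finally have "cmod (\<Sum>n\<in>?I. f (of_int n)) \<le> cmod (F (real N)) + cmod (F (- real N)) + 2 * pi * sqrt (real k)"
      unfolding eq
      by (smt (verit) norm_triangle_ineq4)
    with cmodF[of "real N"] cmodF[of "- real N"] N show ?thesis by simp
  qed
  have "((\<lambda>n::int. f (of_int n)) has_sum (\<Sum>\<^sub>\<infinity>n::int. f (of_int n))) UNIV"
    using summ by simp
  then have lim: "(\<lambda>N. \<Sum>n\<in>{- int N..<int N}. f (of_int n)) \<longlonglongrightarrow> (\<Sum>\<^sub>\<infinity>n::int. f (of_int n))"
    unfolding has_sum_def using filterlim_symmetric_interval_int by (rule filterlim_compose)
  have "(\<lambda>N. (2 * K / \<bar>s\<bar>) * (1 / real N) + 2 * pi * sqrt (real k)) \<longlonglongrightarrow> (2 * K / \<bar>s\<bar>) * 0 + 2 * pi * sqrt (real k)"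
    by (intro tendsto_intros lim_1_over_n)
  then have "(\<lambda>N. 2 * K / (\<bar>s\<bar> * real N) + 2 * pi * sqrt (real k)) \<longlonglongrightarrow> 2 * pi * sqrt (real k)"
    by simp
  then show ?thesis
    using tendsto_norm[OF lim]
    by (rule tendsto_le[OF sequentially_bot])
       (use partial in \<open>auto simp: eventually_sequentially intro!: exI[of _ 1]\<close>)
qed

section \<open>Discrete groups\<close>

lemma matmul_diff:
  fixes A B C :: "real^2^2"
  shows "A ** (B - C) = A ** B - A ** C" "(B - C) ** A = B ** A - C ** A"
  by (rule mat2_eqI; simp add: algebra_simps)+

text \<open>
  Compactness of the ball makes \<open>N\<close> uniform in \<open>S\<close>. The uniformity is what bounds the multiplicity
  of many boxes at once in the area argument below.
\<close>

lemma separated_subset_card_le: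
  fixes R \<delta> :: real
  assumes "\<delta> > 0"
  obtains N where "\<And>S :: (real^2^2) set. (\<And>A. A \<in> S \<Longrightarrow> norm A \<le> R) \<Longrightarrow>
    (\<And>A B. A \<in> S \<Longrightarrow> B \<in> S \<Longrightarrow> A \<noteq> B \<Longrightarrow> dist A B \<ge> \<delta>) \<Longrightarrow> finite S \<and> card S \<le> N"
proof -
  obtain K :: "(real^2^2) set" where K: "finite K" "cball 0 R \<subseteq> (\<Union>x\<in>K. ball x (\<delta> / 2))"
    using compact_imp_seq_compact[OF compact_cball[of 0 R]] seq_compact_imp_totally_bounded assms by (metis half_gt_zero)
  show ?thesis
  proof (rule that[of "card K"])
    fix S :: "(real^2^2) set"
    assume R: "\<And>A. A \<in> S \<Longrightarrow> norm A \<le> R"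
      and sep: "\<And>A B. A \<in> S \<Longrightarrow> B \<in> S \<Longrightarrow> A \<noteq> B \<Longrightarrow> dist A B \<ge> \<delta>"
    have "\<forall>A\<in>S. \<exists>x\<in>K. dist x A < \<delta> / 2"
    proof
      fix A assume "A \<in> S"
      then have "A \<in> cball 0 R" using R by simp
      with K(2) show "\<exists>x\<in>K. dist x A < \<delta> / 2" by (meson UN_E mem_ball subsetD)
    qed
    then obtain c where c: "\<And>A. A \<in> S \<Longrightarrow> c A \<in> K \<and> dist (c A) A < \<delta> / 2" by metis
    have "inj_on c S"
    proof (rule inj_onI, rule ccontr)
      fix A B assume AB: "A \<in> S" "B \<in> S" "c A = c B" "A \<noteq> B"
      then have "dist A B < \<delta>"
        using c[of A] c[of B] dist_triangle[of A B "c A"] by (simp add: dist_commute)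
      with sep AB show False by fastforce
    qed
    moreover have "c ` S \<subseteq> K" using c by auto
    ultimately show "finite S \<and> card S \<le> card K"
      using K(1) by (meson card_inj_on_le inj_on_finite)
  qed
qed

locale fuchsian_group =
  fixes \<Gamma> :: "(real^2^2) set set"
  assumes fuchsian: "fuchsian \<Gamma>"
begin

abbreviation G :: "(real^2^2) set" where "G \<equiv> \<Union>\<Gamma>"

lemma subgroup_\<Gamma>: "subgroup \<Gamma> PSL2" and discrete_G: "discrete G"
  using fuchsian by (auto simp: fuchsian_def)

lemma \<Gamma>_carrier: "g \<in> \<Gamma> \<Longrightarrow> g \<in> carrier PSL2"
  using subgroup.subset[OF subgroup_\<Gamma>] by auto

lemma rep_G:
  assumes "g \<in> \<Gamma>"
  shows "rep g \<in> G" "g = {rep g, - rep g}" "det (rep g) = 1"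
proof -
  show g: "g = {rep g, - rep g}" and "det (rep g) = 1"
    using rep_cases[OF \<Gamma>_carrier[OF assms]] by blast+
  have "rep g \<in> {rep g, - rep g}" by blast
  then have "rep g \<in> g" using g by blast
  then show "rep g \<in> G" using assms by blast
qed

lemma det_G: "A \<in> G \<Longrightarrow> det A = 1"
  using \<Gamma>_carrier by (fastforce simp: carrier_PSL2 det_uminus_2)

lemma coset_G:
  assumes "A \<in> G"
  shows "{A, - A} \<in> \<Gamma>" "rep {A, - A} = A \<or> rep {A, - A} = - A"
proof -
  obtain g where g: "g \<in> \<Gamma>" "A \<in> g" using assms by auto
  have "A \<in> {rep g, - rep g}" using g(2) rep_G(2)[OF g(1)] by blast
  then have A: "rep g = A \<or> rep g = - A" by auto
  then have eq: "g = {A, - A}"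
    by (rule disjE) (use rep_G(2)[OF g(1)] in \<open>simp_all add: insert_commute\<close>)
  show "{A, - A} \<in> \<Gamma>" using g(1) unfolding eq .
  show "rep {A, - A} = A \<or> rep {A, - A} = - A" using A unfolding eq .
qed

lemma G_uminus: "A \<in> G \<Longrightarrow> - A \<in> G"
  using coset_G(1)[of A] by blast

lemma G_one: "mat 1 \<in> G"
  using subgroup.one_closed[OF subgroup_\<Gamma>] by (auto simp: one_PSL2)

lemma G_mult:
  assumes "A \<in> G" "B \<in> G"
  shows "A ** B \<in> G"
proof -
  from assms obtain g h where gh: "g \<in> \<Gamma>" "A \<in> g" "h \<in> \<Gamma>" "B \<in> h" by auto
  then have "A ** B \<in> g \<otimes>\<^bsub>PSL2\<^esub> h"
    by (auto simp: PSL2_def FactGroup_def set_mult_def)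
  with subgroup.m_closed[OF subgroup_\<Gamma> gh(1,3)] show ?thesis by auto
qed

lemma G_adj2:
  assumes "A \<in> G"
  shows "adj2 A \<in> G"
proof -
  from assms obtain g where g: "g \<in> \<Gamma>" "A \<in> g" by auto
  let ?h = "inv\<^bsub>PSL2\<^esub> g"
  have h: "?h \<in> \<Gamma>" using subgroup.m_inv_closed[OF subgroup_\<Gamma>] g by blast
  let ?B = "rep ?h"
  have B: "?B \<in> ?h" "?B \<in> G" using rep_G(1,2)[OF h] by blast+
  have "g \<otimes>\<^bsub>PSL2\<^esub> ?h = {mat 1, - mat 1}"
    using group.r_inv[OF group_PSL2 \<Gamma>_carrier[OF g(1)]] by (simp add: one_PSL2)
  moreover have "A ** ?B \<in> g \<otimes>\<^bsub>PSL2\<^esub> ?h"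
    using g B by (auto simp: PSL2_def FactGroup_def set_mult_def)
  ultimately have "A ** ?B = mat 1 \<or> A ** ?B = - mat 1" by auto
  moreover have "?B = adj2 A ** (A ** ?B)"
    using adj2_mult(2)[OF det_G[OF assms]] by (simp add: matrix_mul_assoc)
  ultimately have "?B = adj2 A \<or> ?B = - adj2 A"
    by (metis matrix_mul_rid matrix_mul_uminus(2))
  then show ?thesis using B(2) G_uminus by fastforce
qed

lemma rep_inj: "g \<in> \<Gamma> \<Longrightarrow> h \<in> \<Gamma> \<Longrightarrow> rep g = rep h \<Longrightarrow> g = h"
  using rep_G(2) by metis

lemma isolated_one:
  obtains \<epsilon> where "\<epsilon> > 0" "\<And>A. A \<in> G \<Longrightarrow> norm (A - mat 1) < \<epsilon> \<Longrightarrow> A = mat 1"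
proof -
  have "mat 1 isolated_in G" using discrete_G G_one by (auto simp: discrete_def)
  then obtain e where "e > 0" "\<And>A. A \<in> G \<Longrightarrow> dist (mat 1) A < e \<Longrightarrow> A = mat 1"
    by (rule isolated_inE_dist) blast
  then show ?thesis by (intro that[of e]) (auto simp: dist_norm norm_minus_commute)
qed

lemma finite_norm_le: "finite {A \<in> G. norm A \<le> R}"
proof -
  obtain \<epsilon> where \<epsilon>: "\<epsilon> > 0" "\<And>A. A \<in> G \<Longrightarrow> norm (A - mat 1) < \<epsilon> \<Longrightarrow> A = mat 1"
    using isolated_one by blast
  define R' where "R' = max R 1"
  have R': "R' > 0" "R \<le> R'" by (auto simp: R'_def)
  obtain N where N: "\<And>S :: (real^2^2) set. (\<And>A. A \<in> S \<Longrightarrow> norm A \<le> R') \<Longrightarrow>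
    (\<And>A B. A \<in> S \<Longrightarrow> B \<in> S \<Longrightarrow> A \<noteq> B \<Longrightarrow> dist A B \<ge> \<epsilon> / R') \<Longrightarrow> finite S \<and> card S \<le> N"
    using separated_subset_card_le[of "\<epsilon> / R'" R'] \<epsilon> R' by (metis divide_pos_pos)
  have "finite {A \<in> G. norm A \<le> R} \<and> card {A \<in> G. norm A \<le> R} \<le> N"
  proof (rule N)
    fix A B assume A: "A \<in> {A \<in> G. norm A \<le> R}" and B: "B \<in> {A \<in> G. norm A \<le> R}" and ne: "A \<noteq> B"
    have "adj2 A ** B \<noteq> mat 1"
    proof
      assume "adj2 A ** B = mat 1"
      then have "A ** (adj2 A ** B) = A" by simp
      moreover have "A ** adj2 A = mat 1" using A det_G[of A] adj2_mult(1)[of A] by blast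
      ultimately show False using ne by (simp add: matrix_mul_assoc)
    qed
    moreover have "adj2 A ** B \<in> G" using A B by (intro G_mult G_adj2) blast+
    ultimately have "\<epsilon> \<le> norm (adj2 A ** B - mat 1)"
      using \<epsilon>(2) not_le by blast
    also have "adj2 A ** B - mat 1 = adj2 A ** (B - A)"
      using A det_G[of A] adj2_mult(2)[of A] by (simp add: matmul_diff)
    also have "norm \<dots> \<le> norm (adj2 A) * norm (B - A)" by (rule norm_matmul_le)
    also have "\<dots> \<le> R' * norm (B - A)" using A R' by (intro mult_right_mono) auto
    finally show "dist A B \<ge> \<epsilon> / R'" using R' by (simp add: dist_norm norm_minus_commute field_simps)
  qed (use R' in auto)
  then show ?thesis by blast
qed

lemma countable_\<Gamma>: "countable \<Gamma>"
proof -
  have "G = (\<Union>n::nat. {A \<in> G. norm A \<le> real n})"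
    using real_arch_simple by auto
  moreover have "countable (\<Union>n::nat. {A \<in> G. norm A \<le> real n})"
    using finite_norm_le by (intro countable_UN) (auto intro: countable_finite)
  ultimately have "countable G" by metis
  moreover have "rep ` \<Gamma> \<subseteq> G" "inj_on rep \<Gamma>"
    using rep_G(1) rep_inj by (blast, blast intro: inj_onI)
  ultimately show ?thesis by (metis countable_image_inj_on countable_subset)
qed

end

section \<open>Matrices in the frame of a point\<close>

text \<open>
  The conjugate of \<open>A\<close> by the upper triangular matrix that sends \<open>\<i>\<close> to \<open>z\<close>. It measures how \<open>A\<close>
  acts near \<open>z\<close>: it is close to \<open>\<plusminus>1\<close> when \<open>A\<close> moves \<open>z\<close> and the directions at \<open>z\<close> only a little.
\<close>

definition frame :: "complex \<Rightarrow> real^2^2 \<Rightarrow> real^2^2" where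
  "frame z A = mat2 (A$1$1 - A$2$1 * Re z)
     ((A$1$2 + (A$1$1 - A$2$2) * Re z - A$2$1 * (Re z)\<^sup>2) / Im z)
     (A$2$1 * Im z) (A$2$2 + A$2$1 * Re z)"

lemma frame_nth [simp]:
  "frame z A $ 1 $ 1 = A$1$1 - A$2$1 * Re z"
  "frame z A $ 1 $ 2 = (A$1$2 + (A$1$1 - A$2$2) * Re z - A$2$1 * (Re z)\<^sup>2) / Im z"
  "frame z A $ 2 $ 1 = A$2$1 * Im z"
  "frame z A $ 2 $ 2 = A$2$2 + A$2$1 * Re z"
  by (simp_all add: frame_def)

lemma frame_mult:
  assumes "Im z > 0"
  shows "frame z (A ** B) = frame z A ** frame z B"
  using assms by (intro mat2_eqI) (auto simp: field_simps power2_eq_square)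

lemma frame_mat_1 [simp]: "frame z (mat 1) = mat 1"
  by (rule mat2_eqI) auto

lemma frame_diff: "frame z (A - B) = frame z A - frame z B"
  by (rule mat2_eqI) (auto simp: diff_divide_distrib add_divide_distrib algebra_simps)

lemma frame_adj2: "frame z (adj2 A) = adj2 (frame z A)"
  by (rule mat2_eqI) (auto simp: diff_divide_distrib add_divide_distrib algebra_simps)

lemma det_frame:
  assumes "Im z > 0"
  shows "det (frame z A) = det A"
  using assms by (simp add: det_2 field_simps power2_eq_square)

lemma norm_le_norm_frame:
  assumes "Im z > 0"
  obtains K where "K > 0" "\<And>A. norm A \<le> K * norm (frame z A)"
proof -
  define x y where "x = Re z" and "y = Im z"
  define K where "K = 1 + (1 + \<bar>x\<bar> / y) + (y + 2 * \<bar>x\<bar> + x\<^sup>2 / y) + 1 / y + (1 + \<bar>x\<bar> / y)"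
  have y: "y > 0" using assms by (simp add: y_def)
  have "norm A \<le> K * norm (frame z A)" for A
  proof -
    let ?M = "frame z A" and ?n = "norm (frame z A)"
    have c: "A$2$1 = ?M$2$1 / y" using y by (simp add: y_def)
    have a: "A$1$1 = ?M$1$1 + ?M$2$1 * (x / y)" using y by (simp add: x_def y_def)
    have d: "A$2$2 = ?M$2$2 - ?M$2$1 * (x / y)" using y by (simp add: x_def y_def)
    have b: "A$1$2 = ?M$1$2 * y - ?M$1$1 * x + ?M$2$2 * x - ?M$2$1 * (x\<^sup>2 / y)"
      using y by (simp add: x_def y_def field_simps power2_eq_square)
    have e: "\<bar>?M$i$j\<bar> \<le> ?n" for i j by (rule entry_le_norm)
    have m: "\<bar>?M$i$j * t\<bar> \<le> ?n * \<bar>t\<bar>" for i j t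
      unfolding abs_mult using e by (intro mult_right_mono) auto
    have q: "\<bar>1 / y\<bar> = 1 / y" "\<bar>x / y\<bar> = \<bar>x\<bar> / y" "\<bar>x\<^sup>2 / y\<bar> = x\<^sup>2 / y" "\<bar>y\<bar> = y"
      using y by auto
    have "\<bar>A$2$1\<bar> \<le> ?n * (1 / y)"
      using m[of 2 1 "1 / y"] unfolding c q by (simp del: frame_nth)
    moreover have "\<bar>A$1$1\<bar> \<le> ?n + ?n * (\<bar>x\<bar> / y)"
      using m[of 2 1 "x / y"] e[of 1 1] unfolding a q by linarith
    moreover have "\<bar>A$2$2\<bar> \<le> ?n + ?n * (\<bar>x\<bar> / y)"
      using m[of 2 1 "x / y"] e[of 2 2] unfolding d q by linarith
    moreover have "\<bar>A$1$2\<bar> \<le> ?n * y + ?n * \<bar>x\<bar> + ?n * \<bar>x\<bar> + ?n * (x\<^sup>2 / y)"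
      using m[of 2 1 "x\<^sup>2 / y"] m[of 1 2 y] m[of 1 1 x] m[of 2 2 x] unfolding b q by linarith
    moreover have "?n * K = ?n + (?n + ?n * (\<bar>x\<bar> / y)) + (?n * y + ?n * \<bar>x\<bar> + ?n * \<bar>x\<bar> + ?n * (x\<^sup>2 / y))
        + ?n * (1 / y) + (?n + ?n * (\<bar>x\<bar> / y))"
      by (simp add: K_def algebra_simps)
    ultimately show ?thesis
      using norm_mat_le_entries[of A] norm_ge_zero[of ?M] by (simp only: mult.commute[of K])
  qed
  moreover have "K > 0" unfolding K_def using y by (intro add_pos_nonneg) auto
  ultimately show ?thesis using that by blast
qed

text \<open>
  Translates between the two measures of displacement: \<open>ppi\<close>, for which the invariance and the
  triangle inequality are at hand, and the matrix norm, for which discreteness and commutators are.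
\<close>

lemma norm_frame_sq:
  assumes "det A = 1" "Im z > 0"
  shows "(norm (frame z A))\<^sup>2 = 4 * ppi (moebius A z) z - 2"
proof -
  have nz: "automorphy A z \<noteq> 0" using assms by (rule automorphy_nz)
  have "(moebius A z - cnj z) * automorphy A z
      = of_real (A$1$1) * z + of_real (A$1$2) - cnj z * automorphy A z"
    using nz by (simp add: moebius_def field_simps)
  then have "(cmod (moebius A z - cnj z) * cmod (automorphy A z))\<^sup>2
      = (cmod (of_real (A$1$1) * z + of_real (A$1$2) - cnj z * automorphy A z))\<^sup>2"
    by (metis norm_mult)
  then have "ppi (moebius A z) z =
      (cmod (of_real (A$1$1) * z + of_real (A$1$2) - cnj z * automorphy A z))\<^sup>2 / (4 * (Im z)\<^sup>2)"
    using assms nz by (simp add: ppi_def Im_moebius power_mult_distrib field_simps power2_eq_square)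
  also have "\<dots> = ((frame z A$1$2 - frame z A$2$1)\<^sup>2 + (frame z A$1$1 + frame z A$2$2)\<^sup>2) / 4"
  proof -
    let ?v = "of_real (A$1$1) * z + of_real (A$1$2) - cnj z * automorphy A z"
    have "Re ?v = Im z * (frame z A$1$2 - frame z A$2$1)" "Im ?v = Im z * (frame z A$1$1 + frame z A$2$2)"
      using assms(2) by (simp_all add: automorphy_def field_simps power2_eq_square)
    then have "(cmod ?v)\<^sup>2 = (Im z)\<^sup>2 * ((frame z A$1$2 - frame z A$2$1)\<^sup>2 + (frame z A$1$1 + frame z A$2$2)\<^sup>2)"
      by (simp only: cmod_power2 power_mult_distrib distrib_left[of "(Im z)\<^sup>2"])
    then show ?thesis using assms(2) by (simp del: frame_nth)
  qed
  also have "\<dots> = ((norm (frame z A))\<^sup>2 + 2 * det (frame z A)) / 4"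
    by (simp only: norm_mat_sq det_2) (simp add: power2_eq_square algebra_simps)
  finally show ?thesis using det_frame[OF assms(2)] assms(1) by simp
qed

lemma frame_i [simp]: "frame \<i> A = A"
  by (rule mat2_eqI) auto

lemma norm_sq_eq_ppi: "det A = 1 \<Longrightarrow> (norm A)\<^sup>2 = 4 * ppi (moebius A \<i>) \<i> - 2"
  using norm_frame_sq[of A \<i>] by simp

lemma (in fuchsian_group) finite_norm_frame_le:
  assumes "Im z > 0"
  shows "finite {A \<in> G. norm (frame z A) \<le> R}"
proof -
  obtain K where K: "K > 0" "\<And>A. norm A \<le> K * norm (frame z A)"
    using norm_le_norm_frame[OF assms] by blast
  have "norm A \<le> K * R" if "norm (frame z A) \<le> R" for A
    using K(2)[of A] mult_left_mono[OF that, of K] K(1) by linarith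
  then have "{A \<in> G. norm (frame z A) \<le> R} \<subseteq> {A \<in> G. norm A \<le> K * R}" by auto
  then show ?thesis using finite_norm_le finite_subset by blast
qed

section \<open>Convergence of the Poincare series\<close>

lemma sum_comp_le_fibres:
  fixes h :: "'b \<Rightarrow> real"
  assumes "finite X" "\<And>i. h i \<ge> 0" "\<And>i. card {g \<in> X. \<phi> g = i} \<le> N"
  shows "(\<Sum>g\<in>X. h (\<phi> g)) \<le> real N * (\<Sum>i\<in>\<phi> ` X. h i)"
proof -
  have "(\<Sum>g\<in>X. h (\<phi> g)) = (\<Sum>i\<in>\<phi> ` X. \<Sum>g\<in>{g \<in> X. \<phi> g = i}. h (\<phi> g))"
    by (rule sum.image_gen[OF assms(1)])
  also have "\<dots> = (\<Sum>i\<in>\<phi> ` X. real (card {g \<in> X. \<phi> g = i}) * h i)"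
    by (intro sum.cong refl) simp
  also have "\<dots> \<le> (\<Sum>i\<in>\<phi> ` X. real N * h i)"
    using assms by (intro sum_mono mult_right_mono) auto
  finally show ?thesis by (simp add: sum_distrib_left)
qed

lemma sum_int_le_suminf:
  fixes f :: "nat \<Rightarrow> real" and J :: "int set"
  assumes "finite J" "summable f" "\<And>n. f n \<ge> 0"
  shows "(\<Sum>j\<in>J. f (nat \<bar>j\<bar>)) \<le> 2 * suminf f"
proof -
  have part: "(\<Sum>j\<in>S. f (nat \<bar>j\<bar>)) \<le> suminf f" if "S \<subseteq> J" "inj_on (\<lambda>j. nat \<bar>j\<bar>) S" for S
  proof -
    have "(\<Sum>j\<in>S. f (nat \<bar>j\<bar>)) = sum f ((\<lambda>j. nat \<bar>j\<bar>) ` S)"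
      using that(2) by (simp add: sum.reindex)
    also have "\<dots> \<le> suminf f"
      using assms finite_subset[OF that(1) assms(1)] by (intro sum_le_suminf) auto
    finally show ?thesis .
  qed
  have "J = {j \<in> J. j \<ge> 0} \<union> {j \<in> J. j < 0}" by auto
  then have "(\<Sum>j\<in>J. f (nat \<bar>j\<bar>)) = (\<Sum>j\<in>{j \<in> J. j \<ge> 0}. f (nat \<bar>j\<bar>)) + (\<Sum>j\<in>{j \<in> J. j < 0}. f (nat \<bar>j\<bar>))"
    using assms(1) by (subst sum.union_disjoint[symmetric]) auto
  also have "\<dots> \<le> suminf f + suminf f"
    by (intro add_mono part) (auto intro!: inj_onI)
  finally show ?thesis by simp
qed

text \<open>
  The half-plane is cut into the boxes \<open>[m 2^j, (m+1) 2^j) \<times> [2^j, 2^(j+1))\<close>, which have bounded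
  hyperbolic size.
\<close>

definition box_height :: "complex \<Rightarrow> int" where
  "box_height w = \<lfloor>log 2 (Im w)\<rfloor>"

definition box_column :: "complex \<Rightarrow> int" where
  "box_column w = \<lfloor>Re w / 2 powr of_int (box_height w)\<rfloor>"

lemma box_bounds:
  assumes "Im w > 0"
  defines "r \<equiv> 2 powr of_int (box_height w)"
  shows "r > 0" "r \<le> Im w" "Im w < 2 * r"
    "of_int (box_column w) * r \<le> Re w" "Re w < (of_int (box_column w) + 1) * r"
proof -
  have "of_int (box_height w) \<le> log 2 (Im w)" "log 2 (Im w) < of_int (box_height w) + 1"
    unfolding box_height_def by linarith+
  then show r: "r > 0" "r \<le> Im w" "Im w < 2 * r"
    using assms(1) by (auto simp: r_def le_log_iff log_less_iff powr_add)
  have "of_int (box_column w) \<le> Re w / r" "Re w / r < of_int (box_column w) + 1"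
    unfolding box_column_def r_def by linarith+
  then show "of_int (box_column w) * r \<le> Re w" "Re w < (of_int (box_column w) + 1) * r"
    using r(1) by (simp_all add: field_simps)
qed

lemma ppi_same_box:
  assumes "Im v > 0" "Im w > 0" "box_height v = box_height w" "box_column v = box_column w"
  shows "ppi v w \<le> 5"
proof -
  define r :: real where "r = 2 powr of_int (box_height w)"
  note v = box_bounds[OF assms(1), unfolded assms(3,4), folded r_def]
  note w = box_bounds[OF assms(2), folded r_def]
  have "\<bar>Re v - Re w\<bar> \<le> r" using v(4,5) w(4,5) by (simp add: algebra_simps)
  then have "(Re v - Re w)\<^sup>2 \<le> r\<^sup>2" by (metis abs_ge_zero power2_abs power_mono)
  moreover have "(Im v + Im w)\<^sup>2 \<le> (4 * r)\<^sup>2" using v w by (intro power_mono) auto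
  moreover have "r * r \<le> Im v * Im w" using v w by (intro mult_mono) auto
  ultimately have "(Re v - Re w)\<^sup>2 + (Im v + Im w)\<^sup>2 \<le> 17 * (Im v * Im w)"
    by (simp add: power2_eq_square)
  also have "\<dots> \<le> 20 * (Im v * Im w)" using assms by simp
  finally show ?thesis
    using assms by (simp add: ppi_alt divide_le_eq)
qed

text \<open>
  The exponent \<open>3/2\<close> leaves room for geometric decay in the height index and for summability in the
  column index. With \<open>S = x\<^sup>2 + y\<^sup>2 + 1\<close> one has \<open>ppi \<ge> S / (4 y)\<close>, while \<open>\<bar>x\<bar> + y\<close> and
  \<open>max 1 y\<^sup>2\<close> are at most \<open>S\<close>.
\<close>

lemma ppi_power_ge_box:
  assumes "Im w > 0"
  shows "2 ^ nat \<bar>box_height w\<bar> * (1 + real (nat \<bar>box_column w\<bar>)) ^ 5 \<le> 2048 * 4 ^ 6 * (ppi w \<i>) ^ 6"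
proof -
  define r :: real where "r = 2 powr of_int (box_height w)"
  define x y where "x = Re w" and "y = Im w"
  note b = box_bounds[OF assms, folded r_def x_def y_def]
  have y: "y > 0" using assms by (simp add: y_def)
  define S where "S = x\<^sup>2 + y\<^sup>2 + 1"
  have S1: "S \<ge> 1" by (simp add: S_def)
  have "(1 + real (nat \<bar>box_column w\<bar>)) * r \<le> 2 * y + \<bar>x\<bar>"
    using b by (cases "box_column w \<ge> 0") (auto simp: algebra_simps)
  then have *: "(1 + real (nat \<bar>box_column w\<bar>)) * y \<le> 2 * (2 * y + \<bar>x\<bar>)"
    using b(3) mult_left_mono[of y "2 * r" "1 + real (nat \<bar>box_column w\<bar>)"] by (simp add: algebra_simps)
  have "2 * y \<le> y\<^sup>2 + 1" "2 * \<bar>x\<bar> \<le> x\<^sup>2 + 1"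
    using zero_le_power2[of "y - 1"] zero_le_power2[of "\<bar>x\<bar> - 1"]
    by (simp_all add: power2_eq_square algebra_simps)
  then have "2 * (2 * y + \<bar>x\<bar>) \<le> 4 * S"
    unfolding S_def using zero_le_power2[of x] zero_le_power2[of y] by argo
  with * have "(1 + real (nat \<bar>box_column w\<bar>)) * y \<le> 4 * S" by (rule order_trans)
  then have col: "1 + real (nat \<bar>box_column w\<bar>) \<le> 4 * S / y" using y by (simp add: field_simps)
  have height: "2 ^ nat \<bar>box_height w\<bar> \<le> 2 * S / y"
  proof (cases "box_height w \<ge> 0")
    case True
    then have "2 ^ nat \<bar>box_height w\<bar> = r" by (simp add: r_def powr_realpow[symmetric])
    with b have "2 ^ nat \<bar>box_height w\<bar> \<le> y" by simp
    moreover have "y * y \<le> S" by (simp add: S_def power2_eq_square)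
    ultimately have "2 ^ nat \<bar>box_height w\<bar> * y \<le> 2 * S"
      using y S1 mult_right_mono[of "2 ^ nat \<bar>box_height w\<bar>" y y] by linarith
    then show ?thesis using y by (simp add: field_simps)
  next
    case False
    then have "2 ^ nat \<bar>box_height w\<bar> = 1 / r"
      by (simp add: r_def powr_realpow[symmetric] powr_minus_divide[symmetric])
    also have "\<dots> \<le> 2 / y" using b y by (simp add: field_simps)
    also have "\<dots> \<le> 2 * S / y" using S1 y by (simp add: field_simps)
    finally show ?thesis .
  qed
  have "S \<le> x\<^sup>2 + (y + 1)\<^sup>2" using y by (simp add: S_def power2_eq_square algebra_simps)
  then have "S / (4 * y) \<le> ppi w \<i>"
    using y by (simp add: ppi_alt x_def y_def divide_right_mono)
  then have ppi: "S / y \<le> 4 * ppi w \<i>" by simp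
  have "2 ^ nat \<bar>box_height w\<bar> * (1 + real (nat \<bar>box_column w\<bar>)) ^ 5 \<le> (2 * S / y) * (4 * S / y) ^ 5"
    using col height y S1 by (intro mult_mono power_mono) auto
  also have "\<dots> = 2 * 4 ^ 5 * (S / y) ^ 6"
    by (simp add: power_mult_distrib power_divide eval_nat_numeral)
  also have "\<dots> \<le> 2 * 4 ^ 5 * (4 * ppi w \<i>) ^ 6"
    using ppi y S1 by (intro mult_left_mono power_mono) auto
  finally show ?thesis by (simp add: power_mult_distrib)
qed

text \<open>
  Two orbit points in the same box differ by a group element of bounded norm, of which there are
  finitely many. So the sum over the group is bounded by a constant times the sum over the boxes.
\<close>

lemma (in fuchsian_group) summable_ppi_orbit:
  "(\<lambda>g. ppi (psl_act g \<i>) \<i> powr (- 3/2)) summable_on \<Gamma>"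
proof -
  define E where "E = {A \<in> G. norm A \<le> 5}"
  have finE: "finite E" unfolding E_def by (rule finite_norm_le)
  define \<phi> where "\<phi> = (\<lambda>g. (box_height (psl_act g \<i>), box_column (psl_act g \<i>)))"
  define a :: "nat \<Rightarrow> real" where "a = (\<lambda>n. (2 powr (- 1/4)) ^ n)"
  define b :: "nat \<Rightarrow> real" where "b = (\<lambda>n. (1 + real n) powr (- 5/4))"
  define h where "h = (\<lambda>(j::int, m::int). a (nat \<bar>j\<bar>) * b (nat \<bar>m\<bar>))"
  define C :: real where "C = (2048 * 4 ^ 6) powr (1/4)"
  have a: "summable a" "a n \<ge> 0" for n
    unfolding a_def by (auto intro!: summable_geometric simp: powr_less_one)
  have "summable (\<lambda>n. real (Suc n) powr (- 5/4))"
    by (subst summable_Suc_iff) (simp add: summable_real_powr_iff)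
  then have b: "summable b" "b n \<ge> 0" for n unfolding b_def by simp_all
  have Im_pos: "Im (psl_act g \<i>) > 0" if "g \<in> \<Gamma>" for g
    using rep_G(3)[OF that] by (simp add: psl_act_def Im_moebius_pos)
  have term_le: "ppi (psl_act g \<i>) \<i> powr (- 3/2) \<le> C * h (\<phi> g)" if "g \<in> \<Gamma>" for g
  proof -
    define p u v :: real where "p = ppi (psl_act g \<i>) \<i>"
      and "u = 2 ^ nat \<bar>box_height (psl_act g \<i>)\<bar>"
      and "v = 1 + real (nat \<bar>box_column (psl_act g \<i>)\<bar>)"
    have p: "p > 0" using ppi_ge_1[of "psl_act g \<i>" \<i>] Im_pos[OF that] by (simp add: p_def)
    have uv: "u > 0" "v > 0" by (simp_all add: u_def v_def)
    have "u * v ^ 5 \<le> 2048 * 4 ^ 6 * p ^ 6"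
      unfolding u_def v_def p_def by (rule ppi_power_ge_box[OF Im_pos[OF that]])
    then have "(u * v ^ 5) powr (1/4) \<le> (2048 * 4 ^ 6 * p ^ 6) powr (1/4)"
      using uv by (intro powr_mono2) auto
    then have le: "u powr (1/4) * v powr (5/4) \<le> C * p powr (3/2)"
    proof -
      have "(v ^ 5) powr (1/4) = v powr (real 5 * (1/4))" "(p ^ 6) powr (1/4) = p powr (real 6 * (1/4))"
        unfolding powr_powr[symmetric] by (simp_all only: powr_realpow[OF uv(2)] powr_realpow[OF p])
      then have "(v ^ 5) powr (1/4) = v powr (5/4)" "(p ^ 6) powr (1/4) = p powr (3/2)" by simp_all
      moreover have "(u * v ^ 5) powr (1/4) = u powr (1/4) * (v ^ 5) powr (1/4)"
        by (rule powr_mult)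
      moreover have "(2048 * 4 ^ 6 * p ^ 6) powr (1/4) = C * (p ^ 6) powr (1/4)"
        unfolding C_def by (rule powr_mult)
      ultimately show ?thesis using \<open>(u * v ^ 5) powr (1/4) \<le> _\<close> by simp
    qed
    have "p powr (- 3/2) = 1 / p powr (3/2)" by (simp add: powr_minus_divide)
    also have "\<dots> \<le> C / (u powr (1/4) * v powr (5/4))"
      using le p uv by (simp add: field_simps)
    also have "\<dots> = C * (u powr (- 1/4) * v powr (- 5/4))"
      by (simp add: powr_minus_divide)
    also have "u powr (- 1/4) = a (nat \<bar>box_height (psl_act g \<i>)\<bar>)"
    proof -
      have "u powr (- 1/4) = 2 powr (real (nat \<bar>box_height (psl_act g \<i>)\<bar>) * (- 1/4))"
        unfolding powr_powr[symmetric] u_def by (simp only: powr_realpow)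
      also have "\<dots> = (2 powr (- 1/4)) powr real (nat \<bar>box_height (psl_act g \<i>)\<bar>)"
        by (simp only: powr_powr mult.commute)
      also have "\<dots> = a (nat \<bar>box_height (psl_act g \<i>)\<bar>)"
        unfolding a_def by (rule powr_realpow) simp
      finally show ?thesis .
    qed
    finally show ?thesis by (simp add: p_def h_def \<phi>_def b_def v_def)
  qed
  have fibre: "card {g \<in> X. \<phi> g = i} \<le> card E" if X: "X \<subseteq> \<Gamma>" for X i
  proof (cases "{g \<in> X. \<phi> g = i} = {}")
    case False
    then obtain g0 where g0: "g0 \<in> X" "\<phi> g0 = i" by blast
    let ?A = "rep g0"
    have A: "?A \<in> G" "det ?A = 1" using rep_G g0 X by blast+
    have "(\<lambda>g. adj2 ?A ** rep g) ` {g \<in> X. \<phi> g = i} \<subseteq> E"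
    proof safe
      fix g assume g: "g \<in> X" "i = \<phi> g"
      have B: "rep g \<in> G" "det (rep g) = 1" using rep_G g X by blast+
      have det: "det (adj2 ?A ** rep g) = 1" using A B by (simp add: det_mul)
      have "ppi (moebius (adj2 ?A ** rep g) \<i>) \<i> = ppi (moebius (adj2 ?A) (psl_act g \<i>)) (moebius (adj2 ?A) (psl_act g0 \<i>))"
        using A B by (simp add: moebius_mult moebius_adj2 psl_act_def)
      also have "\<dots> = ppi (psl_act g \<i>) (psl_act g0 \<i>)"
        using A Im_pos g g0 X by (intro ppi_moebius) auto
      also have "\<dots> \<le> 5"
        using Im_pos g g0 X by (intro ppi_same_box) (auto simp: \<phi>_def)
      finally have "(norm (adj2 ?A ** rep g))\<^sup>2 \<le> 5\<^sup>2" by (simp add: norm_sq_eq_ppi[OF det])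
      then have "norm (adj2 ?A ** rep g) \<le> 5" by (rule power2_le_imp_le) simp
      then show "adj2 ?A ** rep g \<in> E" using A B by (simp add: E_def G_mult G_adj2 del: Union_iff)
    qed
    moreover have "inj_on (\<lambda>g. adj2 ?A ** rep g) {g \<in> X. \<phi> g = i}"
    proof (rule inj_onI)
      fix g g' assume g: "g \<in> {g \<in> X. \<phi> g = i}" "g' \<in> {g \<in> X. \<phi> g = i}" "adj2 ?A ** rep g = adj2 ?A ** rep g'"
      then have "?A ** (adj2 ?A ** rep g) = ?A ** (adj2 ?A ** rep g')" by simp
      then have "rep g = rep g'" using A by (simp add: matrix_mul_assoc adj2_mult)
      then show "g = g'" using g X rep_inj by blast
    qed
    ultimately show ?thesis using finE by (intro card_inj_on_le)
  next
    case True
    show ?thesis unfolding True by simp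
  qed
  show ?thesis
  proof (rule nonneg_bdd_above_summable_on)
    show "bdd_above (sum (\<lambda>g. ppi (psl_act g \<i>) \<i> powr (- 3/2)) ` {F. F \<subseteq> \<Gamma> \<and> finite F})"
    proof (rule bdd_aboveI2)
      fix F assume "F \<in> {F. F \<subseteq> \<Gamma> \<and> finite F}"
      then have F: "F \<subseteq> \<Gamma>" "finite F" by auto
      define J M where "J = fst ` \<phi> ` F" and "M = snd ` \<phi> ` F"
      have fin: "finite J" "finite M" using F by (auto simp: J_def M_def)
      have h0: "h i \<ge> 0" for i using a(2) b(2) by (auto simp: h_def split: prod.split)
      have "\<phi> ` F \<subseteq> J \<times> M" unfolding J_def M_def by (rule subset_fst_snd)
      then have "(\<Sum>i\<in>\<phi> ` F. h i) \<le> (\<Sum>i\<in>J \<times> M. h i)"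
        using fin h0 by (intro sum_mono2) auto
      also have "\<dots> = (\<Sum>j\<in>J. a (nat \<bar>j\<bar>)) * (\<Sum>m\<in>M. b (nat \<bar>m\<bar>))"
        by (simp add: h_def sum_product sum.cartesian_product)
      also have "\<dots> \<le> (2 * suminf a) * (2 * suminf b)"
        using a b fin by (intro mult_mono sum_int_le_suminf mult_nonneg_nonneg sum_nonneg suminf_nonneg) auto
      finally have le: "(\<Sum>i\<in>\<phi> ` F. h i) \<le> (2 * suminf a) * (2 * suminf b)" .
      have "(\<Sum>g\<in>F. ppi (psl_act g \<i>) \<i> powr (- 3/2)) \<le> (\<Sum>g\<in>F. C * h (\<phi> g))"
        using F term_le by (intro sum_mono) auto
      also have "\<dots> = C * (\<Sum>g\<in>F. h (\<phi> g))" by (simp add: sum_distrib_left)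
      also have "\<dots> \<le> C * (real (card E) * (\<Sum>i\<in>\<phi> ` F. h i))"
        using fibre[OF F(1)] h0 F(2) by (intro mult_left_mono sum_comp_le_fibres) (auto simp: C_def)
      also have "\<dots> \<le> C * (real (card E) * ((2 * suminf a) * (2 * suminf b)))"
        using le by (intro mult_left_mono) (auto simp: C_def)
      finally show "(\<Sum>g\<in>F. ppi (psl_act g \<i>) \<i> powr (- 3/2))
          \<le> C * (real (card E) * ((2 * suminf a) * (2 * suminf b)))" .
    qed
  qed simp
qed

section \<open>The Bergman kernel on the diagonal\<close>

text \<open>The base of the \<open>2 k\<close>-th power in the denominator of a term of the series on the diagonal.\<close>

definition bergman_denom :: "real^2^2 \<Rightarrow> complex \<Rightarrow> complex" where
  "bergman_denom A z = (moebius A z - cnj z) * automorphy A z"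

lemma bergman_denom_uminus: "bergman_denom (- A) z = - bergman_denom A z"
  by (simp add: bergman_denom_def moebius_uminus automorphy_uminus)

lemma bergman_series_diagonal:
  "bergman_series \<Gamma> k z z = (\<Sum>\<^sub>\<infinity>g\<in>\<Gamma>. 1 / bergman_denom (rep g) z ^ (2 * k))"
  by (simp add: bergman_series_def bergman_denom_def psl_act_def power_mult_distrib)

lemma cmod_bergman_denom_sq:
  assumes "det A = 1" "Im z > 0"
  shows "(cmod (bergman_denom A z))\<^sup>2 = 4 * (Im z)\<^sup>2 * ppi (moebius A z) z"
  using automorphy_nz[OF assms] assms
  by (simp add: bergman_denom_def ppi_def Im_moebius norm_mult power_mult_distrib power2_eq_square)

lemma cmod_bergman_term:
  assumes "det A = 1" "Im z > 0"
  shows "(4 * Im z * Im z) ^ k * cmod (1 / bergman_denom A z ^ (2 * k)) = (1 / ppi (moebius A z) z) ^ k"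
proof -
  have "ppi (moebius A z) z \<ge> 1"
    using assms by (intro ppi_ge_1 Im_moebius_pos)
  moreover have "cmod (bergman_denom A z ^ (2 * k)) = (4 * (Im z)\<^sup>2 * ppi (moebius A z) z) ^ k"
    by (simp add: norm_power power_mult cmod_bergman_denom_sq[OF assms])
  ultimately show ?thesis
    using assms by (simp add: norm_divide power_mult_distrib power_divide power2_eq_square)
qed

lemma bergman_denom_moebius:
  assumes "det S = 1" "det A = 1" "Im z > 0"
  shows "bergman_denom A (moebius S z)
    = bergman_denom (adj2 S ** A ** S) z / of_real ((cmod (automorphy S z))\<^sup>2)"
proof -
  define B where "B = adj2 S ** A ** S"
  define u where "u = moebius B z"
  have B: "det B = 1" "S ** B = A ** S"
    using assms by (simp_all add: B_def det_mul matrix_mul_assoc adj2_mult)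
  have u: "Im u > 0" using B assms by (simp add: u_def Im_moebius_pos)
  have nz: "automorphy S z \<noteq> 0" "automorphy S u \<noteq> 0" using assms u automorphy_nz by blast+
  have "moebius A (moebius S z) = moebius (S ** B) z"
    unfolding B(2) using assms by (simp add: moebius_mult)
  also have "\<dots> = moebius S u" unfolding u_def by (rule moebius_mult[OF assms(1) B(1) assms(3)])
  finally have "moebius A (moebius S z) - cnj (moebius S z)
      = (u - cnj z) / (automorphy S u * cnj (automorphy S z))"
    using moebius_diff_cnj[OF assms(1) u assms(3)] by simp
  moreover have "automorphy A (moebius S z) = automorphy S u * automorphy B z / automorphy S z"
    using automorphy_mult[OF assms(1,3), of A] automorphy_mult[OF B(1) assms(3), of S] nz B(2)
    by (simp add: u_def field_simps)
  ultimately show ?thesis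
    using nz unfolding bergman_denom_def B_def[symmetric] u_def[symmetric]
    by (simp add: complex_norm_square[symmetric] mult.commute del: of_real_power)
qed

context fuchsian_group
begin

definition conj_coset :: "real^2^2 \<Rightarrow> (real^2^2) set \<Rightarrow> (real^2^2) set" where
  "conj_coset S g = (\<lambda>A. adj2 S ** A ** S) ` g"

lemma conj_coset_closed:
  assumes "S \<in> G" "g \<in> \<Gamma>"
  shows "conj_coset S g \<in> \<Gamma>"
    and "rep (conj_coset S g) = adj2 S ** rep g ** S \<or> rep (conj_coset S g) = - (adj2 S ** rep g ** S)"
proof -
  have eq: "conj_coset S g = {adj2 S ** rep g ** S, - (adj2 S ** rep g ** S)}"
    unfolding conj_coset_def by (subst rep_G(2)[OF assms(2)]) (simp add: matrix_mul_uminus)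
  have "adj2 S ** rep g ** S \<in> G" using assms rep_G(1) by (intro G_mult G_adj2) blast+
  from coset_G[OF this] show "conj_coset S g \<in> \<Gamma>"
    "rep (conj_coset S g) = adj2 S ** rep g ** S \<or> rep (conj_coset S g) = - (adj2 S ** rep g ** S)"
    unfolding eq by blast+
qed

lemma conj_coset_bij:
  assumes "S \<in> G"
  shows "bij_betw (conj_coset S) \<Gamma> \<Gamma>"
proof (rule bij_betw_byWitness)
  have inv: "conj_coset (adj2 T) (conj_coset T g) = g" if "det T = 1" for T g
  proof -
    have "T ** (adj2 T ** A ** T) ** adj2 T = A" for A
      using adj2_mult(1)[OF that] by (metis matrix_mul_assoc matrix_mul_lid matrix_mul_rid)
    then show ?thesis by (simp add: conj_coset_def image_image)
  qed
  have S: "det S = 1" using assms by (rule det_G)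
  show "\<forall>g\<in>\<Gamma>. conj_coset (adj2 S) (conj_coset S g) = g" using inv S by blast
  show "\<forall>g\<in>\<Gamma>. conj_coset S (conj_coset (adj2 S) g) = g" using inv[of "adj2 S"] S by simp
  show "conj_coset S ` \<Gamma> \<subseteq> \<Gamma>" "conj_coset (adj2 S) ` \<Gamma> \<subseteq> \<Gamma>"
    using conj_coset_closed(1) assms G_adj2 by blast+
qed

text \<open>
  Conjugation by \<open>S\<close> permutes the terms of the series, up to the common factor that the powers of the
  imaginary parts compensate.
\<close>

lemma bergman_norm_moebius:
  assumes "S \<in> G" "Im z > 0"
  shows "bergman_norm \<Gamma> k (moebius S z) (moebius S z) = bergman_norm \<Gamma> k z z"
proof -
  define r where "r = (cmod (automorphy S z))\<^sup>2"
  have S: "det S = 1" using assms(1) by (rule det_G)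
  have r: "r > 0" using automorphy_nz[OF S assms(2)] by (simp add: r_def)
  have "1 / bergman_denom (rep g) (moebius S z) ^ (2 * k)
      = of_real r ^ (2 * k) * (1 / bergman_denom (rep (conj_coset S g)) z ^ (2 * k))" if "g \<in> \<Gamma>" for g
  proof -
    have "bergman_denom (rep (conj_coset S g)) z ^ (2 * k) = bergman_denom (adj2 S ** rep g ** S) z ^ (2 * k)"
      using conj_coset_closed(2)[OF assms(1) that] by (auto simp: bergman_denom_uminus)
    then show ?thesis
      using bergman_denom_moebius[OF S rep_G(3)[OF that] assms(2)]
      by (simp add: r_def power_divide)
  qed
  then have "bergman_series \<Gamma> k (moebius S z) (moebius S z)
      = (\<Sum>\<^sub>\<infinity>g\<in>\<Gamma>. of_real r ^ (2 * k) * (1 / bergman_denom (rep (conj_coset S g)) z ^ (2 * k)))"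
    unfolding bergman_series_diagonal by (intro infsum_cong) blast
  also have "\<dots> = of_real r ^ (2 * k) * (\<Sum>\<^sub>\<infinity>g\<in>\<Gamma>. 1 / bergman_denom (rep (conj_coset S g)) z ^ (2 * k))"
    by (rule infsum_cmult_right') 
  also have "(\<Sum>\<^sub>\<infinity>g\<in>\<Gamma>. 1 / bergman_denom (rep (conj_coset S g)) z ^ (2 * k)) = bergman_series \<Gamma> k z z"
    unfolding bergman_series_diagonal by (rule infsum_reindex_bij_betw[OF conj_coset_bij[OF assms(1)]])
  finally have "cmod (bergman_series \<Gamma> k (moebius S z) (moebius S z)) = r ^ (2 * k) * cmod (bergman_series \<Gamma> k z z)"
    using r by (simp add: norm_mult norm_power)
  moreover have "Im (moebius S z) = Im z / r" using Im_moebius[OF S assms(2)] by (simp add: r_def)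
  ultimately show ?thesis
    using r by (simp add: bergman_norm_def power_divide power_mult power_mult_distrib power2_eq_square)
qed

lemma Im_psl_act_pos: "g \<in> \<Gamma> \<Longrightarrow> Im z > 0 \<Longrightarrow> Im (psl_act g z) > 0"
  using rep_G(3) by (simp add: psl_act_def Im_moebius_pos)

lemma ppi_psl_act_ge_1: "g \<in> \<Gamma> \<Longrightarrow> Im z > 0 \<Longrightarrow> ppi (psl_act g z) z \<ge> 1"
  by (intro ppi_ge_1 Im_psl_act_pos)

lemma ppi_orbit_i_le:
  assumes "g \<in> \<Gamma>" "Im z > 0"
  shows "ppi (psl_act g \<i>) \<i> \<le> 16 * (ppi z \<i>)\<^sup>2 * ppi (psl_act g z) z"
proof -
  note pos = Im_psl_act_pos[OF assms(1)]
  have P: "ppi z \<i> \<ge> 1" using assms by (simp add: ppi_ge_1)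
  have eq: "ppi (psl_act g \<i>) (psl_act g z) = ppi z \<i>"
    using ppi_moebius[OF rep_G(3)[OF assms(1)], of \<i> z] assms by (simp add: psl_act_def ppi_commute)
  have "ppi (psl_act g \<i>) \<i> \<le> 4 * ppi (psl_act g \<i>) (psl_act g z) * ppi (psl_act g z) \<i>"
    using pos assms by (intro ppi_triangle) auto
  also have "\<dots> \<le> 4 * ppi z \<i> * (4 * ppi (psl_act g z) z * ppi z \<i>)"
    unfolding eq using P pos assms by (intro mult_left_mono ppi_triangle) auto
  finally show ?thesis by (simp add: power2_eq_square mult_ac)
qed

definition poincare_sum :: real where
  "poincare_sum = (\<Sum>\<^sub>\<infinity>g\<in>\<Gamma>. ppi (psl_act g \<i>) \<i> powr (- 3/2))"

lemma poincare_sum_nonneg: "poincare_sum \<ge> 0"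
  unfolding poincare_sum_def by (rule infsum_nonneg) simp

text \<open>
  The exponent \<open>3 = 3/2 + 3/2\<close> is split: one half is spent on convergence, after the comparison with
  the base point \<open>\<i>\<close>, the other half keeps the decay at \<open>z\<close>.
\<close>

lemma bergman_term_le:
  assumes "g \<in> \<Gamma>" "Im z > 0" "k \<ge> 3"
  shows "(1 / ppi (psl_act g z) z) ^ k
    \<le> (16 * (ppi z \<i>)\<^sup>2 / ppi (psl_act g z) z) powr (3/2) * ppi (psl_act g \<i>) \<i> powr (- 3/2)"
proof -
  define p q P where "p = ppi (psl_act g z) z" and "q = ppi (psl_act g \<i>) \<i>" and "P = ppi z \<i>"
  have p: "p \<ge> 1" and q: "q \<ge> 1"
    using ppi_psl_act_ge_1 assms by (auto simp: p_def q_def)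
  have P: "P \<ge> 1" using assms by (simp add: P_def ppi_ge_1)
  have le: "q \<le> 16 * P\<^sup>2 * p" unfolding p_def q_def P_def using assms(1,2) by (rule ppi_orbit_i_le)
  have "(1 / p) ^ k \<le> (1 / p) ^ 3" using p assms(3) by (intro power_decreasing) auto
  also have "\<dots> = (1 / p) powr (real 3)" by (rule powr_realpow[symmetric]) (use p in simp)
  also have "\<dots> = (1 / p) powr (3/2) * (1 / p) powr (3/2)" by (simp flip: powr_add)
  also have "\<dots> \<le> (1 / p) powr (3/2) * (16 * P\<^sup>2 / q) powr (3/2)"
    using le p q by (intro mult_left_mono powr_mono2) (auto simp: field_simps)
  also have "\<dots> = (16 * P\<^sup>2 / p) powr (3/2) * (1 / q) powr (3/2)"
    by (simp flip: powr_mult)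
  also have "(1 / q) powr (3/2) = q powr (- 3/2)"
    using q by (simp add: powr_divide powr_minus_divide)
  finally show ?thesis by (simp add: p_def q_def P_def)
qed

lemma summable_bergman_terms:
  assumes "Im z > 0" "k \<ge> 3"
  shows "(\<lambda>g. (1 / ppi (psl_act g z) z) ^ k) summable_on \<Gamma>"
proof (rule summable_on_comparison_test)
  show "(\<lambda>g. (16 * (ppi z \<i>)\<^sup>2) powr (3/2) * ppi (psl_act g \<i>) \<i> powr (- 3/2)) summable_on \<Gamma>"
    by (intro summable_on_cmult_right summable_ppi_orbit)
  show "(1 / ppi (psl_act g z) z) ^ k \<le> (16 * (ppi z \<i>)\<^sup>2) powr (3/2) * ppi (psl_act g \<i>) \<i> powr (- 3/2)"
    and "0 \<le> (1 / ppi (psl_act g z) z) ^ k" if "g \<in> \<Gamma>" for g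
  proof -
    have p: "ppi (psl_act g z) z \<ge> 1" using ppi_psl_act_ge_1 that assms by blast
    then show "0 \<le> (1 / ppi (psl_act g z) z) ^ k" by simp
    have "16 * (ppi z \<i>)\<^sup>2 / ppi (psl_act g z) z \<le> 16 * (ppi z \<i>)\<^sup>2 / 1"
      using p by (intro divide_left_mono) auto
    then have "(16 * (ppi z \<i>)\<^sup>2 / ppi (psl_act g z) z) powr (3/2) \<le> (16 * (ppi z \<i>)\<^sup>2) powr (3/2)"
      using p by (intro powr_mono2) auto
    with bergman_term_le[OF that assms]
    show "(1 / ppi (psl_act g z) z) ^ k \<le> (16 * (ppi z \<i>)\<^sup>2) powr (3/2) * ppi (psl_act g \<i>) \<i> powr (- 3/2)"
      by (smt (verit) mult_right_mono powr_ge_zero)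
  qed
qed

lemma abs_summable_bergman_series:
  assumes "Im z > 0" "k \<ge> 3"
  shows "(\<lambda>g. cmod (1 / bergman_denom (rep g) z ^ (2 * k))) summable_on \<Gamma>"
proof -
  have "cmod (1 / bergman_denom (rep g) z ^ (2 * k))
      = 1 / (4 * Im z * Im z) ^ k * (1 / ppi (psl_act g z) z) ^ k" if "g \<in> \<Gamma>" for g
    unfolding psl_act_def cmod_bergman_term[OF rep_G(3)[OF that] assms(1), of k, symmetric]
    using assms(1) by simp
  then show ?thesis
    using summable_on_cmult_right[OF summable_bergman_terms[OF assms], of "1 / (4 * Im z * Im z) ^ k"]
    by (subst summable_on_cong) auto
qed

lemma cmod_bergman_subseries_le:
  assumes "Im z > 0" "k \<ge> 3" "\<Delta> \<subseteq> \<Gamma>"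
    and le: "\<And>g. g \<in> \<Delta> \<Longrightarrow> 16 * (ppi z \<i>)\<^sup>2 / ppi (psl_act g z) z \<le> D"
  shows "(4 * Im z * Im z) ^ k * cmod (\<Sum>\<^sub>\<infinity>g\<in>\<Delta>. 1 / bergman_denom (rep g) z ^ (2 * k))
    \<le> D powr (3/2) * poincare_sum"
proof -
  let ?t = "\<lambda>g. 1 / bergman_denom (rep g) z ^ (2 * k)" and ?m = "(4 * Im z * Im z) ^ k"
  have abs: "(\<lambda>g. cmod (?t g)) summable_on \<Delta>"
    using abs_summable_bergman_series[OF assms(1,2)] assms(3) by (rule summable_on_subset_banach)
  have "?m * cmod (\<Sum>\<^sub>\<infinity>g\<in>\<Delta>. ?t g) \<le> ?m * (\<Sum>\<^sub>\<infinity>g\<in>\<Delta>. cmod (?t g))"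
    using norm_infsum_bound[OF abs] assms(1) by (intro mult_left_mono) auto
  also have "\<dots> = (\<Sum>\<^sub>\<infinity>g\<in>\<Delta>. ?m * cmod (?t g))" by (rule infsum_cmult_right'[symmetric])
  also have "\<dots> \<le> (\<Sum>\<^sub>\<infinity>g\<in>\<Delta>. D powr (3/2) * ppi (psl_act g \<i>) \<i> powr (- 3/2))"
  proof (rule infsum_mono)
    show "(\<lambda>g. ?m * cmod (?t g)) summable_on \<Delta>" using abs by (rule summable_on_cmult_right)
    show "(\<lambda>g. D powr (3/2) * ppi (psl_act g \<i>) \<i> powr (- 3/2)) summable_on \<Delta>"
      using summable_ppi_orbit assms(3) by (intro summable_on_cmult_right) (rule summable_on_subset_banach)
    fix g assume "g \<in> \<Delta>"
    then have g: "g \<in> \<Gamma>" using assms(3) by blast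
    have p: "ppi (psl_act g z) z \<ge> 1" using ppi_psl_act_ge_1 g assms by blast
    have "?m * cmod (?t g) = (1 / ppi (psl_act g z) z) ^ k"
      unfolding psl_act_def using rep_G(3)[OF g] assms(1) by (rule cmod_bergman_term)
    also have "\<dots> \<le> (16 * (ppi z \<i>)\<^sup>2 / ppi (psl_act g z) z) powr (3/2) * ppi (psl_act g \<i>) \<i> powr (- 3/2)"
      using g assms(1,2) by (rule bergman_term_le)
    also have "\<dots> \<le> D powr (3/2) * ppi (psl_act g \<i>) \<i> powr (- 3/2)"
      using le[OF \<open>g \<in> \<Delta>\<close>] p by (intro mult_right_mono powr_mono2) auto
    finally show "?m * cmod (?t g) \<le> D powr (3/2) * ppi (psl_act g \<i>) \<i> powr (- 3/2)" .
  qed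
  also have "\<dots> = D powr (3/2) * (\<Sum>\<^sub>\<infinity>g\<in>\<Delta>. ppi (psl_act g \<i>) \<i> powr (- 3/2))"
    by (rule infsum_cmult_right')
  also have "\<dots> \<le> D powr (3/2) * poincare_sum"
    unfolding poincare_sum_def using summable_ppi_orbit assms(3)
    by (intro mult_left_mono infsum_mono2 summable_on_subset_banach[OF summable_ppi_orbit]) auto
  finally show ?thesis .
qed

lemma bergman_norm_le_at_point:
  assumes "Im z > 0" "k \<ge> 3"
  shows "bergman_norm \<Gamma> k z z \<le> real k * ((16 * (ppi z \<i>)\<^sup>2) powr (3/2) * poincare_sum)"
proof -
  have "16 * (ppi z \<i>)\<^sup>2 / ppi (psl_act g z) z \<le> 16 * (ppi z \<i>)\<^sup>2" if "g \<in> \<Gamma>" for g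
    using ppi_psl_act_ge_1[OF that assms(1)] divide_left_mono[of 1 "ppi (psl_act g z) z" "16 * (ppi z \<i>)\<^sup>2"] by simp
  from cmod_bergman_subseries_le[OF assms order_refl this]
  have le: "(4 * Im z * Im z) ^ k * cmod (bergman_series \<Gamma> k z z) \<le> (16 * (ppi z \<i>)\<^sup>2) powr (3/2) * poincare_sum"
    unfolding bergman_series_diagonal .
  have "bergman_norm \<Gamma> k z z = (2 * real k - 1) / (4 * pi) * ((4 * Im z * Im z) ^ k * cmod (bergman_series \<Gamma> k z z))"
    by (simp add: bergman_norm_def)
  also have "\<dots> \<le> real k * ((16 * (ppi z \<i>)\<^sup>2) powr (3/2) * poincare_sum)"
  proof (rule mult_mono[OF _ le])
    have "2 * real k - 1 \<le> real k * (4 * pi)"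
      using pi_gt3 mult_left_mono[of 2 "4 * pi" "real k"] by (simp add: algebra_simps)
    then show "(2 * real k - 1) / (4 * pi) \<le> real k" by (simp add: divide_le_eq)
  qed auto
  finally show ?thesis .
qed

end

section \<open>Groups with a cusp at infinity\<close>

abbreviation transl :: "real \<Rightarrow> real^2^2" where "transl t \<equiv> mat2 1 t 0 1"

lemma transl_add: "transl s ** transl t = transl (s + t)"
  by (rule mat2_eqI) auto

lemma det_transl [simp]: "det (transl t) = 1"
  by (simp add: det_2)

lemma moebius_transl [simp]: "moebius (transl t) z = z + of_real t"
  by (simp add: moebius_def automorphy_def)

lemma adj2_transl [simp]: "adj2 (transl t) = transl (- t)"
  by (rule mat2_eqI) auto

locale cusp_group = fuchsian_group +
  assumes ex_transl: "\<exists>t. t \<noteq> 0 \<and> transl t \<in> \<Union>\<Gamma>"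
begin

lemma ex_width:
  obtains h where "h > 0" "transl h \<in> G" "\<And>t. transl t \<in> G \<Longrightarrow> \<exists>n::int. t = of_int n * h"
proof -
  define L where "L = {t. transl t \<in> G}"
  have add: "s + t \<in> L" if "s \<in> L" "t \<in> L" for s t
    using that G_mult[of "transl s" "transl t"] by (simp add: L_def transl_add del: Union_iff)
  have minus: "- t \<in> L" if "t \<in> L" for t
    using that G_adj2[of "transl t"] by (simp add: L_def del: Union_iff)
  have "0 \<in> L"
  proof -
    have "mat 1 = transl 0" by (rule mat2_eqI) auto
    then show ?thesis using G_one by (simp add: L_def del: Union_iff)
  qed
  have mult: "of_int n * t \<in> L" if "t \<in> L" for t and n :: int
  proof -
    have nat: "real m * t \<in> L" for m
    proof (induction m)
      case (Suc m)
      then show ?case using add[OF that Suc] by (simp add: distrib_right)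
    qed (use \<open>0 \<in> L\<close> in simp)
    show ?thesis
    proof (cases "n \<ge> 0")
      case True
      then show ?thesis using nat[of "nat n"] by simp
    next
      case False
      then show ?thesis using minus[OF nat[of "nat (- n)"]] by simp
    qed
  qed
  have fin: "finite {t \<in> L. \<bar>t\<bar> \<le> R}" for R
  proof -
    have "norm (transl t) \<le> 2 + R" if "\<bar>t\<bar> \<le> R" for t
      using norm_mat_le_entries[of "transl t"] that by simp
    then have "transl ` {t \<in> L. \<bar>t\<bar> \<le> R} \<subseteq> {A \<in> G. norm A \<le> 2 + R}"
      unfolding L_def by blast
    moreover have "inj_on transl {t \<in> L. \<bar>t\<bar> \<le> R}"
      by (rule inj_onI) (metis mat2_nth(2))
    ultimately show ?thesis using finite_norm_le inj_on_finite by blast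
  qed
  obtain t where t: "t \<noteq> 0" "t \<in> L" using ex_transl by (auto simp: L_def)
  define W where "W = {s \<in> L. 0 < s \<and> s \<le> \<bar>t\<bar>}"
  define h where "h = Min W"
  have finW: "finite W"
    unfolding W_def by (rule finite_subset[OF _ fin[of "\<bar>t\<bar>"]]) auto
  have "\<bar>t\<bar> \<in> W"
    using t minus[of t] by (auto simp: W_def abs_if)
  then have "h \<in> W" unfolding h_def using finW by (intro Min_in) auto
  then have h: "h \<in> L" "h > 0" "h \<le> \<bar>t\<bar>" by (auto simp: W_def)
  have min: "h \<le> s" if "s \<in> L" "0 < s" "s \<le> \<bar>t\<bar>" for s
    unfolding h_def using finW that by (intro Min_le) (auto simp: W_def)
  show ?thesis
  proof (rule that)
    show "h > 0" "transl h \<in> G" using h by (auto simp: L_def)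
    fix s assume "transl s \<in> G"
    then have s: "s \<in> L" by (simp add: L_def)
    define n where "n = \<lfloor>s / h\<rfloor>"
    define r where "r = s - of_int n * h"
    have "of_int n \<le> s / h" "s / h < of_int n + 1" by (auto simp: n_def)
    then have r: "0 \<le> r" "r < h" using h by (simp_all add: r_def field_simps)
    have "r \<in> L" using add[OF s minus[OF mult[OF h(1), of n]]] by (simp add: r_def)
    then have "r = 0" using min[of r] r h by fastforce
    then show "\<exists>n::int. s = of_int n * h" by (auto simp: r_def)
  qed
qed

definition width :: real where
  "width = (SOME h. h > 0 \<and> transl h \<in> G \<and> (\<forall>t. transl t \<in> G \<longrightarrow> (\<exists>n::int. t = of_int n * h)))"

lemma width: "width > 0" "transl width \<in> G" "\<And>t. transl t \<in> G \<Longrightarrow> \<exists>n::int. t = of_int n * width"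
proof -
  have "\<exists>h. h > 0 \<and> transl h \<in> G \<and> (\<forall>t. transl t \<in> G \<longrightarrow> (\<exists>n::int. t = of_int n * h))"
    using ex_width by metis
  from someI_ex[OF this] show "width > 0" "transl width \<in> G"
    "\<And>t. transl t \<in> G \<Longrightarrow> \<exists>n::int. t = of_int n * width"
    unfolding width_def by blast+
qed

lemma transl_multiple_width: "transl (of_int n * width) \<in> G"
proof -
  have nat: "transl (real m * width) \<in> G" for m
  proof (induction m)
    case 0
    have "transl (real 0 * width) = mat 1" by (rule mat2_eqI) auto
    then show ?case using G_one by simp
  next
    case (Suc m)
    have "transl (real (Suc m) * width) = transl width ** transl (real m * width)"
      by (simp add: transl_add algebra_simps)
    then show ?case using G_mult[OF width(2) Suc] by simp
  qed
  show ?thesis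
  proof (cases "n \<ge> 0")
    case True
    then show ?thesis using nat[of "nat n"] by simp
  next
    case False
    then show ?thesis using G_adj2[OF nat[of "nat (- n)"]] by simp
  qed
qed

text \<open>
  Conjugation by a matrix that fixes infinity maps the lattice of translations to its multiple by
  \<open>a\<^sup>2\<close>, so \<open>a\<^sup>2\<close> is a positive integer. The same holds for \<open>d\<^sup>2\<close>, and the product of the two is \<open>1\<close>.
\<close>

lemma stabilizer_infinity:
  assumes "A \<in> G" "A$2$1 = 0"
  shows "\<exists>n::int. A = transl (of_int n * width) \<or> A = - transl (of_int n * width)"
proof -
  have ge: "(B$1$1)\<^sup>2 \<ge> 1" if B: "B \<in> G" "B$2$1 = 0" for B
  proof -
    have det: "B$1$1 * B$2$2 = 1" using det_G[OF B(1)] B(2) by (simp add: det_2)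
    have "B ** transl width ** adj2 B = transl ((B$1$1)\<^sup>2 * width)"
      using B(2) det by (intro mat2_eqI) (auto simp: algebra_simps power2_eq_square)
    then have "transl ((B$1$1)\<^sup>2 * width) \<in> G"
      using G_mult[OF G_mult[OF B(1) width(2)] G_adj2[OF B(1)]] by simp
    then obtain n :: int where n: "(B$1$1)\<^sup>2 * width = of_int n * width" using width(3) by blast
    then have "(B$1$1)\<^sup>2 = of_int n" using width(1) by simp
    moreover have "(B$1$1)\<^sup>2 > 0" using det by auto
    ultimately show ?thesis by simp
  qed
  have det: "A$1$1 * A$2$2 = 1" using det_G[OF assms(1)] assms(2) by (simp add: det_2)
  have "(A$1$1)\<^sup>2 \<ge> 1" "(A$2$2)\<^sup>2 \<ge> 1"
    using ge[OF assms] ge[OF G_adj2[OF assms(1)]] assms(2) by simp_all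
  moreover have "(A$1$1)\<^sup>2 * (A$2$2)\<^sup>2 = 1" using det by (simp flip: power_mult_distrib)
  ultimately have "(A$1$1)\<^sup>2 = 1"
    using mult_left_mono[of 1 "(A$2$2)\<^sup>2" "(A$1$1)\<^sup>2"] by simp
  then have "A$1$1 = 1 \<and> A$2$2 = 1 \<or> A$1$1 = - 1 \<and> A$2$2 = - 1"
    using det by (auto simp: power2_eq_1_iff)
  then have "A = transl (A$1$2) \<or> A = - transl (- A$1$2)"
    using assms(2) by (auto intro!: mat2_eqI)
  then show ?thesis
  proof
    assume A: "A = transl (A$1$2)"
    then show ?thesis using width(3)[of "A$1$2"] assms(1) by metis
  next
    assume A: "A = - transl (- A$1$2)"
    then have "transl (- A$1$2) \<in> G" using G_uminus[OF assms(1)] by (metis minus_minus)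
    then show ?thesis using width(3) A by metis
  qed
qed

text \<open>
  Multiplying by translations from both sides brings the diagonal entries close to \<open>1\<close> without
  changing the lower left entry; then all entries are bounded, and discreteness leaves finitely many
  small values of the lower left entry.
\<close>

lemma ex_lower_left_bound:
  obtains c0 where "c0 > 0" "\<And>A. A \<in> G \<Longrightarrow> A$2$1 \<noteq> 0 \<Longrightarrow> c0 \<le> \<bar>A$2$1\<bar>"
proof -
  define R where "R = (1 + width) + (width * width + 2 * width) + 1 + (1 + width)"
  define V where "V = insert 1 ((\<lambda>A. \<bar>A$2$1\<bar>) ` {A \<in> {A \<in> G. norm A \<le> R}. A$2$1 \<noteq> 0})"
  have fin: "finite V" unfolding V_def
    by (intro finite.insertI finite_imageI finite_Collect_conjI disjI1) (use finite_norm_le in simp)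
  have pos: "v > 0" if "v \<in> V" for v using that by (auto simp: V_def)
  have shift: "\<exists>m::int. \<bar>a + of_int m * width * c - 1\<bar> \<le> width * \<bar>c\<bar>" if "c \<noteq> 0" for a c :: real
  proof -
    define w where "w = width * c"
    define m where "m = - \<lfloor>(a - 1) / w\<rfloor>"
    have w: "w \<noteq> 0" using that width(1) by (simp add: w_def)
    have "\<bar>(a - 1) / w + of_int m\<bar> \<le> 1" unfolding m_def by linarith
    then have "\<bar>(a - 1) / w + of_int m\<bar> * \<bar>w\<bar> \<le> 1 * \<bar>w\<bar>" by (rule mult_right_mono) simp
    also have "\<bar>(a - 1) / w + of_int m\<bar> * \<bar>w\<bar> = \<bar>a + of_int m * width * c - 1\<bar>"
    proof -
      have "((a - 1) / w + of_int m) * w = a + of_int m * width * c - 1"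
        using w by (simp add: distrib_right) (simp add: w_def)
      then show ?thesis by (simp only: abs_mult[symmetric])
    qed
    finally show ?thesis using width(1) by (auto simp: w_def abs_mult)
  qed
  have "Min V \<le> \<bar>A$2$1\<bar>" if A: "A \<in> G" "A$2$1 \<noteq> 0" for A
  proof (cases "\<bar>A$2$1\<bar> \<le> 1")
    case False
    then show ?thesis using Min_le[OF fin, of 1] by (simp add: V_def)
  next
    case True
    define c where "c = A$2$1"
    have c: "c \<noteq> 0" "\<bar>c\<bar> \<le> 1" using A True by (auto simp: c_def)
    obtain m :: int where m: "\<bar>A$1$1 + of_int m * width * c - 1\<bar> \<le> width * \<bar>c\<bar>" using shift c by blast
    obtain n :: int where n: "\<bar>A$2$2 + of_int n * width * c - 1\<bar> \<le> width * \<bar>c\<bar>" using shift c by blast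
    define B where "B = transl (of_int m * width) ** A ** transl (of_int n * width)"
    have B: "B \<in> G" using A G_mult transl_multiple_width by (simp add: B_def del: Union_iff)
    have B21: "B$2$1 = c" by (simp add: B_def c_def)
    define a d where "a = B$1$1 - 1" and "d = B$2$2 - 1"
    have wc: "width * \<bar>c\<bar> \<le> width" using c width(1) mult_left_mono[of "\<bar>c\<bar>" 1 width] by simp
    have ad: "\<bar>a\<bar> \<le> width * \<bar>c\<bar>" "\<bar>d\<bar> \<le> width * \<bar>c\<bar>"
      using m n by (simp_all add: a_def d_def B_def c_def algebra_simps)
    have "B$1$2 * c = a * d + a + d"
      using det_G[OF B] by (simp add: det_2 B21 a_def d_def algebra_simps)
    then have "\<bar>B$1$2\<bar> * \<bar>c\<bar> \<le> \<bar>a\<bar> * \<bar>d\<bar> + \<bar>a\<bar> + \<bar>d\<bar>"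
      by (simp flip: abs_mult) 
    also have "\<dots> \<le> width * (width * \<bar>c\<bar>) + width * \<bar>c\<bar> + width * \<bar>c\<bar>"
      using ad wc by (intro add_mono mult_mono) auto
    finally have "\<bar>B$1$2\<bar> * \<bar>c\<bar> \<le> (width * width + 2 * width) * \<bar>c\<bar>" by (simp add: algebra_simps)
    then have "\<bar>B$1$2\<bar> \<le> width * width + 2 * width" using c by simp
    moreover have "\<bar>B$1$1\<bar> \<le> 1 + width" "\<bar>B$2$2\<bar> \<le> 1 + width"
      using ad wc unfolding a_def d_def by linarith+
    ultimately have "norm B \<le> R"
      using norm_mat_le_entries[of B] B21 c by (simp add: R_def)
    then have "\<bar>A$2$1\<bar> \<in> V" using B B21 c by (auto simp: V_def c_def intro!: image_eqI[of _ _ B])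
    then show ?thesis using fin by (rule Min_le[rotated])
  qed
  moreover have "Min V > 0" using fin pos Min_in[of V] by (auto simp: V_def)
  ultimately show ?thesis using that by blast
qed

end

context cusp_group
begin

definition \<Gamma>_inf :: "(real^2^2) set set" where
  "\<Gamma>_inf = {g \<in> \<Gamma>. rep g $ 2 $ 1 = 0}"

lemma bij_betw_\<Gamma>_inf:
  "bij_betw (\<lambda>n::int. {transl (of_int n * width), - transl (of_int n * width)}) UNIV \<Gamma>_inf"
proof (rule bij_betwI')
  fix m n :: int
  have "transl (of_int m * width) \<noteq> - transl (of_int n * width)"
    by (metis mat2_nth(1) one_neq_neg_one vector_uminus_component)
  moreover have "transl (of_int m * width) = transl (of_int n * width) \<Longrightarrow> m = n"
    using width(1) mat2_nth(2)[of 1 "of_int m * width" 0 1] by force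
  ultimately show "({transl (of_int m * width), - transl (of_int m * width)} =
      {transl (of_int n * width), - transl (of_int n * width)}) = (m = n)"
    by (metis insert_iff singletonD)
next
  fix n :: int
  show "{transl (of_int n * width), - transl (of_int n * width)} \<in> \<Gamma>_inf"
    using coset_G[OF transl_multiple_width[of n]] unfolding \<Gamma>_inf_def
    by (elim disjE) auto
next
  fix g assume "g \<in> \<Gamma>_inf"
  then have g: "g \<in> \<Gamma>" "rep g $ 2 $ 1 = 0" by (auto simp: \<Gamma>_inf_def)
  obtain n :: int where "rep g = transl (of_int n * width) \<or> rep g = - transl (of_int n * width)"
    using stabilizer_infinity[OF rep_G(1)[OF g(1)] g(2)] by blast
  then have "{rep g, - rep g} = {transl (of_int n * width), - transl (of_int n * width)}" by auto
  then show "\<exists>n\<in>UNIV. g = {transl (of_int n * width), - transl (of_int n * width)}"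
    using rep_G(2)[OF g(1)] by blast
qed

lemma cmod_bergman_cusp_sum_le:
  assumes "Im z > 0" "k \<ge> 3"
  shows "(4 * Im z * Im z) ^ k * cmod (\<Sum>\<^sub>\<infinity>g\<in>\<Gamma>_inf. 1 / bergman_denom (rep g) z ^ (2 * k))
    \<le> 2 * pi * sqrt (real k)"
proof -
  define s where "s = - width / (2 * Im z)"
  define f where "f = (\<lambda>x::real. 1 / (1 + \<i> * of_real (s * x)) ^ (2 * k))"
  define m where "m = (2 * \<i> * of_real (Im z)) ^ (2 * k)"
  let ?t = "\<lambda>g. 1 / bergman_denom (rep g) z ^ (2 * k)"
  let ?\<phi> = "\<lambda>n::int. {transl (of_int n * width), - transl (of_int n * width)}"
  have cmod_m: "cmod m = (4 * Im z * Im z) ^ k"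
    using assms(1) by (simp add: m_def norm_power norm_mult power_mult power_mult_distrib power2_eq_square)
  then have m0: "m \<noteq> 0" using assms(1) by (metis mult_pos_pos norm_zero zero_less_numeral zero_less_power less_irrefl)
  have f_eq: "?t (?\<phi> n) = (1 / m) * f (of_int n)" for n
  proof -
    have "bergman_denom (rep (?\<phi> n)) z ^ (2 * k) = bergman_denom (transl (of_int n * width)) z ^ (2 * k)"
      using coset_G(2)[OF transl_multiple_width[of n]] by (auto simp: bergman_denom_uminus)
    also have "bergman_denom (transl (of_int n * width)) z
        = 2 * \<i> * of_real (Im z) * (1 + \<i> * of_real (s * of_int n))"
      using assms(1)
      by (simp add: bergman_denom_def automorphy_def s_def complex_eq_iff)
    finally show ?thesis
      by (simp add: m_def f_def power_mult_distrib)
  qed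
  have "(\<lambda>g. cmod (?t g)) summable_on \<Gamma>_inf"
    by (rule summable_on_subset_banach[OF abs_summable_bergman_series[OF assms]]) (auto simp: \<Gamma>_inf_def)
  then have "?t summable_on \<Gamma>_inf" by (rule abs_summable_summable)
  then have "(\<lambda>n. ?t (?\<phi> n)) summable_on UNIV"
    by (subst summable_on_reindex_bij_betw[OF bij_betw_\<Gamma>_inf])
  then have "(\<lambda>n::int. m * ((1 / m) * f (of_int n))) summable_on UNIV"
    unfolding f_eq by (rule summable_on_cmult_right)
  then have summ: "(\<lambda>n::int. f (of_int n)) summable_on UNIV" using m0 by simp
  have "(\<Sum>\<^sub>\<infinity>g\<in>\<Gamma>_inf. ?t g) = (\<Sum>\<^sub>\<infinity>n. ?t (?\<phi> n))"
    by (rule infsum_reindex_bij_betw[OF bij_betw_\<Gamma>_inf, symmetric])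
  also have "\<dots> = (1 / m) * (\<Sum>\<^sub>\<infinity>n::int. f (of_int n))"
    unfolding f_eq by (rule infsum_cmult_right')
  finally have "m * (\<Sum>\<^sub>\<infinity>g\<in>\<Gamma>_inf. ?t g) = (\<Sum>\<^sub>\<infinity>n::int. f (of_int n))" using m0 by simp
  then have "(4 * Im z * Im z) ^ k * cmod (\<Sum>\<^sub>\<infinity>g\<in>\<Gamma>_inf. ?t g) = cmod (\<Sum>\<^sub>\<infinity>n::int. f (of_int n))"
    by (metis cmod_m norm_mult)
  also have "\<dots> \<le> 2 * pi * sqrt (real k)"
    unfolding f_def
    by (rule cmod_infsum_inverse_powers_le)
       (use assms width(1) summ in \<open>auto simp: s_def f_def\<close>)
  finally show ?thesis .
qed

text \<open>
  Away from the stabilizer of infinity, \<open>ppi (\<gamma> z) z\<close> grows like \<open>(Im z)\<^sup>2\<close>, which makes up for the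
  loss of a factor \<open>(Im z)\<^sup>2\<close> in the comparison of \<open>z\<close> with the base point \<open>\<i>\<close>. So the other terms
  contribute a constant that depends on the group, but not on \<open>k\<close> or \<open>z\<close>.
\<close>

lemma ex_bound_near_cusp:
  assumes "Y > 0"
  obtains C where "C \<ge> 0" "\<And>z k. Im z \<ge> Y \<Longrightarrow> 0 \<le> Re z \<Longrightarrow> Re z \<le> width \<Longrightarrow> k \<ge> 3 \<Longrightarrow>
    bergman_norm \<Gamma> k z z \<le> real k * (sqrt (real k) + C)"
proof -
  obtain c0 where c0: "c0 > 0" "\<And>A. A \<in> G \<Longrightarrow> A$2$1 \<noteq> 0 \<Longrightarrow> c0 \<le> \<bar>A$2$1\<bar>"
    using ex_lower_left_bound by blast
  define Q where "Q = ((width / Y)\<^sup>2 + (1 + 1 / Y)\<^sup>2) / 4"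
  define D where "D = 64 * Q\<^sup>2 / c0\<^sup>2"
  define C where "C = D powr (3/2) * poincare_sum"
  have C: "C \<ge> 0" using poincare_sum_nonneg by (simp add: C_def)
  have "bergman_norm \<Gamma> k z z \<le> real k * (sqrt (real k) + C)"
    if z: "Im z \<ge> Y" "0 \<le> Re z" "Re z \<le> width" and k: "k \<ge> 3" for z k
  proof -
    define y where "y = Im z"
    have y: "y > 0" "Im z > 0" using z assms by (auto simp: y_def)
    let ?t = "\<lambda>g. 1 / bergman_denom (rep g) z ^ (2 * k)" and ?m = "(4 * Im z * Im z) ^ k"
    have "ppi z \<i> / y = ((Re z / y)\<^sup>2 + (1 + 1 / y)\<^sup>2) / 4"
      using y by (simp add: ppi_alt y_def[symmetric] field_simps power2_eq_square)
    also have "\<dots> \<le> Q" unfolding Q_def using z assms y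
      by (intro divide_right_mono add_mono power_mono add_left_mono divide_left_mono frac_le) (auto simp: y_def)
    finally have P: "ppi z \<i> / y \<le> Q" .
    have P0: "ppi z \<i> / y \<ge> 0" using y ppi_ge_1[of z \<i>] by simp
    have rest: "16 * (ppi z \<i>)\<^sup>2 / ppi (psl_act g z) z \<le> D" if "g \<in> \<Gamma> - \<Gamma>_inf" for g
    proof -
      have g: "g \<in> \<Gamma>" "rep g $ 2 $ 1 \<noteq> 0" using that by (auto simp: \<Gamma>_inf_def)
      have det: "det (rep g) = 1" using rep_G(3)[OF g(1)] .
      have "c0 \<le> \<bar>rep g $ 2 $ 1\<bar>" using c0(2) rep_G(1)[OF g(1)] g(2) by blast
      then have "c0\<^sup>2 \<le> (rep g $ 2 $ 1)\<^sup>2" using c0(1) by (metis abs_le_square_iff abs_of_pos)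
      then have "c0\<^sup>2 * y\<^sup>2 \<le> (cmod (automorphy (rep g) z))\<^sup>2"
        unfolding cmod_automorphy_sq power_mult_distrib y_def
        by (smt (verit) mult_right_mono zero_le_power2)
      also have "\<dots> = 4 * (Im z / (4 * Im (psl_act g z)))"
        unfolding psl_act_def Im_moebius[OF det y(2)] using y automorphy_nz[OF det y(2)] by simp
      also have "\<dots> \<le> 4 * ppi (psl_act g z) z"
        using ppi_ge_Im_quotient[OF y(2) Im_psl_act_pos[OF g(1) y(2)]] by (simp add: ppi_commute)
      finally have p: "c0\<^sup>2 * y\<^sup>2 / 4 \<le> ppi (psl_act g z) z" by simp
      have "16 * (ppi z \<i>)\<^sup>2 / ppi (psl_act g z) z \<le> 16 * (ppi z \<i>)\<^sup>2 / (c0\<^sup>2 * y\<^sup>2 / 4)"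
        using p c0(1) y ppi_psl_act_ge_1[OF g(1) y(2)] by (intro divide_left_mono mult_pos_pos) auto
      also have "\<dots> = 64 * (ppi z \<i> / y)\<^sup>2 / c0\<^sup>2"
        by (simp add: power_divide field_simps)
      also have "\<dots> \<le> D"
        unfolding D_def using P P0 by (intro divide_right_mono mult_left_mono power_mono) auto
      finally show ?thesis .
    qed
    have sub: "\<Gamma>_inf \<subseteq> \<Gamma>" by (auto simp: \<Gamma>_inf_def)
    have summ: "?t summable_on \<Delta>" if "\<Delta> \<subseteq> \<Gamma>" for \<Delta>
      using abs_summable_summable[OF abs_summable_bergman_series[OF y(2) k]] that
      by (rule summable_on_subset_banach)
    have "bergman_series \<Gamma> k z z = (\<Sum>\<^sub>\<infinity>g\<in>\<Gamma>_inf \<union> (\<Gamma> - \<Gamma>_inf). ?t g)"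
      unfolding bergman_series_diagonal using sub by (simp add: Un_absorb1)
    also have "\<dots> = (\<Sum>\<^sub>\<infinity>g\<in>\<Gamma>_inf. ?t g) + (\<Sum>\<^sub>\<infinity>g\<in>\<Gamma> - \<Gamma>_inf. ?t g)"
      using summ sub by (intro infsum_Un_disjoint) auto
    finally have "?m * cmod (bergman_series \<Gamma> k z z)
        \<le> ?m * (cmod (\<Sum>\<^sub>\<infinity>g\<in>\<Gamma>_inf. ?t g) + cmod (\<Sum>\<^sub>\<infinity>g\<in>\<Gamma> - \<Gamma>_inf. ?t g))"
      using y by (intro mult_left_mono) (auto intro: norm_triangle_ineq)
    also have "\<dots> \<le> 2 * pi * sqrt (real k) + C"
      unfolding distrib_left C_def
      by (intro add_mono cmod_bergman_cusp_sum_le cmod_bergman_subseries_le rest y k) auto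
    finally have le: "?m * cmod (bergman_series \<Gamma> k z z) \<le> 2 * pi * sqrt (real k) + C" .
    have "bergman_norm \<Gamma> k z z = (2 * real k - 1) / (4 * pi) * (?m * cmod (bergman_series \<Gamma> k z z))"
      by (simp add: bergman_norm_def)
    also have "\<dots> \<le> real k / (2 * pi) * (2 * pi * sqrt (real k) + C)"
      using le y k by (intro mult_mono) (auto simp: field_simps)
    also have "\<dots> = real k * (sqrt (real k) + C / (2 * pi))" by (simp add: field_simps)
    also have "\<dots> \<le> real k * (sqrt (real k) + C)"
    proof -
      have "C / (2 * pi) \<le> C / 1" using C pi_gt3 by (intro divide_left_mono) auto
      then show ?thesis by (intro mult_left_mono add_left_mono) auto
    qed
    finally show ?thesis .
  qed
  with C show ?thesis using that by blast
qed

end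

section \<open>The hyperbolic area\<close>

definition cpx :: "real^2 \<Rightarrow> complex" where "cpx v = Complex (v$1) (v$2)"
definition vec2 :: "complex \<Rightarrow> real^2" where "vec2 z = vector [Re z, Im z]"

lemma cpx_simps [simp]: "Re (cpx v) = v$1" "Im (cpx v) = v$2"
  by (simp_all add: cpx_def)

lemma vec2_simps [simp]: "vec2 z $ 1 = Re z" "vec2 z $ 2 = Im z"
  by (simp_all add: vec2_def)

lemma cpx_vec2 [simp]: "cpx (vec2 z) = z"
  by (simp add: complex_eq_iff)

lemma vec2_cpx [simp]: "vec2 (cpx v) = v"
  by (simp add: vec_eq_iff forall_2)

lemma bounded_linear_cpx: "bounded_linear cpx"
  by (subst linear_conv_bounded_linear[symmetric]) (auto intro!: linearI simp: complex_eq_iff)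

lemma bounded_linear_vec2: "bounded_linear vec2"
  by (subst linear_conv_bounded_linear[symmetric]) (auto intro!: linearI simp: vec_eq_iff forall_2)

lemma borel_cpx [measurable]: "cpx \<in> borel_measurable borel"
  and borel_vec2 [measurable]: "vec2 \<in> borel_measurable borel"
  by (intro borel_measurable_continuous_onI linear_continuous_on bounded_linear_cpx bounded_linear_vec2)+

lemma prod_Basis_real2:
  fixes f :: "real^2 \<Rightarrow> real"
  shows "(\<Prod>b\<in>Basis. f b) = f (axis 1 1) * f (axis 2 1)"
proof -
  have B: "(Basis :: (real^2) set) = {axis 1 1, axis 2 1}"
    by (auto simp: Basis_vec_def UNIV_2)
  have "axis 1 1 \<noteq> (axis 2 1 :: real^2)" by (simp add: axis_eq_axis)
  then show ?thesis unfolding B by simp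
qed

lemma lborel_complex_eq_distr: "(lborel :: complex measure) = distr lborel borel cpx"
proof (rule lborel_eqI)
  fix l u :: complex
  assume le: "\<And>b. b \<in> Basis \<Longrightarrow> l \<bullet> b \<le> u \<bullet> b"
  have "Re l \<le> Re u" "Im l \<le> Im u" using le[of 1] le[of \<i>] by (auto simp: Basis_complex_def)
  have vimage: "cpx -` box l u = box (vec2 l) (vec2 u)"
    by (auto simp: mem_box_cart in_box_complex_iff forall_2)
  have "emeasure (distr lborel borel cpx) (box l u) = emeasure lborel (box (vec2 l) (vec2 u))"
    by (simp add: emeasure_distr vimage)
  also have "\<dots> = (\<Prod>b\<in>Basis. (vec2 u - vec2 l) \<bullet> b)"
    by (rule emeasure_lborel_box)
       (use le[of 1] le[of \<i>] in \<open>auto simp: Basis_vec_def UNIV_2 inner_axis Basis_complex_def\<close>)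
  also have "(\<Prod>b\<in>Basis. (vec2 u - vec2 l) \<bullet> b) = (\<Prod>b\<in>Basis. (u - l) \<bullet> b)"
    by (simp add: prod_Basis_real2 inner_axis Basis_complex_def)
  finally show "emeasure (distr lborel borel cpx) (box l u) = (\<Prod>b\<in>Basis. (u - l) \<bullet> b)" .
qed simp

lemma emeasure_hyperbolic_area:
  assumes "X \<in> sets borel" "X \<subseteq> upper_half_plane"
  shows "emeasure hyperbolic_area X
    = (\<integral>\<^sup>+v. indicator (cpx -` X) v * ennreal (1 / (v$2)\<^sup>2) \<partial>lborel)"
proof -
  have H: "upper_half_plane \<in> sets borel"
    unfolding upper_half_plane_def by measurable
  have "emeasure hyperbolic_area X
      = (\<integral>\<^sup>+z. ennreal (1 / (Im z)\<^sup>2) * indicator upper_half_plane z * indicator X z \<partial>lborel)"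
    unfolding hyperbolic_area_def using assms H by (subst emeasure_density) auto
  also have "\<dots> = (\<integral>\<^sup>+z. indicator X z * ennreal (1 / (Im z)\<^sup>2) \<partial>lborel)"
    using assms(2) by (intro nn_integral_cong) (auto simp: indicator_def)
  also have "\<dots> = (\<integral>\<^sup>+v. indicator X (cpx v) * ennreal (1 / (Im (cpx v))\<^sup>2) \<partial>lborel)"
    using assms(1) by (subst lborel_complex_eq_distr, subst nn_integral_distr) auto
  finally show ?thesis by (simp add: indicator_vimage[symmetric] indicator_def)
qed

lemma moebius_has_field_derivative:
  assumes "det A = 1" "Im z > 0"
  shows "(moebius A has_field_derivative 1 / (automorphy A z)\<^sup>2) (at z)"
proof -
  have nz: "automorphy A z \<noteq> 0" using assms by (rule automorphy_nz)
  have d: "complex_of_real (A$1$1) * of_real (A$2$2) - of_real (A$1$2) * of_real (A$2$1) = 1"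
    using assms(1) by (simp add: det_2 flip: of_real_mult of_real_diff)
  have "((\<lambda>z. (of_real (A$1$1) * z + of_real (A$1$2)) / automorphy A z) has_field_derivative
      (of_real (A$1$1) * automorphy A z - (of_real (A$1$1) * z + of_real (A$1$2)) * of_real (A$2$1))
        / (automorphy A z * automorphy A z)) (at z)"
    unfolding automorphy_def
    by (rule DERIV_divide) (use nz in \<open>auto intro!: derivative_eq_intros simp: automorphy_def\<close>)
  moreover have "of_real (A$1$1) * automorphy A z - (of_real (A$1$1) * z + of_real (A$1$2)) * of_real (A$2$1) = 1"
    using d by (simp add: automorphy_def algebra_simps)
  moreover have "(\<lambda>z. (of_real (A$1$1) * z + of_real (A$1$2)) / automorphy A z) = moebius A"
    by (simp add: fun_eq_iff moebius_def)
  ultimately show ?thesis by (simp add: power2_eq_square)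
qed

lemma continuous_on_moebius: "det A = 1 \<Longrightarrow> continuous_on upper_half_plane (moebius A)"
  using moebius_has_field_derivative DERIV_isCont by (intro continuous_at_imp_continuous_on) fastforce

lemma moebius_image_eq_vimage:
  assumes "det A = 1" "S \<subseteq> upper_half_plane"
  shows "moebius A ` S = upper_half_plane \<inter> moebius (adj2 A) -` S"
  using assms moebius_adj2[OF assms(1)] Im_moebius_pos[OF assms(1)]
  by (auto simp: image_iff subset_iff) metis

lemma borel_vimage_moebius:
  assumes "det A = 1" "S \<in> sets borel"
  shows "upper_half_plane \<inter> moebius A -` S \<in> sets borel"
proof -
  have H: "upper_half_plane \<in> sets borel"
    unfolding upper_half_plane_def by measurable
  have "moebius A \<in> borel_measurable (restrict_space borel upper_half_plane)"
    by (rule borel_measurable_continuous_on_restrict[OF continuous_on_moebius[OF assms(1)]])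
  from measurable_sets[OF this assms(2)] show ?thesis
    using H by (simp add: space_restrict_space sets_restrict_space_iff Int_commute)
qed

text \<open>
  The Jacobian \<open>\<bar>c z + d\<bar> ^ (- 4)\<close> of the transformation cancels against the change of the density
  \<open>1 / y\<^sup>2\<close>. The change of variables takes place in \<open>\<real>\<^sup>2\<close>, with values in \<open>\<real>\<^sup>1\<close>.
\<close>

lemma emeasure_hyperbolic_moebius_image:
  assumes "det A = 1" "S \<in> sets borel" "S \<subseteq> upper_half_plane" "emeasure hyperbolic_area S < \<infinity>"
  shows "emeasure hyperbolic_area (moebius A ` S) = emeasure hyperbolic_area S"
proof -
  define f :: "real^2 \<Rightarrow> real" where "f = (\<lambda>v. 1 / (v$2)\<^sup>2)"
  define F :: "real^2 \<Rightarrow> real^1" where "F = (\<lambda>v. vec (f v))"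
  define g where "g = (\<lambda>v. vec2 (moebius A (cpx v)))"
  define g' where "g' = (\<lambda>v h. vec2 (1 / (automorphy A (cpx v))\<^sup>2 * cpx h))"
  define T where "T = cpx -` S"
  have f0: "f v \<ge> 0" for v by (simp add: f_def)
  have [measurable]: "f \<in> borel_measurable borel" unfolding f_def by measurable
  have T: "T \<in> sets borel" unfolding T_def using measurable_sets[OF borel_cpx assms(2)] by simp
  have TH: "v$2 > 0" if "v \<in> T" for v using that assms(3) by (auto simp: T_def)
  have gT: "g ` T = cpx -` (moebius A ` S)"
  proof (intro equalityI subsetI)
    fix w assume "w \<in> cpx -` (moebius A ` S)"
    then obtain z where z: "z \<in> S" "cpx w = moebius A z" by auto
    then have "w = g (vec2 z)" by (metis cpx_vec2 g_def vec2_cpx)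
    with z show "w \<in> g ` T" by (auto simp: T_def)
  qed (auto simp: g_def T_def)
  have AS: "moebius A ` S \<in> sets borel" "moebius A ` S \<subseteq> upper_half_plane"
    unfolding moebius_image_eq_vimage[OF assms(1,3)]
    using borel_vimage_moebius[of "adj2 A" S] assms by auto
  have gT_borel: "g ` T \<in> sets borel"
    unfolding gT using measurable_sets[OF borel_cpx AS(1)] by simp
  have integrable_iff: "f absolutely_integrable_on X \<and> integral X f = b \<longleftrightarrow>
      (\<integral>\<^sup>+v. indicator X v * ennreal (f v) \<partial>lborel) = ennreal b" if X: "X \<in> sets borel" and b: "b \<ge> 0" for X b
  proof -
    have nn: "(\<integral>\<^sup>+v. indicator X v * ennreal (f v) \<partial>lborel) = (\<integral>\<^sup>+v. ennreal (indicator X v *\<^sub>R f v) \<partial>lebesgue)"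
      by (subst nn_integral_completion) (auto intro!: nn_integral_cong simp: indicator_def)
    have meas: "(\<lambda>v. indicator X v *\<^sub>R f v) \<in> borel_measurable lebesgue"
      using X \<open>f \<in> borel_measurable borel\<close>
      by (intro measurable_completion borel_measurable_scaleR borel_measurable_indicator) auto
    show ?thesis
    proof
      assume "f absolutely_integrable_on X \<and> integral X f = b"
      then have "integrable lebesgue (\<lambda>v. indicator X v *\<^sub>R f v)" "(LINT v|lebesgue. indicator X v *\<^sub>R f v) = b"
        using set_lebesgue_integral_eq_integral(2)[of X f]
        by (auto simp: set_integrable_def set_lebesgue_integral_def)
      then show "(\<integral>\<^sup>+v. indicator X v * ennreal (f v) \<partial>lborel) = ennreal b"
        unfolding nn using nn_integral_eq_integral[of lebesgue "\<lambda>v. indicator X v *\<^sub>R f v"] f0 by simp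
    next
      assume eq: "(\<integral>\<^sup>+v. indicator X v * ennreal (f v) \<partial>lborel) = ennreal b"
      have "has_bochner_integral lebesgue (\<lambda>v. indicator X v *\<^sub>R f v) b"
        using meas f0 b eq unfolding nn by (intro has_bochner_integral_nn_integral) auto
      then have "set_integrable lebesgue X f" "(LINT v:X|lebesgue. f v) = b"
        unfolding set_integrable_def set_lebesgue_integral_def
        by (auto simp: has_bochner_integral_iff)
      then show "f absolutely_integrable_on X \<and> integral X f = b"
        using set_lebesgue_integral_eq_integral(2)[of X f] by simp
    qed
  qed
  have bl_vec: "bounded_linear (vec :: real \<Rightarrow> real^1)"
    by (subst linear_conv_bounded_linear[symmetric]) (auto intro!: linearI simp: vec_eq_iff)
  have bl_nth: "bounded_linear (\<lambda>v :: real^1. v $ 1)" by (rule bounded_linear_vec_nth)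
  have F_iff: "F absolutely_integrable_on X \<and> integral X F = vec b \<longleftrightarrow> f absolutely_integrable_on X \<and> integral X f = b" for X b
  proof
    assume F: "F absolutely_integrable_on X \<and> integral X F = vec b"
    have "(\<lambda>v. v $ 1) \<circ> F = f" by (auto simp: F_def)
    then show "f absolutely_integrable_on X \<and> integral X f = b"
      using absolutely_integrable_linear[OF conjunct1[OF F] bl_nth] F
        integral_linear[OF set_lebesgue_integral_eq_integral(1)[OF conjunct1[OF F]] bl_nth]
      by simp
  next
    assume f: "f absolutely_integrable_on X \<and> integral X f = b"
    have "vec \<circ> f = F" by (auto simp: F_def)
    then show "F absolutely_integrable_on X \<and> integral X F = vec b"
      using absolutely_integrable_linear[OF conjunct1[OF f] bl_vec] f
        integral_linear[OF set_lebesgue_integral_eq_integral(1)[OF conjunct1[OF f]] bl_vec]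
      by simp
  qed
  have der: "(g has_derivative g' v) (at v within T)" if "v \<in> T" for v
  proof -
    have "(moebius A has_derivative (\<lambda>h. 1 / (automorphy A (cpx v))\<^sup>2 * h)) (at (cpx v))"
      using moebius_has_field_derivative[OF assms(1), of "cpx v"] TH[OF that]
      unfolding has_field_derivative_def cpx_simps by blast
    from has_derivative_compose[OF bounded_linear_imp_has_derivative[OF bounded_linear_cpx] this]
    have "((\<lambda>v. moebius A (cpx v)) has_derivative (\<lambda>h. 1 / (automorphy A (cpx v))\<^sup>2 * cpx h)) (at v within T)" .
    from has_derivative_compose[OF this bounded_linear_imp_has_derivative[OF bounded_linear_vec2]]
    show ?thesis unfolding g_def g'_def .
  qed
  have inj: "inj_on g T"
  proof (rule inj_onI)
    fix v w assume vw: "v \<in> T" "w \<in> T" "g v = g w"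
    then have "moebius A (cpx v) = moebius A (cpx w)" by (metis cpx_vec2 g_def)
    then have "cpx v = cpx w" using moebius_adj2(1)[OF assms(1)] TH vw by (metis cpx_simps(2))
    then show "v = w" by (metis vec2_cpx)
  qed
  have jac: "\<bar>det (matrix (g' v))\<bar> *\<^sub>R F (g v) = F v" if "v \<in> T" for v
  proof -
    define m where "m = 1 / (automorphy A (cpx v))\<^sup>2"
    have y: "Im (cpx v) > 0" using TH[OF that] by simp
    have nz: "automorphy A (cpx v) \<noteq> 0" using automorphy_nz[OF assms(1) y] .
    have "det (matrix (g' v)) = (cmod m)\<^sup>2"
      unfolding g'_def m_def[symmetric]
      by (simp only: cmod_power2) (simp add: det_2 matrix_def axis_def power2_eq_square)
    also have "\<dots> = 1 / ((cmod (automorphy A (cpx v)))\<^sup>2)\<^sup>2"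
      by (simp add: m_def norm_divide norm_power power_divide)
    finally have "\<bar>det (matrix (g' v))\<bar> * f (g v) = f v"
      using nz Im_moebius[OF assms(1) y] by (simp add: f_def g_def power_divide)
    then show ?thesis by (simp add: F_def vec_eq_iff)
  qed
  obtain b where b: "emeasure hyperbolic_area S = ennreal b" "b \<ge> 0"
    using assms(4) by (cases "emeasure hyperbolic_area S") auto
  have "(\<integral>\<^sup>+v. indicator T v * ennreal (f v) \<partial>lborel) = ennreal b"
    using emeasure_hyperbolic_area[OF assms(2,3)] b by (simp add: T_def f_def)
  then have "F absolutely_integrable_on T \<and> integral T F = vec b"
    using integrable_iff[OF T b(2)] F_iff by blast
  then have "(\<lambda>v. \<bar>det (matrix (g' v))\<bar> *\<^sub>R F (g v)) absolutely_integrable_on T \<and>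
      integral T (\<lambda>v. \<bar>det (matrix (g' v))\<bar> *\<^sub>R F (g v)) = vec b"
    using jac by (simp cong: set_integrable_cong integral_cong)
  then have "F absolutely_integrable_on (g ` T) \<and> integral (g ` T) F = vec b"
    using has_absolute_integral_change_of_variables[OF _ der inj, of F "vec b"] T by auto
  then have "(\<integral>\<^sup>+v. indicator (g ` T) v * ennreal (f v) \<partial>lborel) = ennreal b"
    using integrable_iff[OF gT_borel b(2)] F_iff by blast
  then show ?thesis
    using emeasure_hyperbolic_area[OF AS] b by (simp add: gT f_def)
qed

text \<open>
  Unfolding: the translates of a fundamental domain cover a set, so its area is at most the integral
  over the domain of the number of points of the orbit that lie in the set.
\<close>

lemma (in fuchsian_group) area_le_multiplicity:
  assumes F: "fundamental_domain \<Gamma> F" "emeasure hyperbolic_area F < \<infinity>"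
    and B: "B \<in> sets borel" "B \<subseteq> upper_half_plane"
    and mult: "\<And>w. Im w > 0 \<Longrightarrow> finite {g \<in> \<Gamma>. psl_act g w \<in> B} \<and> card {g \<in> \<Gamma>. psl_act g w \<in> B} \<le> N"
  shows "emeasure hyperbolic_area B \<le> of_nat N * emeasure hyperbolic_area F"
proof -
  let ?\<mu> = hyperbolic_area
  have sets: "sets ?\<mu> = sets borel" by (simp add: hyperbolic_area_def)
  have FB: "F \<in> sets borel" "F \<subseteq> upper_half_plane" and cover: "(\<Union>g\<in>\<Gamma>. psl_act g ` F) = upper_half_plane"
    using F(1) by (auto simp: fundamental_domain_def)
  define P where "P = (\<lambda>g. F \<inter> (upper_half_plane \<inter> psl_act g -` B))"
  have P: "P g \<in> sets borel" "P g \<subseteq> upper_half_plane" if "g \<in> \<Gamma>" for g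
    unfolding P_def psl_act_def
    using borel_vimage_moebius[OF rep_G(3)[OF that] B(1)] FB by auto
  have image: "psl_act g ` P g = B \<inter> psl_act g ` F" if "g \<in> \<Gamma>" for g
    using FB by (auto simp: P_def)
  have image_borel: "psl_act g ` P g \<in> sets borel" if "g \<in> \<Gamma>" for g
    unfolding psl_act_def moebius_image_eq_vimage[OF rep_G(3)[OF that] P(2)[OF that]]
    using rep_G(3)[OF that] P(1)[OF that] by (intro borel_vimage_moebius) auto
  have "emeasure ?\<mu> B = (\<integral>\<^sup>+z. indicator B z \<partial>?\<mu>)"
    using B sets by simp
  also have "\<dots> \<le> (\<integral>\<^sup>+z. (\<integral>\<^sup>+g. indicator (psl_act g ` P g) z \<partial>count_space \<Gamma>) \<partial>?\<mu>)"
  proof (intro nn_integral_mono)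
    fix z
    show "indicator B z \<le> (\<integral>\<^sup>+g. indicator (psl_act g ` P g) z \<partial>count_space \<Gamma> :: ennreal)"
    proof (cases "z \<in> B")
      case True
      then obtain g where g: "g \<in> \<Gamma>" "z \<in> psl_act g ` F" using B(2) cover by blast
      then have "(1::ennreal) = indicator (psl_act g ` P g) z" using True image by simp
      also have "\<dots> \<le> (\<integral>\<^sup>+g. indicator (psl_act g ` P g) z \<partial>count_space \<Gamma>)"
        using g(1) by (rule nn_integral_ge_point)
      finally show ?thesis using True by simp
    qed simp
  qed
  also have "\<dots> = (\<integral>\<^sup>+g. (\<integral>\<^sup>+z. indicator (psl_act g ` P g) z \<partial>?\<mu>) \<partial>count_space \<Gamma>)"
    using countable_\<Gamma> image_borel sets by (intro nn_integral_count_space_nn_integral) auto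
  also have "\<dots> = (\<integral>\<^sup>+g. (\<integral>\<^sup>+w. indicator (P g) w \<partial>?\<mu>) \<partial>count_space \<Gamma>)"
  proof (rule nn_integral_cong)
    fix g assume "g \<in> space (count_space \<Gamma>)"
    then have g: "g \<in> \<Gamma>" by simp
    have "emeasure ?\<mu> (P g) \<le> emeasure ?\<mu> F"
      using FB sets by (intro emeasure_mono) (auto simp: P_def)
    then have "emeasure ?\<mu> (P g) < \<infinity>" using F(2) by (rule le_less_trans)
    from emeasure_hyperbolic_moebius_image[OF rep_G(3)[OF g] P[OF g] this]
    show "(\<integral>\<^sup>+z. indicator (psl_act g ` P g) z \<partial>?\<mu>) = (\<integral>\<^sup>+w. indicator (P g) w \<partial>?\<mu>)"
      using image_borel[OF g] P[OF g] sets by (simp add: psl_act_def)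
  qed
  also have "\<dots> = (\<integral>\<^sup>+w. (\<integral>\<^sup>+g. indicator (P g) w \<partial>count_space \<Gamma>) \<partial>?\<mu>)"
    using countable_\<Gamma> P sets by (intro nn_integral_count_space_nn_integral[symmetric]) auto
  also have "\<dots> \<le> (\<integral>\<^sup>+w. of_nat N * indicator F w \<partial>?\<mu>)"
  proof (intro nn_integral_mono)
    fix w
    show "(\<integral>\<^sup>+g. indicator (P g) w \<partial>count_space \<Gamma>) \<le> of_nat N * (indicator F w :: ennreal)"
    proof (cases "w \<in> F")
      case True
      let ?M = "{g \<in> \<Gamma>. psl_act g w \<in> B}"
      have w: "Im w > 0" using True FB by auto
      have "(\<integral>\<^sup>+g. indicator (P g) w \<partial>count_space \<Gamma>) = (\<integral>\<^sup>+g. indicator ?M g \<partial>count_space \<Gamma>)"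
        using True w by (intro nn_integral_cong) (auto simp: P_def indicator_def)
      also have "\<dots> = of_nat (card ?M)"
        using mult[OF w] by (subst nn_integral_indicator) auto
      also have "\<dots> \<le> of_nat N" using mult[OF w] by simp
      finally show ?thesis using True by simp
    qed (simp add: P_def)
  qed
  also have "\<dots> = of_nat N * emeasure ?\<mu> F"
    using FB sets by (simp add: nn_integral_cmult)
  finally show ?thesis .
qed

section \<open>Short elements along a geodesic running into the boundary\<close>

lemma emeasure_hyperbolic_box_ge:
  assumes "y > 0"
  shows "emeasure hyperbolic_area (cbox (Complex (x - y) y) (Complex (x + y) (2 * y))) \<ge> ennreal (1 / 2)"
proof -
  let ?B = "cbox (Complex (x - y) y) (Complex (x + y) (2 * y))"
  have B: "?B \<in> sets borel" "?B \<subseteq> upper_half_plane"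
    using assms by (auto simp: in_cbox_complex_iff)
  have H: "upper_half_plane \<in> sets borel"
    unfolding upper_half_plane_def by measurable
  have "emeasure lborel ?B = ennreal (2 * y * y)"
    using assms by (subst emeasure_lborel_cbox) (auto simp: Basis_complex_def)
  then have "ennreal (1 / 2) = ennreal (1 / (4 * y\<^sup>2)) * emeasure lborel ?B"
    using assms by (simp add: power2_eq_square flip: ennreal_mult)
  also have "\<dots> = (\<integral>\<^sup>+z. ennreal (1 / (4 * y\<^sup>2)) * indicator ?B z \<partial>lborel)"
    using B by (simp add: nn_integral_cmult)
  also have "\<dots> \<le> (\<integral>\<^sup>+z. ennreal (1 / (Im z)\<^sup>2) * indicator upper_half_plane z * indicator ?B z \<partial>lborel)"
  proof (intro nn_integral_mono)
    fix z
    show "ennreal (1 / (4 * y\<^sup>2)) * indicator ?B z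
        \<le> ennreal (1 / (Im z)\<^sup>2) * indicator upper_half_plane z * indicator ?B z"
    proof (cases "z \<in> ?B")
      case True
      then have z: "y \<le> Im z" "Im z \<le> 2 * y" by (auto simp: in_cbox_complex_iff)
      then have "(Im z)\<^sup>2 \<le> (2 * y)\<^sup>2" using assms by (intro power_mono) auto
      then have "1 / (4 * y\<^sup>2) \<le> 1 / (Im z)\<^sup>2"
        using z assms by (intro divide_left_mono) (auto simp: power_mult_distrib)
      then show ?thesis using True B(2) by (auto intro: ennreal_leI)
    qed simp
  qed
  also have "\<dots> = emeasure hyperbolic_area ?B"
    unfolding hyperbolic_area_def using B H by (subst emeasure_density) auto
  finally show ?thesis .
qed

context fuchsian_group
begin

lemma frame_separated:
  assumes "A \<in> G" "B \<in> G" "A \<noteq> B" "Im z > 0"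
    and bad: "\<And>C. C \<in> G \<Longrightarrow> C \<noteq> mat 1 \<Longrightarrow> \<epsilon> \<le> norm (frame z C - mat 1)"
  shows "\<epsilon> \<le> norm (frame z A) * dist (frame z A) (frame z B)"
proof -
  have detA: "det A = 1" using assms(1) by (rule det_G)
  have "adj2 A ** B \<noteq> mat 1"
  proof
    assume "adj2 A ** B = mat 1"
    then have "A ** (adj2 A ** B) = A" by simp
    then show False using assms(3) adj2_mult(1)[OF detA] by (simp add: matrix_mul_assoc)
  qed
  moreover have "adj2 A ** B \<in> G" using assms(1,2) by (intro G_mult G_adj2)
  ultimately have "\<epsilon> \<le> norm (frame z (adj2 A ** B) - mat 1)" using bad by blast
  also have "frame z (adj2 A ** B) - mat 1 = adj2 (frame z A) ** (frame z B - frame z A)"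
    using adj2_mult(2)[of "frame z A"] detA det_frame[OF assms(4)]
    by (simp add: frame_mult[OF assms(4)] frame_adj2 matmul_diff)
  also have "norm \<dots> \<le> norm (adj2 (frame z A)) * norm (frame z B - frame z A)"
    by (rule norm_matmul_le)
  finally show ?thesis by (simp add: dist_norm norm_minus_commute)
qed

text \<open>
  The hypothesis on \<open>x\<close> says that no element of the group raises a point of the vertical line over
  \<open>x\<close> by more than a factor \<open>2\<close>. If there were no short elements at arbitrarily low points of the line,
  then boxes of fixed hyperbolic area around infinitely many such points would map to the quotient
  with bounded multiplicity: by packing, each box overlaps boundedly many of its own translates, and
  translates of different boxes do not meet because of their heights. This contradicts the finiteness
  of the area.
\<close>

lemma ex_short_elements:
  assumes F: "fundamental_domain \<Gamma> F" "emeasure hyperbolic_area F < \<infinity>"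
    and x: "\<And>A. A \<in> G \<Longrightarrow> (A$2$1 * x + A$2$2)\<^sup>2 \<ge> 1 / 2"
    and \<epsilon>: "\<epsilon> > 0"
  shows "\<exists>y0>0. \<forall>y. 0 < y \<and> y \<le> y0 \<longrightarrow> (\<exists>A\<in>G. A \<noteq> mat 1 \<and> norm (frame (Complex x y) A - mat 1) < \<epsilon>)"
proof (rule ccontr)
  define bad where "bad = (\<lambda>y. \<forall>A\<in>G. A \<noteq> mat 1 \<longrightarrow> \<epsilon> \<le> norm (frame (Complex x y) A - mat 1))"
  assume "\<not> ?thesis"
  then have "\<forall>y0. \<exists>y. y0 > 0 \<longrightarrow> 0 < y \<and> y \<le> y0 \<and> bad y"
    unfolding bad_def by (metis not_le)
  then obtain b where b: "\<And>y0. y0 > 0 \<Longrightarrow> 0 < b y0 \<and> b y0 \<le> y0 \<and> bad (b y0)" by metis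
  \<comment> \<open>The ratio 400 of consecutive heights makes \<open>ppi\<close> at least 50 between the centres of
    translates of different boxes, while it is at most 25 if these meet.\<close>
  define y where "y = (\<lambda>n. ((\<lambda>t. b (t / 400)) ^^ n) (b 1))"
  have y: "y n > 0 \<and> bad (y n)" for n
  proof (induction n)
    case 0 then show ?case using b[of 1] by (simp add: y_def)
  next
    case (Suc n) then show ?case using b[of "y n / 400"] by (simp add: y_def)
  qed
  have step: "y (Suc n) \<le> y n / 400" for n
    using b[of "y n / 400"] y[of n] by (simp add: y_def)
  have gap: "y n \<le> y m / 400" if "m < n" for m n
    using that
  proof (induction n)
    case (Suc n)
    then show ?case
      using step[of n] y[of n] y[of m] by (cases "m = n") auto
  qed simp
  define z where "z = (\<lambda>n. Complex x (y n))"
  define B where "B = (\<lambda>n. cbox (Complex (x - y n) (y n)) (Complex (x + y n) (2 * y n)))"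
  have z: "Im (z n) > 0" "Re (z n) = x" "Im (z n) = y n" for n using y by (auto simp: z_def)
  have BH: "B n \<subseteq> upper_half_plane" for n
    using y[of n] by (auto simp: B_def in_cbox_complex_iff)
  have near: "ppi v (z n) \<le> 5 / 2" if "v \<in> B n" for v n
  proof -
    have v: "\<bar>Re v - x\<bar> \<le> y n" "y n \<le> Im v" "Im v \<le> 2 * y n"
      using that by (auto simp: B_def in_cbox_complex_iff)
    have "(Re v - x)\<^sup>2 \<le> (y n)\<^sup>2" using v(1) by (metis abs_ge_zero power2_abs power_mono)
    moreover have "(Im v + y n)\<^sup>2 \<le> (3 * y n)\<^sup>2" using v y[of n] by (intro power_mono) auto
    moreover have "y n * y n \<le> Im v * y n" using v y[of n] by (intro mult_right_mono) auto
    ultimately have "(Re v - x)\<^sup>2 + (Im v + y n)\<^sup>2 \<le> 10 * (Im v * y n)"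
      by (simp add: power2_eq_square)
    then show ?thesis using v y[of n] by (simp add: ppi_alt z divide_le_eq)
  qed
  have Im_le: "Im (moebius A (z n)) \<le> 2 * y n" if "A \<in> G" for A n
  proof -
    have det: "det A = 1" using det_G[OF that] .
    have ge: "(cmod (automorphy A (z n)))\<^sup>2 \<ge> 1 / 2"
      using x[OF that] zero_le_power2[of "A$2$1 * y n"] unfolding cmod_automorphy_sq z by linarith
    have "Im (moebius A (z n)) = y n / (cmod (automorphy A (z n)))\<^sup>2"
      using Im_moebius[OF det z(1)] z(3) by simp
    also have "\<dots> \<le> y n / (1 / 2)"
      using ge y[of n] by (intro divide_left_mono mult_pos_pos) auto
    finally show ?thesis by simp
  qed
  have far: "ppi (moebius A (z m)) (z n) \<ge> 50" if "A \<in> G" "m \<noteq> n" for A m n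
  proof -
    have *: "ppi (moebius A (z m)) (z n) \<ge> 50" if "A \<in> G" "n < m" for A m n
    proof -
      have det: "det A = 1" using det_G[OF that(1)] .
      note pos = Im_moebius_pos[OF det z(1)[of m]]
      have "50 * (4 * Im (moebius A (z m))) \<le> y n"
        using Im_le[OF that(1), of m] gap[OF that(2)] by simp
      then have "50 \<le> Im (z n) / (4 * Im (moebius A (z m)))" using pos by (simp add: z field_simps)
      also have "\<dots> \<le> ppi (z n) (moebius A (z m))" using pos z by (intro ppi_ge_Im_quotient) auto
      finally show ?thesis by (simp add: ppi_commute)
    qed
    show ?thesis
    proof (cases "n < m")
      case True then show ?thesis using * that by blast
    next
      case False
      have det: "det A = 1" using det_G[OF that(1)] .
      have "ppi (moebius A (z m)) (z n) = ppi (moebius (adj2 A) (moebius A (z m))) (moebius (adj2 A) (z n))"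
        using det z Im_moebius_pos by (intro ppi_moebius[symmetric]) auto
      also have "\<dots> = ppi (moebius (adj2 A) (z n)) (z m)"
        using moebius_adj2(1)[OF det z(1)] by (simp add: ppi_commute)
      also have "\<dots> \<ge> 50" using *[OF G_adj2[OF that(1)], of m n] False that(2) by simp
      finally show ?thesis .
    qed
  qed
  obtain N where N: "\<And>S :: (real^2^2) set. (\<And>A. A \<in> S \<Longrightarrow> norm A \<le> 10) \<Longrightarrow>
    (\<And>A B. A \<in> S \<Longrightarrow> B \<in> S \<Longrightarrow> A \<noteq> B \<Longrightarrow> dist A B \<ge> \<epsilon> / 10) \<Longrightarrow> finite S \<and> card S \<le> N"
    using separated_subset_card_le[of "\<epsilon> / 10" 10] \<epsilon> by (metis divide_pos_pos zero_less_numeral)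
  have mult: "finite {g \<in> \<Gamma>. psl_act g w \<in> (\<Union>n<M. B n)} \<and> card {g \<in> \<Gamma>. psl_act g w \<in> (\<Union>n<M. B n)} \<le> N"
    if w: "Im w > 0" for w M
  proof (cases "{g \<in> \<Gamma>. psl_act g w \<in> (\<Union>n<M. B n)} = {}")
    case True
    then show ?thesis by (metis card.empty finite.emptyI le0)
  next
    case False
    let ?S = "{g \<in> \<Gamma>. psl_act g w \<in> (\<Union>n<M. B n)}"
    obtain g0 n0 where g0: "g0 \<in> \<Gamma>" "psl_act g0 w \<in> B n0" using False by blast
    define C where "C = rep g0"
    have C: "C \<in> G" "det C = 1" using rep_G[OF g0(1)] by (auto simp: C_def)
    define \<phi> where "\<phi> = (\<lambda>g. frame (z n0) (rep g ** adj2 C))"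
    have A: "rep g ** adj2 C \<in> G" if "g \<in> \<Gamma>" for g
      using rep_G(1)[OF that] C by (intro G_mult G_adj2)
    have norm_le: "norm (\<phi> g) \<le> 10" if g: "g \<in> ?S" for g
    proof -
      let ?A = "rep g ** adj2 C"
      obtain n where n: "psl_act g w \<in> B n" using g by blast
      have det: "det (rep g) = 1" "det ?A = 1" using rep_G(3) g A det_G by blast+
      have Aw: "moebius ?A (psl_act g0 w) = psl_act g w"
        using moebius_mult[of "rep g" "adj2 C" "moebius C w"] moebius_adj2(1)[OF C(2) w] det C w Im_moebius_pos
        by (simp add: psl_act_def C_def)
      have Iw: "Im (psl_act g0 w) > 0" "Im (psl_act g w) > 0" using Im_psl_act_pos g g0 w by blast+
      have IA: "Im (moebius ?A (z n0)) > 0" using Im_moebius_pos[OF det(2) z(1)] .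
      have "ppi (moebius ?A (z n0)) (z n) \<le> 4 * ppi (moebius ?A (z n0)) (psl_act g w) * ppi (psl_act g w) (z n)"
        using IA Iw z by (intro ppi_triangle) auto
      also have "ppi (moebius ?A (z n0)) (psl_act g w) = ppi (z n0) (psl_act g0 w)"
        unfolding Aw[symmetric] using det(2) z Iw by (intro ppi_moebius) auto
      also have "4 * ppi (z n0) (psl_act g0 w) * ppi (psl_act g w) (z n) \<le> 4 * (5 / 2) * (5 / 2)"
        using near[OF n] near[OF g0(2)] ppi_ge_1[OF Iw(2) z(1)] ppi_ge_1[OF z(1) Iw(1)]
        by (intro mult_mono) (auto simp: ppi_commute intro: order_trans[OF zero_le_one])
      finally have le: "ppi (moebius ?A (z n0)) (z n) \<le> 25" by simp
      then have "n = n0" using far[OF A, of g n0 n] g by force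
      with le have "(norm (\<phi> g))\<^sup>2 \<le> 10\<^sup>2"
        unfolding \<phi>_def norm_frame_sq[OF det(2) z(1)] by simp
      then show ?thesis by (rule power2_le_imp_le) simp
    qed
    have sep: "dist (\<phi> g) (\<phi> h) \<ge> \<epsilon> / 10" if "g \<in> ?S" "h \<in> ?S" "g \<noteq> h" for g h
    proof -
      have "rep g ** adj2 C \<noteq> rep h ** adj2 C"
      proof
        assume "rep g ** adj2 C = rep h ** adj2 C"
        then have "rep g ** adj2 C ** C = rep h ** adj2 C ** C" by simp
        then have "rep g = rep h" using adj2_mult(2)[OF C(2)] by (simp flip: matrix_mul_assoc)
        then show False using rep_inj that by blast
      qed
      then have "\<epsilon> \<le> norm (\<phi> g) * dist (\<phi> g) (\<phi> h)"
        unfolding \<phi>_def using A that y[of n0] z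
        by (intro frame_separated) (auto simp: bad_def z_def)
      also have "\<dots> \<le> 10 * dist (\<phi> g) (\<phi> h)"
        using norm_le[OF that(1)] by (intro mult_right_mono) auto
      finally show ?thesis by simp
    qed
    have inj: "inj_on \<phi> ?S"
      by (rule inj_onI) (use sep \<epsilon> in fastforce)
    have "finite (\<phi> ` ?S) \<and> card (\<phi> ` ?S) \<le> N"
      by (rule N) (use norm_le sep in blast)+
    then show ?thesis using inj by (simp add: finite_image_iff card_image)
  qed
  have disj: "disjoint_family B"
    unfolding disjoint_family_on_def
  proof (intro ballI impI)
    fix m n :: nat assume "m \<noteq> n"
    then show "B m \<inter> B n = {}"
      using gap[of m n] gap[of n m] y[of m] y[of n]
      by (cases "m < n") (auto simp: B_def in_cbox_complex_iff)
  qed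
  have area: "ennreal (1 / 2) * of_nat M \<le> of_nat N * emeasure hyperbolic_area F" for M
  proof -
    have "ennreal (1 / 2) * of_nat M = (\<Sum>n<M. ennreal (1 / 2))" by (simp add: mult.commute)
    also have "\<dots> \<le> (\<Sum>n<M. emeasure hyperbolic_area (B n))"
      unfolding B_def using y by (intro sum_mono emeasure_hyperbolic_box_ge) auto
    also have "\<dots> = emeasure hyperbolic_area (\<Union>n<M. B n)"
      using disj by (intro sum_emeasure) (auto simp: B_def hyperbolic_area_def disjoint_family_on_def)
    also have "\<dots> \<le> of_nat N * emeasure hyperbolic_area F"
      by (rule area_le_multiplicity[OF F _ _ mult]) (use BH in \<open>auto simp: B_def\<close>)
    finally show ?thesis .
  qed
  obtain a where a: "emeasure hyperbolic_area F = ennreal a" "a \<ge> 0"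
    using F(2) by (cases "emeasure hyperbolic_area F") auto
  obtain M where M: "2 * (real N * a) < real M" using reals_Archimedean2 by blast
  have "ennreal (1 / 2 * real M) = ennreal (1 / 2) * of_nat M"
    by (subst ennreal_mult) (auto simp: ennreal_of_nat_eq_real_of_nat)
  moreover have "ennreal (real N * a) = of_nat N * ennreal a"
    using a(2) by (subst ennreal_mult) (auto simp: ennreal_of_nat_eq_real_of_nat)
  ultimately have "ennreal (1 / 2 * real M) \<le> ennreal (real N * a)"
    using area[of M] unfolding a(1) by metis
  then have "1 / 2 * real M \<le> real N * a" using a by (subst (asm) ennreal_le_iff) auto
  with M show False by linarith
qed

end

text \<open>
  The vector \<open>(a - d, b, c)\<close> represents the traceless part of a matrix, and its class up to scaling
  determines the fixed points on the boundary. Proportionality, unlike commuting, is transitive.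
\<close>

lemma commuting_proportional:
  fixes A B :: "real^2^2"
  assumes "A ** B = B ** A" "A$1$1 - A$2$2 \<noteq> 0 \<or> A$1$2 \<noteq> 0 \<or> A$2$1 \<noteq> 0"
  obtains t where "B$1$1 - B$2$2 = t * (A$1$1 - A$2$2)" "B$1$2 = t * A$1$2" "B$2$1 = t * A$2$1"
proof -
  have "(A ** B) $ 1 $ 1 = (B ** A) $ 1 $ 1" "(A ** B) $ 1 $ 2 = (B ** A) $ 1 $ 2"
    "(A ** B) $ 2 $ 1 = (B ** A) $ 2 $ 1"
    using assms(1) by simp_all
  then have e: "A$1$2 * B$2$1 = B$1$2 * A$2$1"
    "A$1$2 * (B$1$1 - B$2$2) = B$1$2 * (A$1$1 - A$2$2)"
    "A$2$1 * (B$1$1 - B$2$2) = B$2$1 * (A$1$1 - A$2$2)"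
    by (simp_all add: algebra_simps)
  consider "A$1$1 - A$2$2 \<noteq> 0" | "A$1$2 \<noteq> 0" | "A$2$1 \<noteq> 0" using assms(2) by blast
  then show ?thesis
  proof cases
    case 1
    show ?thesis
      by (rule that[of "(B$1$1 - B$2$2) / (A$1$1 - A$2$2)"])
         (use 1 e in \<open>simp_all add: nonzero_eq_divide_eq mult.commute\<close>)
  next
    case 2
    show ?thesis
      by (rule that[of "B$1$2 / A$1$2"])
         (use 2 e in \<open>simp_all add: nonzero_eq_divide_eq mult.commute\<close>)
  next
    case 3
    show ?thesis
      by (rule that[of "B$2$1 / A$2$1"])
         (use 3 e in \<open>simp_all add: nonzero_eq_divide_eq mult.commute\<close>)
  qed
qed

text \<open>
  The commutator is \<open>1 + (E F - F E) M\<inverse> N\<inverse>\<close> with \<open>E = M - 1\<close> and \<open>F = N - 1\<close>, so its distance from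
  the identity is quadratic in the distances of \<open>M\<close> and \<open>N\<close>.
\<close>

lemma norm_commutator_le:
  fixes M N :: "real^2^2"
  assumes "det M = 1" "det N = 1" "norm (M - mat 1) \<le> 1 / 16" "norm (N - mat 1) \<le> 1 / 16"
  shows "norm (M ** N ** adj2 M ** adj2 N - mat 1) \<le> norm (N - mat 1) / 2"
proof -
  have MN: "norm M \<le> 2" "norm N \<le> 2"
    using assms(3,4) norm_triangle_sub[of M "mat 1"] norm_triangle_sub[of N "mat 1"] norm_mat_1_le
    by linarith+
  let ?E = "M - mat 1" and ?F = "N - mat 1"
  let ?D = "?E ** ?F - ?F ** ?E"
  have D: "?D = M ** N - N ** M" by (simp add: matmul_diff)
  have inv: "N ** M ** adj2 M ** adj2 N = mat 1"
    by (metis adj2_mult(1) assms(1,2) matrix_mul_assoc matrix_mul_rid)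
  have "M ** N ** adj2 M ** adj2 N - mat 1 = ?D ** adj2 M ** adj2 N"
    unfolding D by (simp add: matmul_diff inv)
  also have "norm \<dots> \<le> norm ?D * norm (adj2 M) * norm (adj2 N)"
    by (meson norm_matmul_le order_trans mult_right_mono norm_ge_zero)
  also have "\<dots> \<le> norm ?D * 2 * 2" using MN by (intro mult_mono) auto
  also have "norm ?D \<le> norm ?E * norm ?F + norm ?F * norm ?E"
    by (rule order_trans[OF norm_triangle_ineq4]) (intro add_mono norm_matmul_le)
  also have "(norm ?E * norm ?F + norm ?F * norm ?E) * 2 * 2 = 8 * norm ?E * norm ?F" by simp
  also have "\<dots> \<le> 8 * (1 / 16) * norm ?F" using assms(3) by (intro mult_right_mono) auto
  finally show ?thesis by simp
qed

lemma frame_eq_mat_1_iff: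
  assumes "Im z > 0"
  shows "frame z A = mat 1 \<longleftrightarrow> A = mat 1"
proof
  assume "frame z A = mat 1"
  then have "frame z (A - mat 1) = 0" by (simp add: frame_diff)
  moreover obtain K where "\<And>A. norm A \<le> K * norm (frame z A)"
    using norm_le_norm_frame[OF assms] by blast
  ultimately have "norm (A - mat 1) \<le> 0" by (metis mult_zero_right norm_zero)
  then show "A = mat 1" by simp
qed simp

lemma norm_frame_half_height:
  assumes "y > 0"
  shows "norm (frame (Complex x y) A - mat 1) \<le> 2 * norm (frame (Complex x (y / 2)) A - mat 1)"
proof -
  let ?M = "frame (Complex x y) A - mat 1" and ?N = "frame (Complex x (y / 2)) A - mat 1"
  have "?M$1$1 = ?N$1$1" "?M$2$2 = ?N$2$2" "?M$1$2 = ?N$1$2 / 2" "?M$2$1 = 2 * ?N$2$1"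
    using assms by (simp_all add: field_simps)
  then have "(norm ?M)\<^sup>2 = (?N$1$1)\<^sup>2 + (?N$1$2)\<^sup>2 / 4 + 4 * (?N$2$1)\<^sup>2 + (?N$2$2)\<^sup>2"
    unfolding norm_mat_sq by (simp only: power_divide power_mult_distrib) simp
  also have "\<dots> \<le> 4 * (norm ?N)\<^sup>2"
  proof -
    have "p + q / 4 + 4 * s + t \<le> 4 * (p + q + s + t)" if "0 \<le> p" "0 \<le> q" "0 \<le> t" for p q s t :: real
      using that by argo
    then show ?thesis unfolding norm_mat_sq by (meson zero_le_power2)
  qed
  finally have "(norm ?M)\<^sup>2 \<le> (2 * norm ?N)\<^sup>2" by (simp add: power_mult_distrib)
  then show ?thesis by (rule power2_le_imp_le) simp
qed

context fuchsian_group
begin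

text \<open>
  The element is the shortest nontrivial one at \<open>z\<close>, which exists by discreteness; a nontrivial
  commutator with it would be shorter still.
\<close>

lemma ex_minimal_short_element:
  assumes z: "Im z > 0" and ex: "\<exists>A\<in>G. A \<noteq> mat 1 \<and> norm (frame z A - mat 1) < 1 / 32"
  obtains B where "B \<in> G" "B \<noteq> mat 1" "norm (frame z B - mat 1) < 1 / 32"
    "\<And>A. A \<in> G \<Longrightarrow> norm (frame z A - mat 1) \<le> 1 / 16 \<Longrightarrow> A ** B = B ** A"
proof -
  let ?l = "\<lambda>A. norm (frame z A - mat 1)"
  define S where "S = {A \<in> G. A \<noteq> mat 1 \<and> ?l A < 1 / 32}"
  have "norm (frame z A) \<le> 2" if "A \<in> S" for A
    using that norm_triangle_sub[of "frame z A" "mat 1"] norm_mat_1_le by (auto simp: S_def)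
  then have "S \<subseteq> {A \<in> G. norm (frame z A) \<le> 2}" by (auto simp: S_def)
  then have "finite S" using finite_norm_frame_le[OF z] finite_subset by blast
  moreover have "S \<noteq> {}" using ex by (auto simp: S_def)
  ultimately obtain B where B: "B \<in> S" "\<And>A. A \<in> S \<Longrightarrow> ?l B \<le> ?l A"
    using arg_min_if_finite[of S ?l] by (metis not_le)
  have BG: "B \<in> G" "B \<noteq> mat 1" "?l B < 1 / 32" using B(1) by (auto simp: S_def)
  have "A ** B = B ** A" if A: "A \<in> G" "?l A \<le> 1 / 16" for A
  proof -
    define C where "C = A ** B ** adj2 A ** adj2 B"
    have det: "det A = 1" "det B = 1" using A(1) BG(1) det_G by blast+
    have C: "C \<in> G" unfolding C_def using A(1) BG(1) by (intro G_mult G_adj2)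
    have "frame z C = frame z A ** frame z B ** adj2 (frame z A) ** adj2 (frame z B)"
      by (simp add: C_def frame_mult[OF z] frame_adj2)
    then have "?l C \<le> ?l B / 2"
      using norm_commutator_le[of "frame z A" "frame z B"] det A(2) BG(3) det_frame[OF z] by simp
    moreover have "?l B > 0" using BG(2) frame_eq_mat_1_iff[OF z] by simp
    ultimately have "?l C < ?l B" by linarith
    then have "C = mat 1" using B(2)[of C] C BG(3) by (fastforce simp: S_def)
    then have "C ** B ** A = B ** A" by simp
    moreover have "C ** B ** A = A ** B"
      unfolding C_def by (metis adj2_mult(2) det matrix_mul_assoc matrix_mul_rid)
    ultimately show ?thesis by simp
  qed
  then show ?thesis using that BG by blast
qed

text \<open>
  The shortest elements at the heights \<open>y0 / 2 ^ n\<close> commute successively, since halving the height at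
  most doubles the length; so they all have the same fixed points. If \<open>x\<close> were not among these, the
  elements would have to converge to the identity, against discreteness. A hyperbolic element
  fixing \<open>x\<close> is excluded because its powers violate the bound \<open>r\<close>.
\<close>

lemma ex_parabolic_of_short_elements:
  assumes r: "r > 0" "\<And>A. A \<in> G \<Longrightarrow> \<bar>A$2$1 * x + A$2$2\<bar> \<ge> r"
    and y0: "y0 > 0" and short: "\<And>y. 0 < y \<Longrightarrow> y \<le> y0 \<Longrightarrow>
      \<exists>A\<in>G. A \<noteq> mat 1 \<and> norm (frame (Complex x y) A - mat 1) < 1 / 32"
  obtains B where "B \<in> G" "B \<noteq> mat 1" "B$1$1 - B$2$1 * x = 1" "B$2$2 + B$2$1 * x = 1"
    "B$1$2 + (B$1$1 - B$2$2) * x - B$2$1 * x\<^sup>2 = 0"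
proof -
  define z where "z = (\<lambda>n::nat. Complex x (y0 / 2 ^ n))"
  have z: "Im (z n) > 0" "Re (z n) = x" "Im (z n) = y0 / 2 ^ n" for n using y0 by (auto simp: z_def)
  have "\<exists>B. B \<in> G \<and> B \<noteq> mat 1 \<and> norm (frame (z n) B - mat 1) < 1 / 32 \<and>
      (\<forall>A\<in>G. norm (frame (z n) A - mat 1) \<le> 1 / 16 \<longrightarrow> A ** B = B ** A)" for n
  proof -
    have "y0 / 2 ^ n \<le> y0" using y0 by (simp add: divide_le_eq)
    then have "\<exists>A\<in>G. A \<noteq> mat 1 \<and> norm (frame (z n) A - mat 1) < 1 / 32"
      unfolding z_def using y0 by (intro short) auto
    from ex_minimal_short_element[OF z(1) this] show ?thesis by metis
  qed
  then obtain B where BG: "\<And>n. B n \<in> G" and B1: "\<And>n. B n \<noteq> mat 1"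
    and Bs: "\<And>n. norm (frame (z n) (B n) - mat 1) < 1 / 32"
    and comm: "\<And>n A. A \<in> G \<Longrightarrow> norm (frame (z n) A - mat 1) \<le> 1 / 16 \<Longrightarrow> A ** B n = B n ** A"
    by metis
  have det: "det (B n) = 1" for n using det_G[OF BG] .
  have entry: "\<bar>(frame (z n) (B n) - mat 1) $ i $ j\<bar> < 1 / 32" for n i j
    using entry_le_norm[of "frame (z n) (B n) - mat 1" i j] Bs[of n] by linarith
  have a': "\<bar>B n $1$1 - B n $2$1 * x - 1\<bar> < 1 / 32" and d': "\<bar>B n $2$2 + B n $2$1 * x - 1\<bar> < 1 / 32"
    for n using entry[of n 1 1] entry[of n 2 2] by (simp_all add: z)
  have nonscalar: "B n $1$1 - B n $2$2 \<noteq> 0 \<or> B n $1$2 \<noteq> 0 \<or> B n $2$1 \<noteq> 0" for n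
  proof (rule ccontr)
    assume "\<not> ?thesis"
    then have s: "B n $1$1 = B n $2$2" "B n $1$2 = 0" "B n $2$1 = 0" by auto
    then have "B n $1$1 * B n $1$1 = 1" using det[of n] by (simp add: det_2)
    then have "B n $1$1 = 1 \<or> B n $1$1 = - 1" by (simp only: square_eq_1_iff)
    moreover have "\<bar>B n $1$1 - 1\<bar> < 1 / 32" using a'[of n] s(3) by simp
    ultimately have "B n $1$1 = 1" by auto
    then have "B n = mat 1" using s by (intro mat2_eqI) auto
    then show False using B1 by blast
  qed
  have "\<exists>t. B n $1$1 - B n $2$2 = t * (B 0 $1$1 - B 0 $2$2) \<and> B n $1$2 = t * B 0 $1$2 \<and> B n $2$1 = t * B 0 $2$1" for n
  proof (induction n)
    case 0
    show ?case by (rule exI[of _ 1]) simp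
  next
    case (Suc n)
    then obtain t where t: "B n $1$1 - B n $2$2 = t * (B 0 $1$1 - B 0 $2$2)" "B n $1$2 = t * B 0 $1$2"
      "B n $2$1 = t * B 0 $2$1" by blast
    have "norm (frame (z n) (B (Suc n)) - mat 1) \<le> 2 * norm (frame (z (Suc n)) (B (Suc n)) - mat 1)"
      using norm_frame_half_height[of "y0 / 2 ^ n" x "B (Suc n)"] y0 by (simp add: z_def mult.commute)
    then have "B n ** B (Suc n) = B (Suc n) ** B n"
      using comm[OF BG, of n "Suc n"] Bs[of "Suc n"] by simp
    from commuting_proportional[OF this nonscalar] obtain s where
      "B (Suc n) $1$1 - B (Suc n) $2$2 = s * (B n $1$1 - B n $2$2)"
      "B (Suc n) $1$2 = s * B n $1$2" "B (Suc n) $2$1 = s * B n $2$1" .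
    with t show ?case by (intro exI[of _ "s * t"]) simp
  qed
  then obtain t where t: "\<And>n. B n $1$1 - B n $2$2 = t n * (B 0 $1$1 - B 0 $2$2)"
      "\<And>n. B n $1$2 = t n * B 0 $1$2" "\<And>n. B n $2$1 = t n * B 0 $2$1" by metis
  define b where "b = (\<lambda>n. B n $1$2 + (B n $1$1 - B n $2$2) * x - B n $2$1 * x\<^sup>2)"
  have bt: "b n = t n * b 0" for n unfolding b_def t[of n] by (simp add: algebra_simps)
  have b_le: "\<bar>b n\<bar> \<le> y0 * (1 / 2) ^ n" for n
  proof -
    have "\<bar>b n / (y0 / 2 ^ n)\<bar> < 1 / 32" using entry[of n 1 2] by (simp add: z b_def)
    then have "\<bar>b n\<bar> < 1 / 32 * (y0 / 2 ^ n)" using y0 by (simp add: abs_divide field_simps)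
    also have "\<dots> \<le> 1 * (y0 / 2 ^ n)" using y0 by (intro mult_right_mono) auto
    also have "\<dots> = y0 * (1 / 2) ^ n" by (simp add: power_divide)
    finally show ?thesis by simp
  qed
  have "b 0 = 0"
  proof (rule ccontr)
    assume b0: "b 0 \<noteq> 0"
    have "(\<lambda>n. y0 * (1 / 2) ^ n) \<longlonglongrightarrow> y0 * 0" by (intro tendsto_intros LIMSEQ_power_zero) simp
    then have "b \<longlonglongrightarrow> 0" using b_le by (intro Lim_null_comparison[of b]) auto
    then have "(\<lambda>n. b n / b 0) \<longlonglongrightarrow> 0 / b 0" by (intro tendsto_intros b0)
    moreover have "b n / b 0 = t n" for n using bt[of n] b0 by simp
    ultimately have t0: "t \<longlonglongrightarrow> 0" by simp
    have lim: "(\<lambda>n. B n $1$1 - B n $2$2) \<longlonglongrightarrow> 0" "(\<lambda>n. B n $1$2) \<longlonglongrightarrow> 0" "(\<lambda>n. B n $2$1) \<longlonglongrightarrow> 0"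
      using tendsto_mult_right[OF t0, of "B 0 $1$1 - B 0 $2$2"] tendsto_mult_right[OF t0, of "B 0 $1$2"]
        tendsto_mult_right[OF t0, of "B 0 $2$1"]
      unfolding t(1,2,3)[symmetric] by simp_all
    have tr: "B n $1$1 + B n $2$2 = sqrt ((B n $1$1 - B n $2$2)\<^sup>2 + 4 * (1 + B n $1$2 * B n $2$1))" for n
    proof -
      have "(B n $1$1 + B n $2$2)\<^sup>2 = (B n $1$1 - B n $2$2)\<^sup>2 + 4 * (1 + B n $1$2 * B n $2$1)"
        using det[of n] by (simp add: det_2 power2_eq_square algebra_simps)
      moreover have "B n $1$1 + B n $2$2 \<ge> 0" using a'[of n] d'[of n] by linarith
      ultimately show ?thesis by (metis real_sqrt_abs abs_of_nonneg)
    qed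
    have "(\<lambda>n. sqrt ((B n $1$1 - B n $2$2)\<^sup>2 + 4 * (1 + B n $1$2 * B n $2$1))) \<longlonglongrightarrow> sqrt (0\<^sup>2 + 4 * (1 + 0 * 0))"
      by (intro tendsto_intros lim)
    then have trlim: "(\<lambda>n. B n $1$1 + B n $2$2) \<longlonglongrightarrow> 2" unfolding tr by simp
    have "(\<lambda>n. ((B n $1$1 + B n $2$2) + (B n $1$1 - B n $2$2)) / 2) \<longlonglongrightarrow> (2 + 0) / 2"
      "(\<lambda>n. ((B n $1$1 + B n $2$2) - (B n $1$1 - B n $2$2)) / 2) \<longlonglongrightarrow> (2 - 0) / 2"
      by (intro tendsto_intros trlim lim; simp)+
    then have "(\<lambda>n. B n $1$1) \<longlonglongrightarrow> 1" "(\<lambda>n. B n $2$2) \<longlonglongrightarrow> 1" by simp_all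
    then have small: "(\<lambda>n. \<bar>B n $1$1 - 1\<bar> + \<bar>B n $1$2\<bar> + \<bar>B n $2$1\<bar> + \<bar>B n $2$2 - 1\<bar>) \<longlonglongrightarrow> \<bar>1 - 1\<bar> + \<bar>0\<bar> + \<bar>0\<bar> + \<bar>1 - 1\<bar>"
      by (intro tendsto_intros lim)
    obtain \<epsilon> where \<epsilon>: "\<epsilon> > 0" "\<And>A. A \<in> G \<Longrightarrow> norm (A - mat 1) < \<epsilon> \<Longrightarrow> A = mat 1"
      using isolated_one by blast
    have "\<forall>\<^sub>F n in sequentially. \<bar>B n $1$1 - 1\<bar> + \<bar>B n $1$2\<bar> + \<bar>B n $2$1\<bar> + \<bar>B n $2$2 - 1\<bar> < \<epsilon>"
      using order_tendstoD(2)[OF small, of \<epsilon>] \<epsilon>(1) by simp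
    then obtain n where "\<bar>B n $1$1 - 1\<bar> + \<bar>B n $1$2\<bar> + \<bar>B n $2$1\<bar> + \<bar>B n $2$2 - 1\<bar> < \<epsilon>"
      by (auto simp: eventually_sequentially)
    then have "norm (B n - mat 1) < \<epsilon>" using norm_mat_le_entries[of "B n - mat 1"] by simp
    then show False using \<epsilon>(2)[OF BG] B1 by blast
  qed
  have bz: "B 0 $1$2 + (B 0 $1$1 - B 0 $2$2) * x - B 0 $2$1 * x\<^sup>2 = 0"
    using \<open>b 0 = 0\<close> by (simp add: b_def)
  have ge: "r \<le> \<bar>frame (z 0) A $2$2\<bar>" if "A \<in> G" for A
    using r(2)[OF that] by (simp add: z add.commute)
  have no_contraction: "\<bar>frame (z 0) A $2$2\<bar> \<ge> 1" if A: "A \<in> G" and A0: "frame (z 0) A $1$2 = 0" for A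
  proof (rule ccontr)
    assume lt: "\<not> 1 \<le> \<bar>frame (z 0) A $2$2\<bar>"
    have pow: "\<exists>C\<in>G. frame (z 0) C $1$2 = 0 \<and> frame (z 0) C $2$2 = (frame (z 0) A $2$2) ^ m" for m
    proof (induction m)
      case 0
      show ?case using G_one by (intro bexI[of _ "mat 1"]) (simp_all del: frame_nth)
    next
      case (Suc m)
      then obtain C where C: "C \<in> G" "frame (z 0) C $1$2 = 0" "frame (z 0) C $2$2 = (frame (z 0) A $2$2) ^ m" by blast
      have "frame (z 0) (C ** A) $1$2 = 0 \<and> frame (z 0) (C ** A) $2$2 = (frame (z 0) A $2$2) ^ Suc m"
        unfolding frame_mult[OF z(1)] matmul_nth C(2,3) A0 by simp
      then show ?case using G_mult[OF C(1) A] by blast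
    qed
    obtain m where "\<bar>frame (z 0) A $2$2\<bar> ^ m < r" using real_arch_pow_inv[OF r(1)] lt by (meson not_le)
    moreover obtain C where "C \<in> G" "frame (z 0) C $2$2 = (frame (z 0) A $2$2) ^ m" using pow by blast
    ultimately show False using ge by (metis power_abs not_le)
  qed
  define M where "M = frame (z 0) (B 0)"
  have M12: "M $1$2 = 0" using bz by (simp add: M_def z)
  have "M $1$1 * M $2$2 = 1"
    using det_frame[OF z(1), of 0 "B 0"] det[of 0] M12 by (simp add: M_def[symmetric] det_2)
  moreover have "\<bar>M $2$2\<bar> \<ge> 1" using no_contraction[OF BG[of 0]] M12 by (simp only: M_def)
  moreover have "\<bar>M $1$1\<bar> \<ge> 1"
    using no_contraction[OF G_adj2[OF BG[of 0]]] M12 unfolding frame_adj2 M_def[symmetric] by simp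
  moreover have "M $1$1 > 0" "M $2$2 > 0" using a'[of 0] d'[of 0] unfolding M_def frame_nth z by linarith+
  ultimately have "M $1$1 = 1 \<and> M $2$2 = 1"
    using mult_left_mono[of 1 "M $2$2" "M $1$1"] mult_right_mono[of 1 "M $1$1" "M $2$2"] by simp
  then have "B 0 $1$1 - B 0 $2$1 * x = 1" "B 0 $2$2 + B 0 $2$1 * x = 1" by (simp_all add: M_def z)
  then show ?thesis using that[OF BG B1 _ _ bz] by blast
qed

end

section \<open>Reduction to a neighbourhood of the cusp\<close>

lemma (in fuchsian_group) mem_cuspsI:
  assumes "B \<in> G" "B \<noteq> mat 1" "B$1$1 - B$2$1 * x = 1" "B$2$2 + B$2$1 * x = 1"
    "B$1$2 + (B$1$1 - B$2$2) * x - B$2$1 * x\<^sup>2 = 0"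
  shows "Some x \<in> cusps \<Gamma>"
proof -
  let ?g = "{B, - B}"
  note g = coset_G[OF assms(1)]
  have tr: "B$1$1 + B$2$2 = 2" using assms(3,4) by linarith
  have "B \<noteq> - mat 1"
  proof
    assume "B = - mat 1"
    then have "B$1$1 = - 1" "B$2$2 = - 1" by simp_all
    then show False using tr by simp
  qed
  then have "?g \<noteq> \<one>\<^bsub>PSL2\<^esub>" using assms(2) by (auto simp: one_PSL2 doubleton_eq_iff)
  moreover have "\<bar>trace (rep ?g)\<bar> = 2"
    using g(2) tr by (elim disjE) (auto simp: trace_def sum_2)
  ultimately have par: "parabolic ?g" by (simp add: parabolic_def)
  have den: "B$2$1 * x + B$2$2 = 1" using assms(4) by simp
  have num: "B$1$1 * x + B$1$2 = x"
  proof -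
    have "B$1$1 * x + B$1$2 = x * (B$2$2 + B$2$1 * x)"
      using assms(5) by (simp add: power2_eq_square algebra_simps)
    then show ?thesis using assms(4) by simp
  qed
  have "moebius_boundary B (Some x) = Some x" using den num by simp
  moreover have "moebius_boundary (- B) (Some x) = Some x"
  proof -
    have "(- B)$2$1 * x + (- B)$2$2 = - 1" "(- B)$1$1 * x + (- B)$1$2 = - x" using den num by simp_all
    then show ?thesis by simp
  qed
  ultimately have "psl_boundary_act ?g (Some x) = Some x"
    using g(2) unfolding psl_boundary_act_def by metis
  then show ?thesis using g(1) par by (auto simp: cusps_def)
qed

text \<open>
  Boundary points as lines in the plane: the fixed points become eigenvectors, and the case
  distinctions in the action disappear.
\<close>

fun boundary_vector :: "real option \<Rightarrow> real^2" where
  "boundary_vector None = vector [1, 0]"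
| "boundary_vector (Some x) = vector [x, 1]"

lemma moebius_boundary_vector:
  assumes "det A = 1"
  shows "\<exists>\<mu>. \<mu> \<noteq> 0 \<and> A *v boundary_vector p = \<mu> *\<^sub>R boundary_vector (moebius_boundary A p)"
proof (cases p)
  case None
  then show ?thesis
  proof (cases "A$2$1 = 0")
    case True
    then have "A$1$1 \<noteq> 0" using assms by (auto simp: det_2)
    with True None show ?thesis
      by (intro exI[of _ "A$1$1"]) (simp add: vec_eq_iff forall_2 matrix_vector_mult_def sum_2)
  next
    case False
    with None show ?thesis
      by (intro exI[of _ "A$2$1"]) (simp add: vec_eq_iff forall_2 matrix_vector_mult_def sum_2)
  qed
next
  case (Some x)
  show ?thesis
  proof (cases "A$2$1 * x + A$2$2 = 0")
    case True
    have "A$1$1 * x + A$1$2 \<noteq> 0"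
    proof
      assume "A$1$1 * x + A$1$2 = 0"
      then have "A$1$2 = - A$1$1 * x" "A$2$2 = - A$2$1 * x" using True by simp_all
      then show False using assms by (simp add: det_2)
    qed
    with True Some show ?thesis
      by (intro exI[of _ "A$1$1 * x + A$1$2"]) (simp add: vec_eq_iff forall_2 matrix_vector_mult_def sum_2)
  next
    case False
    with Some show ?thesis
      by (intro exI[of _ "A$2$1 * x + A$2$2"]) (simp add: vec_eq_iff forall_2 matrix_vector_mult_def sum_2)
  qed
qed

context fuchsian_group
begin

text \<open>
  Every cusp is equivalent to infinity. Conjugating a parabolic element accordingly gives one that
  fixes infinity, which is a translation up to sign.
\<close>

lemma cusp_at_infinity:
  assumes "infinity_only_puncture \<Gamma>"
  shows "\<exists>t. t \<noteq> 0 \<and> transl t \<in> G"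
    and "Some x \<in> cusps \<Gamma> \<Longrightarrow> \<exists>A\<in>G. A$2$1 * x + A$2$2 = 0"
proof -
  let ?orb = "orbit (PSL2\<lparr>carrier := \<Gamma>\<rparr>) psl_boundary_act"
  have orb: "?orb p = (\<lambda>g. psl_boundary_act g p) ` \<Gamma>" for p by (auto simp: orbit_def)
  have one: "\<one>\<^bsub>PSL2\<^esub> \<in> \<Gamma>" using subgroup.one_closed[OF subgroup_\<Gamma>] .
  have "rep \<one>\<^bsub>PSL2\<^esub> = mat 1 \<or> rep \<one>\<^bsub>PSL2\<^esub> = - mat 1" using coset_G(2)[OF G_one] by (simp add: one_PSL2)
  then have "psl_boundary_act \<one>\<^bsub>PSL2\<^esub> None = None" by (auto simp: psl_boundary_act_def)
  then have None_orb: "None \<in> ?orb None" unfolding orb using one by (metis image_eqI)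
  have punct: "?orb ` cusps \<Gamma> = {?orb None}"
    using assms by (simp add: infinity_only_puncture_def punctures_def)
  show "\<exists>A\<in>G. A$2$1 * x + A$2$2 = 0" if "Some x \<in> cusps \<Gamma>"
  proof -
    have "?orb (Some x) \<in> {?orb None}" unfolding punct[symmetric] using that by (rule imageI)
    then have "?orb (Some x) = ?orb None" by (rule singletonD)
    with None_orb have "None \<in> (\<lambda>g. psl_boundary_act g (Some x)) ` \<Gamma>" unfolding orb by blast
    then obtain g where g: "None = psl_boundary_act g (Some x)" "g \<in> \<Gamma>" by (rule imageE)
    from g(1) have "rep g $2$1 * x + rep g $2$2 = 0"
      by (auto simp: psl_boundary_act_def split: if_splits)
    then show ?thesis using rep_G(1)[OF g(2)] by blast
  qed
  show "\<exists>t. t \<noteq> 0 \<and> transl t \<in> G"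
  proof -
    have "?orb None \<in> ?orb ` cusps \<Gamma>" unfolding punct by (rule singletonI)
    then obtain p where p: "?orb None = ?orb p" "p \<in> cusps \<Gamma>" by (rule imageE)
    from None_orb have "None \<in> (\<lambda>g. psl_boundary_act g p) ` \<Gamma>" unfolding p(1) unfolding orb .
    then obtain h where h: "None = psl_boundary_act h p" "h \<in> \<Gamma>" by (rule imageE)
    obtain g where g: "g \<in> \<Gamma>" "parabolic g" "psl_boundary_act g p = p"
      using p(2) unfolding cusps_def by blast
    define A C where "A = rep h" and "C = rep g"
    have A: "A \<in> G" "det A = 1" and C: "C \<in> G" "det C = 1"
      using rep_G(1,3)[OF h(2)] rep_G(1,3)[OF g(1)] unfolding A_def C_def by blast+
    define D where "D = A ** C ** adj2 A"
    have D: "D \<in> G" unfolding D_def using A C by (intro G_mult G_adj2)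
    have detD: "det D = 1" using det_G[OF D] .
    obtain \<mu> where \<mu>: "\<mu> \<noteq> 0" "A *v boundary_vector p = \<mu> *\<^sub>R boundary_vector None"
      using moebius_boundary_vector[OF A(2), of p] h(1) unfolding psl_boundary_act_def A_def by metis
    obtain \<nu> where \<nu>: "\<nu> \<noteq> 0" "C *v boundary_vector p = \<nu> *\<^sub>R boundary_vector p"
      using moebius_boundary_vector[OF C(2), of p] g(3) unfolding psl_boundary_act_def C_def by metis
    have DA: "D ** A = A ** C"
      unfolding D_def using adj2_mult(2)[OF A(2)] by (metis matrix_mul_assoc matrix_mul_rid)
    have "D *v (\<mu> *\<^sub>R boundary_vector None) = (D ** A) *v boundary_vector p"
      by (simp add: \<mu>(2)[symmetric] matrix_vector_mul_assoc del: boundary_vector.simps)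
    also have "\<dots> = A *v (\<nu> *\<^sub>R boundary_vector p)"
      by (simp add: DA \<nu>(2)[symmetric] matrix_vector_mul_assoc del: boundary_vector.simps)
    also have "\<dots> = (\<nu> * \<mu>) *\<^sub>R boundary_vector None"
      by (simp add: matrix_vector_mult_scaleR \<mu>(2) del: boundary_vector.simps)
    finally have "(D *v (\<mu> *\<^sub>R boundary_vector None)) $ 2 = ((\<nu> * \<mu>) *\<^sub>R boundary_vector None) $ 2"
      by simp
    then have D21: "D$2$1 = 0" using \<mu>(1) by (simp add: matrix_vector_mult_def sum_2)
    have "trace D = trace C"
    proof -
      have "trace D = (C$1$1 + C$2$2) * (A$1$1 * A$2$2 - A$1$2 * A$2$1)"
        by (simp add: trace_def sum_2 D_def algebra_simps)
      then show ?thesis using A(2) by (simp add: trace_def sum_2 det_2)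
    qed
    moreover have "\<bar>trace C\<bar> = 2" using g(2) by (simp add: parabolic_def C_def)
    ultimately have tr: "\<bar>D$1$1 + D$2$2\<bar> = 2" by (simp add: trace_def sum_2)
    have prod: "D$1$1 * D$2$2 = 1" using detD D21 by (simp add: det_2)
    have "(D$1$1 - D$2$2)\<^sup>2 = \<bar>D$1$1 + D$2$2\<bar>\<^sup>2 - 4 * (D$1$1 * D$2$2)"
      by (simp add: power2_eq_square algebra_simps)
    then have "D$1$1 = D$2$2" using tr prod by simp
    then have diag: "D$1$1 = 1 \<and> D$2$2 = 1 \<or> D$1$1 = - 1 \<and> D$2$2 = - 1"
      using prod by (auto simp: square_eq_1_iff)
    have C_eq: "C = adj2 A ** D ** A"
      unfolding D_def using adj2_mult(2)[OF A(2)] by (metis matrix_mul_assoc matrix_mul_lid matrix_mul_rid)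
    have ne: "D$1$2 \<noteq> 0"
    proof
      assume "D$1$2 = 0"
      then have "D = mat 1 \<or> D = - mat 1" using diag D21 by (auto intro!: mat2_eqI)
      then have "C = mat 1 \<or> C = - mat 1"
        unfolding C_eq using adj2_mult(2)[OF A(2)] by (auto simp: matrix_mul_uminus)
      then have "{C, - C} = {mat 1, - mat 1}" by (elim disjE) (simp_all add: insert_commute)
      moreover have "g = {C, - C}" unfolding C_def by (rule rep_G(2)[OF g(1)])
      ultimately have "g = \<one>\<^bsub>PSL2\<^esub>" unfolding one_PSL2 by (rule trans[rotated])
      then show False using g(2) by (simp add: parabolic_def)
    qed
    show ?thesis
    proof (cases "D$1$1 = 1")
      case True
      then have "D = transl (D$1$2)" using diag D21 by (intro mat2_eqI) auto
      then show ?thesis using D ne by metis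
    next
      case False
      then have "- D = transl (- D$1$2)" using diag D21 by (intro mat2_eqI) auto
      then show ?thesis using G_uminus[OF D] ne by (metis neg_equal_0_iff_equal)
    qed
  qed
qed

end

context cusp_group
begin

lemma automorphy_transl: "automorphy A (z + of_real t) = automorphy (A ** transl t) z"
  by (simp add: automorphy_def algebra_simps)

lemma ex_transl_to_strip:
  obtains n :: int where "0 \<le> Re z + of_int n * width" "Re z + of_int n * width \<le> width"
proof -
  define q where "q = Re z / width"
  have "of_int \<lfloor>q\<rfloor> * width \<le> q * width" "q * width \<le> (of_int \<lfloor>q\<rfloor> + 1) * width"
    using width(1) by (intro mult_right_mono; linarith)+
  moreover have "q * width = Re z" using width(1) by (simp add: q_def)
  ultimately show ?thesis
    by (intro that[of "- \<lfloor>q\<rfloor>"]) (simp_all add: algebra_simps)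
qed

text \<open>
  Points of almost maximal height in their orbit stay away from the real line: a limit point \<open>x\<close> of
  counterexamples would, by finiteness of the area, be a cusp, hence equivalent to infinity, and
  the points above a cusp equivalent to infinity are not of almost maximal height.
\<close>

lemma ex_height_bound:
  assumes F: "fundamental_domain \<Gamma> F" "emeasure hyperbolic_area F < \<infinity>"
    and only: "\<And>x. Some x \<in> cusps \<Gamma> \<Longrightarrow> \<exists>A\<in>G. A$2$1 * x + A$2$2 = 0"
  obtains Y where "Y > 0" "\<And>z. Im z > 0 \<Longrightarrow> (\<And>A. A \<in> G \<Longrightarrow> (cmod (automorphy A z))\<^sup>2 \<ge> 1 / 2) \<Longrightarrow> Im z \<ge> Y"
proof (rule ccontr)
  note below = that
  assume contra: "\<not> thesis"
  have "\<exists>z. Im z > 0 \<and> Im z < 1 / real (Suc n) \<and> 0 \<le> Re z \<and> Re z \<le> width \<and>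
      (\<forall>A\<in>G. (cmod (automorphy A z))\<^sup>2 \<ge> 1 / 2)" for n
  proof -
    obtain z where z: "Im z > 0" "Im z < 1 / real (Suc n)" "\<And>A. A \<in> G \<Longrightarrow> (cmod (automorphy A z))\<^sup>2 \<ge> 1 / 2"
      using contra below[of "1 / real (Suc n)"] by (metis not_le of_nat_0_less_iff zero_less_Suc zero_less_divide_1_iff)
    obtain m :: int where m: "0 \<le> Re z + of_int m * width" "Re z + of_int m * width \<le> width"
      by (rule ex_transl_to_strip)
    have "(cmod (automorphy A (z + of_real (of_int m * width))))\<^sup>2 \<ge> 1 / 2" if "A \<in> G" for A
      unfolding automorphy_transl using that by (intro z G_mult transl_multiple_width)
    then show ?thesis using z m by (intro exI[of _ "z + of_real (of_int m * width)"]) auto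
  qed
  then obtain z where z: "\<And>n. Im (z n) > 0" "\<And>n. Im (z n) < 1 / real (Suc n)"
      "\<And>n. 0 \<le> Re (z n) \<and> Re (z n) \<le> width" "\<And>n A. A \<in> G \<Longrightarrow> (cmod (automorphy A (z n)))\<^sup>2 \<ge> 1 / 2"
    by metis
  have "\<forall>n. Re (z n) \<in> {0..width}" using z(3) by simp
  then obtain x r where r: "strict_mono r" and x: "((\<lambda>n. Re (z n)) \<circ> r) \<longlonglongrightarrow> x"
    using compact_imp_seq_compact[OF compact_Icc[of 0 width]] unfolding seq_compact_def by metis
  have "(\<lambda>n. Im (z n)) \<longlonglongrightarrow> 0"
    by (rule Lim_null_comparison[OF _ LIMSEQ_inverse_real_of_nat])
       (use z(1,2) in \<open>auto intro!: always_eventually simp: inverse_eq_divide less_imp_le\<close>)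
  then have y: "((\<lambda>n. Im (z n)) \<circ> r) \<longlonglongrightarrow> 0" using r by (rule LIMSEQ_subseq_LIMSEQ)
  have low: "(A$2$1 * x + A$2$2)\<^sup>2 \<ge> 1 / 2" if "A \<in> G" for A
  proof -
    have "(\<lambda>n. (A$2$1 * ((\<lambda>n. Re (z n)) \<circ> r) n + A$2$2)\<^sup>2 + (A$2$1 * ((\<lambda>n. Im (z n)) \<circ> r) n)\<^sup>2)
        \<longlonglongrightarrow> (A$2$1 * x + A$2$2)\<^sup>2 + (A$2$1 * 0)\<^sup>2"
      by (intro tendsto_intros x y)
    then have "1 / 2 \<le> (A$2$1 * x + A$2$2)\<^sup>2 + (A$2$1 * 0)\<^sup>2"
      by (rule LIMSEQ_le_const) (use z(4)[OF that] in \<open>auto simp: cmod_automorphy_sq\<close>)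
    then show ?thesis by simp
  qed
  obtain y0 where y0: "y0 > 0" "\<And>y. 0 < y \<Longrightarrow> y \<le> y0 \<Longrightarrow>
      \<exists>A\<in>G. A \<noteq> mat 1 \<and> norm (frame (Complex x y) A - mat 1) < 1 / 32"
    using ex_short_elements[OF F low, of "1 / 32"] by auto
  have ge: "\<bar>A$2$1 * x + A$2$2\<bar> \<ge> 1 / 2" if "A \<in> G" for A
  proof (rule power2_le_imp_le)
    show "(1 / 2)\<^sup>2 \<le> \<bar>A$2$1 * x + A$2$2\<bar>\<^sup>2" using low[OF that] by (simp add: power2_eq_square)
  qed simp
  have half: "(1 / 2 :: real) > 0" by simp
  obtain B where "B \<in> G" "B \<noteq> mat 1" "B$1$1 - B$2$1 * x = 1" "B$2$2 + B$2$1 * x = 1"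
    "B$1$2 + (B$1$1 - B$2$2) * x - B$2$1 * x\<^sup>2 = 0"
    by (rule ex_parabolic_of_short_elements[OF half ge y0])
  then have "Some x \<in> cusps \<Gamma>" by (rule mem_cuspsI)
  then obtain A where "A \<in> G" "A$2$1 * x + A$2$2 = 0" using only by blast
  then show False using ge[of A] by simp
qed

text \<open>
  Heights in an orbit are bounded, since nonzero lower left entries are bounded away from zero. A
  point of height more than half of the supremum is enough.
\<close>

lemma ex_almost_highest:
  assumes "Im z > 0"
  obtains S where "S \<in> G" "\<And>A. A \<in> G \<Longrightarrow> (cmod (automorphy A (moebius S z)))\<^sup>2 \<ge> 1 / 2"
proof -
  obtain c0 where c0: "c0 > 0" "\<And>A. A \<in> G \<Longrightarrow> A$2$1 \<noteq> 0 \<Longrightarrow> c0 \<le> \<bar>A$2$1\<bar>"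
    using ex_lower_left_bound by blast
  let ?H = "(\<lambda>A. Im (moebius A z)) ` G"
  have "Im (moebius A z) \<le> Im z + 1 / (c0\<^sup>2 * Im z)" if A: "A \<in> G" for A
  proof (cases "A$2$1 = 0")
    case True
    obtain n :: int where "A = transl (of_int n * width) \<or> A = - transl (of_int n * width)"
      using stabilizer_infinity[OF A True] by blast
    then have "Im (moebius A z) = Im z" by (auto simp: moebius_uminus)
    then show ?thesis using assms by simp
  next
    case False
    have det: "det A = 1" using det_G[OF A] .
    have "c0\<^sup>2 \<le> (A$2$1)\<^sup>2" using c0(1) c0(2)[OF A False] by (metis abs_le_square_iff abs_of_pos)
    then have "c0\<^sup>2 * (Im z)\<^sup>2 \<le> (cmod (automorphy A z))\<^sup>2"
      unfolding cmod_automorphy_sq power_mult_distrib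
      by (smt (verit) mult_right_mono zero_le_power2)
    then have "Im z / (cmod (automorphy A z))\<^sup>2 \<le> Im z / (c0\<^sup>2 * (Im z)\<^sup>2)"
      using c0(1) assms automorphy_nz[OF det assms] by (intro divide_left_mono mult_pos_pos) auto
    then show ?thesis using assms by (simp add: Im_moebius[OF det assms] power2_eq_square)
  qed
  then have bdd: "bdd_above ?H" by (intro bdd_aboveI2)
  have ne: "?H \<noteq> {}" using G_one by blast
  have pos: "Im (moebius A z) > 0" if "A \<in> G" for A using Im_moebius_pos[OF det_G[OF that] assms] .
  have "Sup ?H \<ge> Im (moebius (mat 1) z)" using G_one bdd by (intro cSup_upper) blast+
  then have "Sup ?H > 0" using assms by simp
  then have "Sup ?H / 2 < Sup ?H" by simp
  then obtain S where S: "S \<in> G" "Sup ?H / 2 < Im (moebius S z)"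
    using less_cSup_iff[OF ne bdd] by auto
  have "(cmod (automorphy A (moebius S z)))\<^sup>2 \<ge> 1 / 2" if A: "A \<in> G" for A
  proof -
    note dets = det_G[OF A] det_G[OF S(1)]
    have "Im (moebius (A ** S) z) \<le> Sup ?H" using G_mult[OF A S(1)] bdd by (intro cSup_upper) blast+
    also have "\<dots> \<le> 2 * Im (moebius S z)" using S(2) by simp
    also have "Im (moebius (A ** S) z) = Im (moebius S z) / (cmod (automorphy A (moebius S z)))\<^sup>2"
      using dets assms pos[OF S(1)] by (simp add: moebius_mult Im_moebius[of A "moebius S z"])
    finally have "Im (moebius S z) \<le> 2 * Im (moebius S z) * (cmod (automorphy A (moebius S z)))\<^sup>2"
      using automorphy_nz[OF dets(1) pos[OF S(1)]] by (simp add: divide_le_eq)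
    then show ?thesis using pos[OF S(1)] by simp
  qed
  with S(1) show ?thesis using that by blast
qed

lemma ex_bound_cusp:
  assumes F: "fundamental_domain \<Gamma> F" "emeasure hyperbolic_area F < \<infinity>"
    and only: "\<And>x. Some x \<in> cusps \<Gamma> \<Longrightarrow> \<exists>A\<in>G. A$2$1 * x + A$2$2 = 0"
  obtains C where "C \<ge> 0" "\<And>z k. Im z > 0 \<Longrightarrow> k \<ge> 3 \<Longrightarrow>
    bergman_norm \<Gamma> k z z \<le> real k * (sqrt (real k) + C)"
proof -
  obtain Y where Y: "Y > 0"
    "\<And>z. Im z > 0 \<Longrightarrow> (\<And>A. A \<in> G \<Longrightarrow> (cmod (automorphy A z))\<^sup>2 \<ge> 1 / 2) \<Longrightarrow> Im z \<ge> Y"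
    using ex_height_bound[OF F only] by blast
  obtain C where C: "C \<ge> 0" "\<And>z k. Im z \<ge> Y \<Longrightarrow> 0 \<le> Re z \<Longrightarrow> Re z \<le> width \<Longrightarrow> k \<ge> 3 \<Longrightarrow>
    bergman_norm \<Gamma> k z z \<le> real k * (sqrt (real k) + C)"
    using ex_bound_near_cusp[OF Y(1)] by blast
  have "bergman_norm \<Gamma> k z z \<le> real k * (sqrt (real k) + C)" if z: "Im z > 0" and k: "k \<ge> 3" for z k
  proof -
    obtain S where S: "S \<in> G" "\<And>A. A \<in> G \<Longrightarrow> (cmod (automorphy A (moebius S z)))\<^sup>2 \<ge> 1 / 2"
      using ex_almost_highest[OF z] by blast
    define w where "w = moebius S z"
    have w: "Im w > 0" using Im_moebius_pos[OF det_G[OF S(1)] z] by (simp add: w_def)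
    have wY: "Im w \<ge> Y" using Y(2)[OF w] S(2) by (simp add: w_def)
    obtain n :: int where n: "0 \<le> Re w + of_int n * width" "Re w + of_int n * width \<le> width"
      by (rule ex_transl_to_strip)
    have "bergman_norm \<Gamma> k z z = bergman_norm \<Gamma> k w w"
      unfolding w_def using bergman_norm_moebius[OF S(1) z] by simp
    also have "\<dots> = bergman_norm \<Gamma> k (w + of_real (of_int n * width)) (w + of_real (of_int n * width))"
      using bergman_norm_moebius[OF transl_multiple_width w, of k n] by (simp only: moebius_transl)
    also have "\<dots> \<le> real k * (sqrt (real k) + C)"
      by (rule C(2)) (use wY n k in auto)
    finally show ?thesis .
  qed
  with C(1) show ?thesis using that by blast
qed

end

section \<open>Compact quotients\<close>

lemma (in fuchsian_group) orbit_map_eq: "orbit_map \<Gamma> z = (\<lambda>g. psl_act g z) ` \<Gamma>"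
  by (auto simp: orbit_map_def orbit_def)

lemma (in fuchsian_group) orbit_map_eqD:
  assumes "Im z > 0" "Im w > 0" "orbit_map \<Gamma> z = orbit_map \<Gamma> w"
  shows "\<exists>A\<in>G. moebius A z = w"
proof -
  have one: "\<one>\<^bsub>PSL2\<^esub> \<in> \<Gamma>" using subgroup.one_closed[OF subgroup_\<Gamma>] .
  have "rep \<one>\<^bsub>PSL2\<^esub> = mat 1 \<or> rep \<one>\<^bsub>PSL2\<^esub> = - mat 1" using coset_G(2)[OF G_one] by (simp add: one_PSL2)
  then have "psl_act \<one>\<^bsub>PSL2\<^esub> w = w" by (auto simp: psl_act_def moebius_uminus)
  then have "w \<in> orbit_map \<Gamma> w" unfolding orbit_map_eq using one by (metis image_eqI)
  then obtain g where "g \<in> \<Gamma>" "w = psl_act g z" using assms(3) unfolding orbit_map_eq by blast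
  then show ?thesis using rep_G(1) by (auto simp: psl_act_def)
qed

lemma (in fuchsian_group) orbit_map_moebius:
  assumes "A \<in> G" "Im z > 0"
  shows "orbit_map \<Gamma> (moebius A z) = orbit_map \<Gamma> z"
proof -
  have sub: "orbit_map \<Gamma> (moebius B w) \<subseteq> orbit_map \<Gamma> w" if B: "B \<in> G" and w: "Im w > 0" for B w
  proof
    fix u assume "u \<in> orbit_map \<Gamma> (moebius B w)"
    then obtain g where g: "g \<in> \<Gamma>" "u = moebius (rep g) (moebius B w)"
      by (auto simp: orbit_map_eq psl_act_def)
    have "u = moebius (rep g ** B) w"
      using g rep_G(3)[OF g(1)] det_G[OF B] w by (simp add: moebius_mult)
    moreover have "rep g ** B \<in> G" using G_mult[OF rep_G(1)[OF g(1)] B] .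
    from coset_G[OF this] have "{rep g ** B, - (rep g ** B)} \<in> \<Gamma>"
      "psl_act {rep g ** B, - (rep g ** B)} w = moebius (rep g ** B) w"
      by (auto simp: psl_act_def moebius_uminus)
    ultimately show "u \<in> orbit_map \<Gamma> w" unfolding orbit_map_eq by (metis image_eqI)
  qed
  have "orbit_map \<Gamma> z = orbit_map \<Gamma> (moebius (adj2 A) (moebius A z))"
    using moebius_adj2(1)[OF det_G[OF assms(1)] assms(2)] by simp
  also have "\<dots> \<subseteq> orbit_map \<Gamma> (moebius A z)"
    using G_adj2[OF assms(1)] Im_moebius_pos[OF det_G[OF assms(1)] assms(2)] by (rule sub)
  finally show ?thesis using sub[OF assms] by blast
qed

text \<open>
  The images of an exhaustion of the half-plane by bounded open sets cover the quotient, and they are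
  open there because the group acts by homeomorphisms.
\<close>

lemma (in fuchsian_group) ex_bounded_representatives:
  assumes "compact_space (quotient_surface \<Gamma>)"
  obtains R where "R > 0"
    "\<And>z. Im z > 0 \<Longrightarrow> \<exists>A\<in>G. \<bar>Re (moebius A z)\<bar> < R \<and> 1 / R < Im (moebius A z) \<and> Im (moebius A z) < R"
proof -
  define K where "K = (\<lambda>n::nat. {z. \<bar>Re z\<bar> < real n \<and> 1 / real n < Im z \<and> Im z < real n})"
  have KH: "K n \<subseteq> upper_half_plane" for n
  proof
    fix z assume "z \<in> K n"
    then have "1 / real n < Im z" by (simp add: K_def)
    moreover have "0 \<le> 1 / real n" by simp
    ultimately have "0 < Im z" by linarith
    then show "z \<in> upper_half_plane" by simp
  qed
  have K_open: "open (K n)" for n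
    unfolding K_def by (intro open_Collect_conj open_Collect_less continuous_intros)
  have K_mono: "K m \<subseteq> K n" if "m \<le> n" for m n
  proof
    fix z assume z: "z \<in> K m"
    then have "m > 0" by (auto simp: K_def intro: Suc_le_eq[THEN iffD1] gr0I)
    then have "1 / real n \<le> 1 / real m" using that by (intro divide_left_mono) auto
    then show "z \<in> K n" using z that by (auto simp: K_def)
  qed
  have vimage: "{z \<in> upper_half_plane. orbit_map \<Gamma> z \<in> orbit_map \<Gamma> ` K n}
      = (\<Union>A\<in>G. upper_half_plane \<inter> moebius A -` K n)" for n
  proof (intro equalityI subsetI)
    fix z assume "z \<in> {z \<in> upper_half_plane. orbit_map \<Gamma> z \<in> orbit_map \<Gamma> ` K n}"
    then obtain w where z: "Im z > 0" and w: "w \<in> K n" "orbit_map \<Gamma> z = orbit_map \<Gamma> w" by auto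
    have "Im w > 0" using KH w(1) uhp_iff by blast
    then obtain A where A: "A \<in> G" "moebius A z = w" using orbit_map_eqD[OF z _ w(2)] by blast
    show "z \<in> (\<Union>A\<in>G. upper_half_plane \<inter> moebius A -` K n)"
      by (rule UN_I[OF A(1)]) (use A(2) z w(1) in simp)
  next
    fix z assume "z \<in> (\<Union>A\<in>G. upper_half_plane \<inter> moebius A -` K n)"
    then obtain A where A: "A \<in> G" "Im z > 0" "moebius A z \<in> K n" by (elim UN_E) simp
    have "orbit_map \<Gamma> z \<in> orbit_map \<Gamma> ` K n"
      using orbit_map_moebius[OF A(1,2)] A(3) by (metis image_eqI)
    then show "z \<in> {z \<in> upper_half_plane. orbit_map \<Gamma> z \<in> orbit_map \<Gamma> ` K n}" using A(2) by simp
  qed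
  have H: "open upper_half_plane"
    unfolding upper_half_plane_def by (intro open_Collect_less continuous_intros)
  have op: "openin (quotient_surface \<Gamma>) (orbit_map \<Gamma> ` K n)" for n
    unfolding openin_quotient_surface vimage
  proof (rule conjI)
    show "orbit_map \<Gamma> ` K n \<subseteq> orbit_map \<Gamma> ` upper_half_plane" by (rule image_mono[OF KH])
    have "openin (top_of_set upper_half_plane) (upper_half_plane \<inter> moebius A -` K n)" if "A \<in> G" for A
      using continuous_openin_preimage_gen[OF continuous_on_moebius[OF det_G[OF that]] K_open] .
    then show "openin (top_of_set upper_half_plane) (\<Union>A\<in>G. upper_half_plane \<inter> moebius A -` K n)"
      by (intro openin_Union) blast
  qed
  have cover: "topspace (quotient_surface \<Gamma>) \<subseteq> \<Union> (range (\<lambda>n. orbit_map \<Gamma> ` K n))"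
  proof
    fix p assume "p \<in> topspace (quotient_surface \<Gamma>)"
    then obtain z where z: "Im z > 0" "p = orbit_map \<Gamma> z" by (auto simp: topspace_quotient_surface)
    obtain n :: nat where n: "real n > \<bar>Re z\<bar> + Im z + 1 / Im z" using reals_Archimedean2 by blast
    have "1 / Im z > 0" using z(1) by simp
    then have "real n > 1 / Im z" "real n > \<bar>Re z\<bar>" "real n > Im z" "real n > 0" using n z(1) by linarith+
    then have "z \<in> K n" using z(1) by (simp add: K_def field_simps)
    then show "p \<in> \<Union> (range (\<lambda>n. orbit_map \<Gamma> ` K n))" using z(2) by blast
  qed
  obtain \<F> where \<F>: "finite \<F>" "\<F> \<subseteq> range (\<lambda>n. orbit_map \<Gamma> ` K n)" "topspace (quotient_surface \<Gamma>) \<subseteq> \<Union>\<F>"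
  proof -
    have "\<forall>U\<in>range (\<lambda>n. orbit_map \<Gamma> ` K n). openin (quotient_surface \<Gamma>) U" using op by blast
    then show ?thesis using assms cover that unfolding compact_space_alt by meson
  qed
  obtain I where I: "finite I" "\<F> = (\<lambda>n. orbit_map \<Gamma> ` K n) ` I"
    using finite_subset_image[OF \<F>(1,2)] by blast
  define N where "N = Max (insert 1 I)"
  have N: "N \<ge> 1" "\<And>n. n \<in> I \<Longrightarrow> n \<le> N" using I(1) by (auto simp: N_def)
  show ?thesis
  proof (rule that[of "real N"])
    show "real N > 0" using N(1) by simp
    fix z :: complex assume z: "Im z > 0"
    then have "orbit_map \<Gamma> z \<in> \<Union>\<F>" using \<F>(3) unfolding topspace_quotient_surface using uhp_iff by blast
    then obtain n w where n: "n \<in> I" "w \<in> K n" "orbit_map \<Gamma> z = orbit_map \<Gamma> w" unfolding I(2) by blast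
    have "Im w > 0" using KH n(2) uhp_iff by blast
    then obtain A where "A \<in> G" "moebius A z = w" using orbit_map_eqD[OF z _ n(3)] by blast
    moreover have "w \<in> K N" using n(2) K_mono[OF N(2)[OF n(1)]] by blast
    ultimately show "\<exists>A\<in>G. \<bar>Re (moebius A z)\<bar> < real N \<and> 1 / real N < Im (moebius A z) \<and> Im (moebius A z) < real N"
      by (auto simp: K_def)
  qed
qed

lemma (in fuchsian_group) ex_bound_compact:
  assumes "compact_space (quotient_surface \<Gamma>)"
  obtains C where "\<And>z k. Im z > 0 \<Longrightarrow> k \<ge> 3 \<Longrightarrow> bergman_norm \<Gamma> k z z \<le> C * real k"
proof -
  obtain R where R: "R > 0"
    "\<And>z. Im z > 0 \<Longrightarrow> \<exists>A\<in>G. \<bar>Re (moebius A z)\<bar> < R \<and> 1 / R < Im (moebius A z) \<and> Im (moebius A z) < R"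
    using ex_bounded_representatives[OF assms] by blast
  define P where "P = (R\<^sup>2 + (R + 1)\<^sup>2) * R / 4"
  have "bergman_norm \<Gamma> k z z \<le> ((16 * P\<^sup>2) powr (3/2) * poincare_sum) * real k" if z: "Im z > 0" and k: "k \<ge> 3" for z k
  proof -
    obtain A where A: "A \<in> G" "\<bar>Re (moebius A z)\<bar> < R" "1 / R < Im (moebius A z)" "Im (moebius A z) < R"
      using R(2)[OF z] by blast
    define w where "w = moebius A z"
    have w: "\<bar>Re w\<bar> < R" "1 / R < Im w" "Im w < R" "Im w > 0"
      using A Im_moebius_pos[OF det_G[OF A(1)] z] by (auto simp: w_def)
    have "(Re w)\<^sup>2 \<le> R\<^sup>2" using w(1) R(1) by (metis abs_le_square_iff abs_of_pos less_imp_le)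
    moreover have "(Im w + 1)\<^sup>2 \<le> (R + 1)\<^sup>2" using w by (intro power_mono) auto
    moreover have "1 / Im w \<le> R" using w R(1) by (simp add: field_simps)
    ultimately have "((Re w)\<^sup>2 + (Im w + 1)\<^sup>2) * (1 / Im w) \<le> (R\<^sup>2 + (R + 1)\<^sup>2) * R"
      using w by (intro mult_mono add_mono) auto
    then have "((Re w)\<^sup>2 + (Im w + 1)\<^sup>2) * (1 / Im w) / 4 \<le> P" unfolding P_def by (rule divide_right_mono) simp
    moreover have "ppi w \<i> = ((Re w)\<^sup>2 + (Im w + 1)\<^sup>2) * (1 / Im w) / 4" using w(4) by (simp add: ppi_alt)
    ultimately have "ppi w \<i> \<le> P" by simp
    moreover have "ppi w \<i> \<ge> 1" using w by (intro ppi_ge_1) auto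
    ultimately have "(16 * (ppi w \<i>)\<^sup>2) powr (3/2) \<le> (16 * P\<^sup>2) powr (3/2)"
      by (intro powr_mono2 mult_left_mono power_mono) auto
    then have "real k * ((16 * (ppi w \<i>)\<^sup>2) powr (3/2) * poincare_sum)
        \<le> real k * ((16 * P\<^sup>2) powr (3/2) * poincare_sum)"
      using poincare_sum_nonneg by (intro mult_left_mono mult_right_mono) auto
    moreover have "bergman_norm \<Gamma> k z z = bergman_norm \<Gamma> k w w"
      unfolding w_def using bergman_norm_moebius[OF A(1) z] by simp
    ultimately show ?thesis
      using bergman_norm_le_at_point[OF w(4) k] by (simp add: mult.commute)
  qed
  then show ?thesis using that by blast
qed

section \<open>Bounds for the Bergman kernel\<close>

theorem mainTheorem2:
  shows "(\<forall>\<Gamma>. cofinite_fuchsian \<Gamma> \<and> compact_space (quotient_surface \<Gamma>) \<longrightarrow>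
            (\<exists>C. \<forall>k\<ge>3. \<forall>z\<in>upper_half_plane. bergman_norm \<Gamma> k z z \<le> C * real k)) \<and>
         (\<exists>C. \<forall>\<Gamma>. cofinite_fuchsian \<Gamma> \<and> \<not> compact_space (quotient_surface \<Gamma>) \<and>
                  infinity_only_puncture \<Gamma> \<longrightarrow>
            (\<exists>k0. \<forall>k\<ge>k0. \<forall>z\<in>upper_half_plane.
                bergman_norm \<Gamma> k z z \<le> C * real k powr (3/2)) \<and>
            (\<exists>C'. \<forall>k\<ge>3. \<forall>z\<in>upper_half_plane.
                bergman_norm \<Gamma> k z z \<le> C' * real k powr (3/2)))"
proof (rule conjI, goal_cases)
  case 1
  show ?case
  proof (intro allI impI)
    fix \<Gamma> assume \<Gamma>: "cofinite_fuchsian \<Gamma> \<and> compact_space (quotient_surface \<Gamma>)"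
    then interpret fuchsian_group \<Gamma> by unfold_locales (simp add: cofinite_fuchsian_def)
    obtain C where "\<And>z k. Im z > 0 \<Longrightarrow> k \<ge> 3 \<Longrightarrow> bergman_norm \<Gamma> k z z \<le> C * real k"
      using ex_bound_compact \<Gamma> by blast
    then show "\<exists>C. \<forall>k\<ge>3. \<forall>z\<in>upper_half_plane. bergman_norm \<Gamma> k z z \<le> C * real k"
      by (intro exI[of _ C]) simp
  qed
next
  case 2
  show ?case
  proof (rule exI[of _ 2], intro allI impI)
    fix \<Gamma>
    assume \<Gamma>: "cofinite_fuchsian \<Gamma> \<and> \<not> compact_space (quotient_surface \<Gamma>) \<and> infinity_only_puncture \<Gamma>"
    then interpret fuchsian_group \<Gamma> by unfold_locales (simp add: cofinite_fuchsian_def)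
    interpret cusp_group \<Gamma> by unfold_locales (use cusp_at_infinity(1) \<Gamma> in blast)
    obtain F where F: "fundamental_domain \<Gamma> F" "emeasure hyperbolic_area F < \<infinity>"
      using \<Gamma> by (auto simp: cofinite_fuchsian_def)
    obtain C where C: "C \<ge> 0"
        "\<And>z k. Im z > 0 \<Longrightarrow> k \<ge> 3 \<Longrightarrow> bergman_norm \<Gamma> k z z \<le> real k * (sqrt (real k) + C)"
      using ex_bound_cusp[OF F] cusp_at_infinity(2) \<Gamma> by blast
    have powr: "real k powr (3/2) = real k * sqrt (real k)" if "k \<ge> 3" for k :: nat
    proof -
      have "real k powr (3/2) = real k powr (1 + 1/2)" by simp
      also have "\<dots> = real k * sqrt (real k)" using that by (simp only: powr_add powr_half_sqrt) simp
      finally show ?thesis .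
    qed
    have large: "\<exists>k0. \<forall>k\<ge>k0. \<forall>z\<in>upper_half_plane. bergman_norm \<Gamma> k z z \<le> 2 * real k powr (3/2)"
    proof (intro exI allI impI ballI)
      fix k z assume k: "k \<ge> max 3 (nat \<lceil>C\<^sup>2\<rceil>)" and z: "z \<in> upper_half_plane"
      have "C\<^sup>2 \<le> real k" using k by linarith
      then have "C \<le> sqrt (real k)" by (rule real_le_rsqrt)
      then have "real k * (sqrt (real k) + C) \<le> real k * (sqrt (real k) + sqrt (real k))"
        by (intro mult_left_mono add_left_mono) auto
      moreover have "bergman_norm \<Gamma> k z z \<le> real k * (sqrt (real k) + C)" using C(2)[of z k] k z by simp
      moreover have "real k * (sqrt (real k) + sqrt (real k)) = 2 * real k powr (3/2)" using k by (simp add: powr)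
      ultimately show "bergman_norm \<Gamma> k z z \<le> 2 * real k powr (3/2)" by linarith
    qed
    have all: "\<exists>C'. \<forall>k\<ge>3. \<forall>z\<in>upper_half_plane. bergman_norm \<Gamma> k z z \<le> C' * real k powr (3/2)"
    proof (intro exI allI impI ballI)
      fix k :: nat and z assume k: "k \<ge> 3" and z: "z \<in> upper_half_plane"
      have "1 \<le> sqrt (real k)" using k by simp
      then have "C \<le> C * sqrt (real k)" using C(1) mult_left_mono[of 1 "sqrt (real k)" C] by simp
      then have "real k * (sqrt (real k) + C) \<le> real k * (sqrt (real k) + C * sqrt (real k))"
        by (intro mult_left_mono add_left_mono) auto
      also have "\<dots> = (1 + C) * real k powr (3/2)" using k by (simp add: powr algebra_simps)
      finally have "real k * (sqrt (real k) + C) \<le> (1 + C) * real k powr (3/2)" .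
      moreover have "bergman_norm \<Gamma> k z z \<le> real k * (sqrt (real k) + C)" using C(2)[of z k] k z by simp
      ultimately show "bergman_norm \<Gamma> k z z \<le> (1 + C) * real k powr (3/2)" by (rule order_trans[rotated])
    qed
    show "(\<exists>k0. \<forall>k\<ge>k0. \<forall>z\<in>upper_half_plane. bergman_norm \<Gamma> k z z \<le> 2 * real k powr (3/2)) \<and>
        (\<exists>C'. \<forall>k\<ge>3. \<forall>z\<in>upper_half_plane. bergman_norm \<Gamma> k z z \<le> C' * real k powr (3/2))"
      using large all by (rule conjI)
  qed
qed

end
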